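(* Let $(M,\mathcal{F},g)$ be a compact connected foliated Riemannian manifold, let $G\subset M$ be a dense subset, and let $(f_n)_{n\in\mathbb{N}}$, $f_n:M\to(0,1)$, be a sequence of warping functions on $M$ such that $f_n(x)\to 0$ for every $x\in G$. Then the Gromov–Hausdorff limit of the sequence of warped foliations $M_{f_n}=(M,\mathcal{F},g_{f_n})$ (each regarded as a compact metric space with the Riemannian distance of $g_{f_n}$) is isometric to the Hausdorff leaf space $\mathrm{HLS}(\mathcal{F})$ of $(M,\mathcal{F},g)$.
   Context: Hausdorff leaf space: for a compact connected foliated Riemannian manifold $(M,\mathcal{F},g)$ with Riemannian distance $d$ and set of leaves $\mathcal{L}$, put $\mathrm{dist}(L,L')=\inf\{d(x,y):x\in L,\,y\in L'\}$ and $$\rho(L,L')=\inf\Big\{\sum_{i=1}^{n-1}\mathrm{dist}(L_i,L_{i+1})\Big\},$$ the infimum being over all finite sequences of leaves $L_1,\dots,L_n$ with $L_1=L$, $L_n=L'$. Put $L\sim L'$ iff $\rho(L,L')=0$, $\tilde{\mathcal{L}}=\mathcal{L}/_\sim$ and $\tilde\rho([L],[L'])=\rho(L,L')$. The metric space $(\tilde{\mathcal{L}},\tilde\rho)$ is the Hausdorff leaf space $\mathrm{HLS}(\mathcal{F})$. Warped foliation: a warping function is a smooth positive function $f:M\to(0,\infty)$ that is constant along the leaves of $\mathcal{F}$ (a basic function). The Riemannian metric $g_f$ is defined by $g_f(v,w)=f^2g(v,w)$ if both $v,w$ are tangent to $\mathcal{F}$, and $g_f(v,w)=g(v,w)$ if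 at least one of $v,w$ is perpendicular to $\mathcal{F}$ (with respect to $g$). The warped foliation $M_f$ is $(M,\mathcal{F},g_f)$. *)

theory Defs
  imports "HOL-Analysis.Analysis"
begin

section \<open>Smooth foliated manifolds\<close>

text \<open>\<open>S\<close> is meant to be open. In finite dimension, continuity of all iterated directional
  derivatives up to order \<open>k\<close> is the usual notion of a function of class \<open>C\<^sup>k\<close>.\<close>

primrec Ck_on ::
  "nat \<Rightarrow> 'e::real_normed_vector set \<Rightarrow> ('e \<Rightarrow> 'f::real_normed_vector) \<Rightarrow> bool"
where
  "Ck_on 0 S h \<longleftrightarrow> continuous_on S h"
| "Ck_on (Suc k) S h \<longleftrightarrow>
     (\<forall>x\<in>S. h differentiable (at x)) \<and> (\<forall>v. Ck_on k S (\<lambda>x. frechet_derivative h (at x) v))"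

definition smooth_on ::
  "'e::real_normed_vector set \<Rightarrow> ('e \<Rightarrow> 'f::real_normed_vector) \<Rightarrow> bool"
where
  "smooth_on S h \<longleftrightarrow> (\<forall>k. Ck_on k S h)"

text \<open>A chart is a domain together with a coordinate map, whose values off the domain are
  irrelevant.\<close>

type_synonym ('a, 'e) chart = "'a set \<times> ('a \<Rightarrow> 'e)"

definition chart_inv :: "('a, 'e) chart \<Rightarrow> 'e \<Rightarrow> 'a" where
  "chart_inv c = inv_into (fst c) (snd c)"

definition transition :: "('a, 'e) chart \<Rightarrow> ('a, 'e) chart \<Rightarrow> 'e \<Rightarrow> 'e" where
  "transition c c' = snd c' \<circ> chart_inv c"

definition smooth_atlas :: "'a topology \<Rightarrow> ('a, 'e::euclidean_space) chart set \<Rightarrow> bool" where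
  "smooth_atlas X A \<longleftrightarrow>
     \<Union>(fst ` A) = topspace X \<and>
     (\<forall>(U, \<phi>)\<in>A. openin X U \<and> open (\<phi> ` U) \<and>
        homeomorphic_map (subtopology X U) (top_of_set (\<phi> ` U)) \<phi>) \<and>
     (\<forall>c\<in>A. \<forall>c'\<in>A. smooth_on (snd c ` (fst c \<inter> fst c')) (transition c c'))"

text \<open>The leaf directions of the model space are given by a linear subspace \<open>T\<close>, so two points of
  the model have the same transverse coordinates iff their difference lies in \<open>T\<close>. Hence the
  dimension of the foliation is \<open>dim T\<close> and its codimension \<open>DIM('e) - dim T\<close>. The condition on
  transition maps is that they are locally of the form \<open>(x, y) \<mapsto> (a(x, y), b(y))\<close>,
  where \<open>y\<close> denotes the transverse coordinates.\<close>

definition foliated_atlas ::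
  "'a topology \<Rightarrow> ('a, 'e::euclidean_space) chart set \<Rightarrow> 'e set \<Rightarrow> bool"
where
  "foliated_atlas X A T \<longleftrightarrow>
     smooth_atlas X A \<and> subspace T \<and>
     (\<forall>c\<in>A. \<forall>c'\<in>A. \<forall>z \<in> snd c ` (fst c \<inter> fst c').
        \<exists>W. open W \<and> z \<in> W \<and> W \<subseteq> snd c ` (fst c \<inter> fst c') \<and>
            (\<forall>w\<in>W. \<forall>w'\<in>W. w - w' \<in> T \<longrightarrow> transition c c' w - transition c c' w' \<in> T))"

definition foliated_manifold ::
  "'a topology \<Rightarrow> ('a, 'e::euclidean_space) chart set \<Rightarrow> 'e set \<Rightarrow> bool"
where
  "foliated_manifold X A T \<longleftrightarrow>
     topspace X \<noteq> {} \<and> Hausdorff_space X \<and> second_countable X \<and> foliated_atlas X A T"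

text \<open>Plaques are the connected components of the slices of the charts by translates of \<open>T\<close>, and a
  leaf consists of all the points reachable from a given one by a finite chain of plaques.\<close>

definition same_plaque :: "('a, 'e::euclidean_space) chart set \<Rightarrow> 'e set \<Rightarrow> ('a \<times> 'a) set" where
  "same_plaque A T =
     {(x, y). \<exists>(U, \<phi>)\<in>A. x \<in> U \<and> y \<in> U \<and>
        connected_component (\<phi> ` U \<inter> (\<lambda>v. \<phi> x + v) ` T) (\<phi> x) (\<phi> y)}"

definition leaves ::
  "'a topology \<Rightarrow> ('a, 'e::euclidean_space) chart set \<Rightarrow> 'e set \<Rightarrow> 'a set set"
where
  "leaves X A T = topspace X // (same_plaque A T)\<^sup>*"


section \<open>Riemannian metrics and the Riemannian distance\<close>

text \<open>Tangent vectors at a point are represented by their coordinates in a chart around it, and a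
  covariant 2-tensor \<open>g\<close> by its local expressions: \<open>g c x v w\<close> is the value on the tangent vectors
  at \<open>x\<close> with coordinates \<open>v\<close>, \<open>w\<close> in the chart \<open>c\<close>. The last clause below is the
  transformation law that makes this independent of the chart.\<close>

type_synonym ('a, 'e) tensor2 = "('a, 'e) chart \<Rightarrow> 'a \<Rightarrow> 'e \<Rightarrow> 'e \<Rightarrow> real"

definition inner_product_form :: "('e::euclidean_space \<Rightarrow> 'e \<Rightarrow> real) \<Rightarrow> bool" where
  "inner_product_form q \<longleftrightarrow>
     bilinear q \<and> (\<forall>v w. q v w = q w v) \<and> (\<forall>v. v \<noteq> 0 \<longrightarrow> 0 < q v v)"

definition riemannian_metric ::
  "('a, 'e::euclidean_space) chart set \<Rightarrow> ('a, 'e) tensor2 \<Rightarrow> bool"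
where
  "riemannian_metric A g \<longleftrightarrow>
     (\<forall>c\<in>A. \<forall>x\<in>fst c. inner_product_form (g c x)) \<and>
     (\<forall>c\<in>A. \<forall>v w. smooth_on (snd c ` fst c) (\<lambda>z. g c (chart_inv c z) v w)) \<and>
     (\<forall>c\<in>A. \<forall>c'\<in>A. \<forall>x \<in> fst c \<inter> fst c'. \<forall>v w.
        g c x v w =
        g c' x (frechet_derivative (transition c c') (at (snd c x)) v)
               (frechet_derivative (transition c c') (at (snd c x)) w))"

definition foliated_riemannian_manifold ::
  "'a topology \<Rightarrow> ('a, 'e::euclidean_space) chart set \<Rightarrow> 'e set \<Rightarrow> ('a, 'e) tensor2 \<Rightarrow> bool"
where
  "foliated_riemannian_manifold X A T g \<longleftrightarrow> foliated_manifold X A T \<and> riemannian_metric A g"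

definition C1_piece :: "('a, 'e::euclidean_space) chart \<Rightarrow> real \<Rightarrow> real \<Rightarrow> (real \<Rightarrow> 'a) \<Rightarrow> bool" where
  "C1_piece c a b \<gamma> \<longleftrightarrow>
     \<gamma> ` {a..b} \<subseteq> fst c \<and>
     (\<exists>D. continuous_on {a..b} D \<and>
        (\<forall>s\<in>{a..b}. ((snd c \<circ> \<gamma>) has_vector_derivative D s) (at s within {a..b})))"

definition piece_length ::
  "('a, 'e::euclidean_space) tensor2 \<Rightarrow> ('a, 'e) chart \<Rightarrow> real \<Rightarrow> real \<Rightarrow> (real \<Rightarrow> 'a) \<Rightarrow> real"
where
  "piece_length g c a b \<gamma> =
     integral {a..b} (\<lambda>s.
       let v = vector_derivative (snd c \<circ> \<gamma>) (at s within {a..b}) in sqrt (g c (\<gamma> s) v v))"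

text \<open>The lengths of the piecewise \<open>C\<^sup>1\<close> curves from \<open>x\<close> to \<open>y\<close>. By compactness of
  \<open>[0, 1]\<close> the subdivision of a curve can always be refined so that each piece lies in one chart
  of the atlas. The pieces are \<open>C\<^sup>1\<close> up to the endpoints, unlike those of
  \<open>piecewise_C1_differentiable_on\<close>, so the speed is integrable.\<close>

definition curve_lengths ::
  "('a, 'e::euclidean_space) chart set \<Rightarrow> ('a, 'e) tensor2 \<Rightarrow> 'a \<Rightarrow> 'a \<Rightarrow> real set"
where
  "curve_lengths A g x y =
     {(\<Sum>i<k. piece_length g (c i) (t i) (t (Suc i)) \<gamma>) | \<gamma> k t c.
        \<gamma> 0 = x \<and> \<gamma> 1 = y \<and> t 0 = 0 \<and> t k = 1 \<and>
        (\<forall>i<k. t i < t (Suc i) \<and> c i \<in> A \<and> C1_piece (c i) (t i) (t (Suc i)) \<gamma>)}"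

definition riemannian_dist ::
  "('a, 'e::euclidean_space) chart set \<Rightarrow> ('a, 'e) tensor2 \<Rightarrow> 'a \<Rightarrow> 'a \<Rightarrow> real"
where
  "riemannian_dist A g x y = Inf (curve_lengths A g x y)"


section \<open>Warped foliations\<close>

definition warping_function ::
  "'a topology \<Rightarrow> ('a, 'e::euclidean_space) chart set \<Rightarrow> 'e set \<Rightarrow> ('a \<Rightarrow> real) \<Rightarrow> bool"
where
  "warping_function X A T f \<longleftrightarrow>
     (\<forall>c\<in>A. smooth_on (snd c ` fst c) (f \<circ> chart_inv c)) \<and>
     (\<forall>x\<in>topspace X. 0 < f x) \<and>
     (\<forall>L\<in>leaves X A T. \<forall>x\<in>L. \<forall>y\<in>L. f x = f y)"

text \<open>The vectors tangent to the foliation are those with coordinates in \<open>T\<close>, in any chart.\<close>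

definition is_warped_form ::
  "'e::euclidean_space set \<Rightarrow> real \<Rightarrow> ('e \<Rightarrow> 'e \<Rightarrow> real) \<Rightarrow> ('e \<Rightarrow> 'e \<Rightarrow> real) \<Rightarrow> bool"
where
  "is_warped_form T r q h \<longleftrightarrow>
     bilinear h \<and>
     (\<forall>v\<in>T. \<forall>w\<in>T. h v w = r\<^sup>2 * q v w) \<and>
     (\<forall>v w. (\<forall>u\<in>T. q v u = 0) \<or> (\<forall>u\<in>T. q w u = 0) \<longrightarrow> h v w = q v w)"

definition warped_metric ::
  "'e::euclidean_space set \<Rightarrow> ('a \<Rightarrow> real) \<Rightarrow> ('a, 'e) tensor2 \<Rightarrow> ('a, 'e) tensor2"
where
  "warped_metric T f g c x = (THE h. is_warped_form T (f x) (g c x) h)"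

lemma orthogonal_decomposition:
  fixes q :: "'e::euclidean_space \<Rightarrow> 'e \<Rightarrow> real"
  assumes q: "inner_product_form q" and T: "subspace T"
  shows "\<exists>u\<in>T. \<forall>w\<in>T. q (v - u) w = 0"
proof -
  have bl: "bilinear q" and sym: "\<And>v w. q v w = q w v" and pos: "\<And>v. v \<noteq> 0 \<Longrightarrow> 0 < q v v"
    using q by (auto simp: inner_product_form_def)
  note bs = bilinear_ladd[OF bl] bilinear_radd[OF bl] bilinear_lmul[OF bl] bilinear_rmul[OF bl]
    bilinear_lsub[OF bl] bilinear_rsub[OF bl] bilinear_lzero[OF bl] bilinear_rzero[OF bl]
  obtain B where B: "B \<subseteq> T" "T = span B" "finite B"
    by (metis T basis_exists finiteI_independent span_subspace)
  have "\<forall>v. \<exists>u\<in>span B. \<forall>w\<in>span B. q (v - u) w = 0" using \<open>finite B\<close>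
  proof (induction B)
    case empty
    show ?case by (auto simp: bs)
  next
    case (insert b B)
    obtain p where p: "\<And>v. p v \<in> span B" "\<And>v w. w \<in> span B \<Longrightarrow> q (v - p v) w = 0"
      using insert.IH by metis
    define b' where "b' = b - p b"
    have b'0: "q b' w = 0" if "w \<in> span B" for w
      using p(2)[OF that] by (simp add: b'_def)
    have sub: "span B \<subseteq> span (insert b B)" by (simp add: span_mono subset_insertI)
    have b'in: "b' \<in> span (insert b B)"
      unfolding b'_def using p(1) sub by (intro span_diff) (auto intro: span_base)
    show ?case
    proof
      fix v
      define k where "k = q v b' / q b' b'"
      define u where "u = p v + k *\<^sub>R b'"
      have u: "u \<in> span (insert b B)"
        unfolding u_def using p(1) sub b'in by (intro span_add span_scale) auto
      have k: "k * q b' b' = q v b'"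
        using pos[of b'] by (cases "b' = 0") (auto simp: k_def bs)
      have "q (v - u) w = 0" if wB: "w \<in> span (insert b B)" for w
      proof -
        obtain m where m: "w - m *\<^sub>R b \<in> span B"
          using wB span_breakdown_eq[of w b B] by blast
        define s where "s = w - m *\<^sub>R b'"
        have "s = (w - m *\<^sub>R b) + m *\<^sub>R p b"
          by (simp add: s_def b'_def scaleR_diff_right)
        then have s: "s \<in> span B" using m p(1) by (simp add: span_add span_scale)
        have w: "w = s + m *\<^sub>R b'" by (simp add: s_def)
        have 1: "q (v - u) s = 0"
          using p(2)[OF s, of v] b'0[OF s] by (simp add: u_def bs)
        have 2: "q (v - u) b' = 0"
          using k b'0[OF p(1)[of v]] sym[of "p v" b'] by (simp add: u_def bs)
        show ?thesis unfolding w using 1 2 by (simp add: bs)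
      qed
      with u show "\<exists>u\<in>span (insert b B). \<forall>w\<in>span (insert b B). q (v - u) w = 0" by blast
    qed
  qed
  then show ?thesis using B by auto
qed

lemma warped_form_unique_exists:
  fixes q :: "'e::euclidean_space \<Rightarrow> 'e \<Rightarrow> real"
  assumes q: "inner_product_form q" and T: "subspace T"
  shows "\<exists>!h. is_warped_form T r q h"
proof -
  have bl: "bilinear q" and sym: "\<And>v w. q v w = q w v" and pos: "\<And>v. v \<noteq> 0 \<Longrightarrow> 0 < q v v"
    using q by (auto simp: inner_product_form_def)
  note bs = bilinear_ladd[OF bl] bilinear_radd[OF bl] bilinear_lmul[OF bl] bilinear_rmul[OF bl]
    bilinear_lsub[OF bl] bilinear_rsub[OF bl] bilinear_lzero[OF bl] bilinear_rzero[OF bl]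
  obtain p where p: "\<And>v. p v \<in> T" "\<And>v w. w \<in> T \<Longrightarrow> q (v - p v) w = 0"
    using orthogonal_decomposition[OF q T] by metis
  have puniq: "p v = u" if u: "u \<in> T" "\<And>w. w \<in> T \<Longrightarrow> q (v - u) w = 0" for u v
  proof (rule ccontr)
    assume "p v \<noteq> u"
    then have "0 < q (p v - u) (p v - u)" using pos by simp
    moreover have d: "p v - u \<in> T" using p(1) u(1) T by (simp add: subspace_diff)
    moreover have "q (p v - u) (p v - u) = q (v - u) (p v - u) - q (v - p v) (p v - u)"
      by (simp add: bs)
    ultimately show False using u(2)[OF d] p(2)[OF d] by simp
  qed
  have lin: "linear p"
  proof (rule linearI)
    show "p (a + b) = p a + p b" for a b
    proof (rule puniq)
      show "p a + p b \<in> T" using p(1) T by (simp add: subspace_add)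
      show "q (a + b - (p a + p b)) w = 0" if "w \<in> T" for w
        using p(2)[OF that, of a] p(2)[OF that, of b] by (simp add: bs)
    qed
    show "p (k *\<^sub>R a) = k *\<^sub>R p a" for k a
    proof (rule puniq)
      show "k *\<^sub>R p a \<in> T" using p(1) T by (simp add: subspace_scale)
      show "q (k *\<^sub>R a - k *\<^sub>R p a) w = 0" if "w \<in> T" for w
        using p(2)[OF that, of a] by (simp add: bs flip: right_diff_distrib)
    qed
  qed
  define h where "h = (\<lambda>v w. r\<^sup>2 * q (p v) (p w) + q (v - p v) (w - p w))"
  have pT: "p v = v" if "v \<in> T" for v by (rule puniq) (use that bs in auto)
  have pP: "p v = 0" if "\<forall>u\<in>T. q v u = 0" for v
    by (rule puniq) (use that T in \<open>auto simp: subspace_0\<close>)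
  have 1: "is_warped_form T r q h"
    unfolding is_warped_form_def
  proof (intro conjI ballI allI impI)
    show "bilinear h" unfolding bilinear_def h_def
      by (auto intro!: linearI
          simp: linear_add[OF lin] linear_cmul[OF lin] bs algebra_simps)
    show "h v w = r\<^sup>2 * q v w" if "v \<in> T" "w \<in> T" for v w
      using that by (simp add: h_def pT bs)
    show "h v w = q v w" if pp: "(\<forall>u\<in>T. q v u = 0) \<or> (\<forall>u\<in>T. q w u = 0)" for v w
      using pp
    proof
      assume a: "\<forall>u\<in>T. q v u = 0"
      then show ?thesis using p(1)[of w] by (simp add: h_def pP bs)
    next
      assume a: "\<forall>u\<in>T. q w u = 0"
      then have "q (p v) w = 0" using p(1)[of v] sym[of w "p v"] by simp
      with a show ?thesis by (simp add: h_def pP bs)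
    qed
  qed
  have 2: "k = h" if k: "is_warped_form T r q k" for k
  proof (intro ext)
    fix v w
    have kb: "bilinear k"
      and kT: "\<And>v w. v \<in> T \<Longrightarrow> w \<in> T \<Longrightarrow> k v w = r\<^sup>2 * q v w"
      and kP: "\<And>v w. (\<forall>u\<in>T. q v u = 0) \<or> (\<forall>u\<in>T. q w u = 0) \<Longrightarrow> k v w = q v w"
      using k unfolding is_warped_form_def by blast+
    have o: "\<forall>u\<in>T. q (a - p a) u = 0" for a using p(2) by blast
    have "k v w = k (p v + (v - p v)) (p w + (w - p w))" by simp
    also have "\<dots> = k (p v) (p w) + k (p v) (w - p w) + k (v - p v) (p w) + k (v - p v) (w - p w)"
      by (simp only: bilinear_ladd[OF kb] bilinear_radd[OF kb] add_ac)
    also have "\<dots> = r\<^sup>2 * q (p v) (p w) + q (p v) (w - p w) + q (v - p v) (p w)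
        + q (v - p v) (w - p w)"
      using kT[OF p(1) p(1)] kP o by simp
    also have "q (v - p v) (p w) = 0" by (rule p(2)[OF p(1)])
    also have "q (p v) (w - p w) = 0" using p(2)[OF p(1)] sym by simp
    finally show "k v w = h v w" by (simp add: h_def)
  qed
  show ?thesis using 1 2 by blast
qed

corollary warped_metric_is_warped_form:
  assumes "foliated_riemannian_manifold X A T g" "c \<in> A" "x \<in> fst c"
  shows "is_warped_form T (f x) (g c x) (warped_metric T f g c x)"
proof -
  have "\<exists>!h. is_warped_form T (f x) (g c x) h"
    using assms
    by (intro warped_form_unique_exists)
      (auto simp: foliated_riemannian_manifold_def foliated_manifold_def foliated_atlas_def
        riemannian_metric_def)
  then show ?thesis unfolding warped_metric_def by (rule theI')
qed


section \<open>The Hausdorff leaf space\<close>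

text \<open>Here \<open>\<L>\<close> is a set of leaves and \<open>d\<close> a distance on the union of the leaves.\<close>

definition leaf_dist :: "('a \<Rightarrow> 'a \<Rightarrow> real) \<Rightarrow> 'a set \<Rightarrow> 'a set \<Rightarrow> real" where
  "leaf_dist d L L' = Inf {d x y | x y. x \<in> L \<and> y \<in> L'}"

definition leaf_rho ::
  "'a set set \<Rightarrow> ('a \<Rightarrow> 'a \<Rightarrow> real) \<Rightarrow> 'a set \<Rightarrow> 'a set \<Rightarrow> real"
where
  "leaf_rho \<L> d L L' =
     Inf {(\<Sum>i<length Ls - 1. leaf_dist d (Ls ! i) (Ls ! Suc i)) | Ls.
            Ls \<noteq> [] \<and> set Ls \<subseteq> \<L> \<and> hd Ls = L \<and> last Ls = L'}"

definition HLS :: "'a set set \<Rightarrow> ('a \<Rightarrow> 'a \<Rightarrow> real) \<Rightarrow> 'a set set set" where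
  "HLS \<L> d = \<L> // {(L, L'). L \<in> \<L> \<and> L' \<in> \<L> \<and> leaf_rho \<L> d L L' = 0}"

text \<open>By the triangle inequality for \<open>leaf_rho\<close>, the choice of representatives is immaterial.\<close>

definition HLS_dist ::
  "'a set set \<Rightarrow> ('a \<Rightarrow> 'a \<Rightarrow> real) \<Rightarrow> 'a set set \<Rightarrow> 'a set set \<Rightarrow> real"
where
  "HLS_dist \<L> d P Q = leaf_rho \<L> d (SOME L. L \<in> P) (SOME L. L \<in> Q)"


section \<open>Gromov--Hausdorff convergence\<close>

definition hausdorff_dist :: "('z \<Rightarrow> 'z \<Rightarrow> real) \<Rightarrow> 'z set \<Rightarrow> 'z set \<Rightarrow> real" where
  "hausdorff_dist \<delta> S S' =
     Inf {r. 0 < r \<and> (\<forall>s\<in>S. \<exists>s'\<in>S'. \<delta> s s' < r) \<and> (\<forall>s'\<in>S'. \<exists>s\<in>S. \<delta> s s' < r)}"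

definition isometric_embedding ::
  "'a set \<Rightarrow> ('a \<Rightarrow> 'a \<Rightarrow> real) \<Rightarrow> 'z set \<Rightarrow> ('z \<Rightarrow> 'z \<Rightarrow> real) \<Rightarrow> ('a \<Rightarrow> 'z) \<Rightarrow> bool"
where
  "isometric_embedding M d Z \<delta> \<phi> \<longleftrightarrow>
     \<phi> ` M \<subseteq> Z \<and> (\<forall>x\<in>M. \<forall>y\<in>M. \<delta> (\<phi> x) (\<phi> y) = d x y)"

text \<open>The ambient metric space may be shrunk to the union of the two images, so there is no loss of
  generality in taking its points in the sum type.\<close>

definition GH_dist ::
  "'a set \<Rightarrow> ('a \<Rightarrow> 'a \<Rightarrow> real) \<Rightarrow> 'b set \<Rightarrow> ('b \<Rightarrow> 'b \<Rightarrow> real) \<Rightarrow> real"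
where
  "GH_dist M d N e =
     Inf {hausdorff_dist \<delta> (\<phi> ` M) (\<psi> ` N) | (Z :: ('a + 'b) set) \<delta> \<phi> \<psi>.
            Metric_space Z \<delta> \<and> isometric_embedding M d Z \<delta> \<phi> \<and> isometric_embedding N e Z \<delta> \<psi>}"

text \<open>\<open>Metric_space\<close> demands non-negativity and symmetry also off the carrier, where the
  distances defined above are infima of empty sets. Hence the restriction.\<close>

definition dist_on :: "'a set \<Rightarrow> ('a \<Rightarrow> 'a \<Rightarrow> real) \<Rightarrow> 'a \<Rightarrow> 'a \<Rightarrow> real" where
  "dist_on M d x y = (if x \<in> M \<and> y \<in> M then d x y else 0)"

definition compact_metric_space :: "'a set \<Rightarrow> ('a \<Rightarrow> 'a \<Rightarrow> real) \<Rightarrow> bool" where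
  "compact_metric_space M d \<longleftrightarrow>
     M \<noteq> {} \<and> Metric_space M (dist_on M d) \<and>
     compact_space (Metric_space.mtopology M (dist_on M d))"

text \<open>The Gromov--Hausdorff limit of a sequence of compact metric spaces is unique only up to
  isometry; \<open>(N, e)\<close> is the limit, up to isometry, of the spaces \<open>(M n, d n)\<close>.\<close>

definition GH_limit ::
  "(nat \<Rightarrow> 'a set) \<Rightarrow> (nat \<Rightarrow> 'a \<Rightarrow> 'a \<Rightarrow> real) \<Rightarrow> 'b set \<Rightarrow> ('b \<Rightarrow> 'b \<Rightarrow> real) \<Rightarrow> bool"
where
  "GH_limit M d N e \<longleftrightarrow>
     (\<forall>n. compact_metric_space (M n) (d n)) \<and> compact_metric_space N e \<and>
     (\<lambda>n. GH_dist (M n) (d n) N e) \<longlonglongrightarrow> 0"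

end

theory Submission
  imports Defs
begin

text \<open>Write \<open>d\<close> and \<open>d\<^sub>n\<close> for the Riemannian distances of \<open>g\<close> and of the \<open>n\<close>-th warped metric, and
  \<open>L\<^sub>x\<close> for the leaf of \<open>x\<close>. The projection of \<open>M\<close> onto the Hausdorff leaf space distorts \<open>d\<^sub>n\<close> by an amount
  tending to 0, because \<open>\<rho>(L\<^sub>x, L\<^sub>y) \<le> d\<^sub>n(x, y) \<le> d(x, y)\<close> and \<open>d\<^sub>n(x, y)\<close> converges to
  \<open>\<rho>(L\<^sub>x, L\<^sub>y)\<close> uniformly.

  For the lower bound, warping does not shorten the component of a velocity perpendicular to the leaves.
  From a point of a curve one reaches the leaf of a nearby point of the curve by following that component
  in a chart, so along the curve \<open>\<rho>(L\<^sub>x, \<cdot>)\<close> grows at most at the rate of the warped speed.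

  For the upper bound, it suffices that \<open>d\<^sub>n(x, y)\<close> tends to 0 for \<open>x\<close>, \<open>y\<close> in one leaf. Since this
  is an equivalence relation, it suffices to treat the endpoints of a short segment of a plaque. Translate the
  segment slightly in the chart, so that it starts in the dense set \<open>G\<close>: the warping function is constant on the
  translated segment and tends to 0 there, while the two ends have moved by an arbitrarily small amount.
  Uniformity follows from \<open>d\<^sub>n \<le> d\<close> and a finite net.\<close>

section \<open>Charts and continuous metrics\<close>

text \<open>Three obstacles shape the proof. On a leaf that misses \<open>G\<close> the warping
  functions need not tend to 0, so the collapse of that leaf has to be read off its neighbours, and
  it is obtained for two points at a time, not uniformly along a leaf. The function
  \<open>\<rho>(L\<^sub>x, \<cdot>)\<close> is merely Lipschitz and cannot be differentiated along a
  curve; the lower bound rests on a mean value inequality whose hypothesis is a first-order growth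
  estimate in one chart at a time. Finally, no transformation law between charts is established for
  the warped metrics. Lengths and the triangle inequality work with continuous coefficients in each
  chart; positivity of \<open>d\<^sub>n\<close>, where chart changes matter, is inherited from
  \<open>d\<close> through the minimum of the warping function, which compactness makes positive.
  The distortion bound becomes a bound on Gromov-Hausdorff distances by gluing the manifold to the
  leaf space, each point being placed at a small distance from its class.\<close>

locale smooth_manifold =
  fixes X :: "'a topology" and A :: "('a, 'e::euclidean_space) chart set"
  assumes atlas: "smooth_atlas X A"
begin

lemma chart:
  assumes "c \<in> A"
  shows openin_chart: "openin X (fst c)"
    and open_chart_range: "open (snd c ` fst c)"
    and chart_homeomorphic:
      "homeomorphic_map (subtopology X (fst c)) (top_of_set (snd c ` fst c)) (snd c)"
  using atlas assms unfolding smooth_atlas_def by (auto simp: case_prod_beta)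

lemma topspace_chart: "c \<in> A \<Longrightarrow> fst c \<subseteq> topspace X"
  by (simp add: openin_chart openin_subset)

lemma chart_cover:
  assumes "x \<in> topspace X"
  obtains c where "c \<in> A" "x \<in> fst c"
  using assms atlas unfolding smooth_atlas_def by blast

lemma chart_inj: "c \<in> A \<Longrightarrow> inj_on (snd c) (fst c)"
  using homeomorphic_imp_injective_map[OF chart_homeomorphic] topspace_chart
  by (simp add: Int_absorb1)

lemma chart_inv_left [simp]: "c \<in> A \<Longrightarrow> x \<in> fst c \<Longrightarrow> chart_inv c (snd c x) = x"
  by (simp add: chart_inj chart_inv_def)

lemma chart_inv_right [simp]: "z \<in> snd c ` fst c \<Longrightarrow> snd c (chart_inv c z) = z"
  unfolding chart_inv_def by (rule f_inv_into_f)

lemma chart_inv_mem [simp]: "z \<in> snd c ` fst c \<Longrightarrow> chart_inv c z \<in> fst c"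
  unfolding chart_inv_def by (rule inv_into_into)

lemma open_chart_image:
  assumes "c \<in> A" "openin X V"
  shows "open (snd c ` (fst c \<inter> V))"
proof -
  have "openin (subtopology X (fst c)) (fst c \<inter> V)"
    using assms(2) by (metis inf_commute openin_subtopology)
  then have "openin (top_of_set (snd c ` fst c)) (snd c ` (fst c \<inter> V))"
    using homeomorphic_imp_open_map[OF chart_homeomorphic[OF assms(1)]]
    unfolding open_map_def by blast
  then show ?thesis
    using open_chart_range[OF assms(1)] openin_open_trans by blast
qed

lemma openin_chart_preimage:
  assumes "c \<in> A" "open W"
  shows "openin X {x \<in> fst c. snd c x \<in> W}"
proof -
  have "continuous_map (subtopology X (fst c)) (top_of_set (snd c ` fst c)) (snd c)"
    by (simp add: assms chart_homeomorphic homeomorphic_imp_continuous_map)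
  then have "continuous_map (subtopology X (fst c)) euclidean (snd c)"
    by (simp add: continuous_map_in_subtopology)
  then have "openin (subtopology X (fst c)) {x \<in> topspace (subtopology X (fst c)). snd c x \<in> W}"
    using assms(2) openin_continuous_map_preimage open_openin by blast
  moreover have "topspace (subtopology X (fst c)) = fst c"
    by (simp add: Int_absorb1 assms(1) topspace_chart)
  ultimately show ?thesis
    using openin_chart[OF assms(1)] openin_trans_full by fastforce
qed

text \<open>Hausdorffness turns compactness inside one chart into closedness in the whole manifold.
  The complement is then open, so a function that is constant off this set is locally constant
  there, also beyond the edge of the chart.\<close>

lemma closedin_chart_compact:
  assumes "c \<in> A" "Hausdorff_space X" "compact K" "K \<subseteq> snd c ` fst c"
  shows "closedin X {x \<in> fst c. snd c x \<in> K}"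
proof -
  define V where "V = {x \<in> fst c. snd c x \<in> K}"
  have "V \<subseteq> topspace (subtopology X (fst c))"
    using topspace_chart[OF assms(1)] by (auto simp: V_def)
  moreover have "snd c ` V = K" using assms(4) by (auto simp: V_def)
  moreover have "compactin (top_of_set (snd c ` fst c)) K"
    using assms by (simp add: compactin_subtopology)
  ultimately have "compactin (subtopology X (fst c)) V"
    using homeomorphic_map_compactness[OF chart_homeomorphic[OF assms(1)]] by auto
  then show ?thesis
    using assms(2) compactin_imp_closedin compactin_subtopology V_def by blast
qed

lemma chart_neighbourhood:
  assumes "c \<in> A" "x \<in> fst c"
  obtains \<delta> where "\<delta> > 0" "ball (snd c x) \<delta> \<subseteq> snd c ` fst c"
  using open_chart_range[OF assms(1)] assms(2) open_contains_ball by blast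

end

definition speed :: "('a, 'e) tensor2 \<Rightarrow> ('a, 'e) chart \<Rightarrow> 'a \<Rightarrow> 'e \<Rightarrow> real" where
  "speed g c x v = sqrt (g c x v v)"

text \<open>Continuity stands in for smoothness so that a warped metric fits as soon as its
  coefficients are seen to be continuous. Changes of charts enter only through the assumption
  \<open>law\<close> of \<open>dist_pos\<close>.\<close>

locale metric_manifold = smooth_manifold X A
  for X :: "'a topology" and A :: "('a, 'e::euclidean_space) chart set" +
  fixes g :: "('a, 'e) tensor2"
  assumes form: "\<lbrakk>c \<in> A; x \<in> fst c\<rbrakk> \<Longrightarrow> inner_product_form (g c x)"
    and coefficient_continuous:
      "c \<in> A \<Longrightarrow> continuous_on (snd c ` fst c) (\<lambda>z. g c (chart_inv c z) v w)"

section \<open>Inner products and their norms\<close>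

lemma bilinear_expand:
  fixes q :: "'e::euclidean_space \<Rightarrow> 'e \<Rightarrow> real"
  assumes "bilinear q"
  shows "q v w = (\<Sum>i\<in>Basis. \<Sum>j\<in>Basis. (v \<bullet> i) * (w \<bullet> j) * q i j)"
proof -
  have "q v w = q (\<Sum>i\<in>Basis. (v \<bullet> i) *\<^sub>R i) (\<Sum>j\<in>Basis. (w \<bullet> j) *\<^sub>R j)"
    by (simp add: euclidean_representation)
  also have "\<dots> = (\<Sum>(i,j)\<in>Basis \<times> Basis. q ((v \<bullet> i) *\<^sub>R i) ((w \<bullet> j) *\<^sub>R j))"
    by (simp add: assms bilinear_sum)
  also have "\<dots> = (\<Sum>i\<in>Basis. \<Sum>j\<in>Basis. (v \<bullet> i) * (w \<bullet> j) * q i j)"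
    by (simp add: sum.cartesian_product[symmetric] bilinear_lmul[OF assms] bilinear_rmul[OF assms]
        mult_ac)
  finally show ?thesis .
qed

text \<open>A bilinear form is a finite sum over its coefficients, so continuity for constant
  vectors already gives continuity along moving ones.\<close>

lemma continuous_on_form:
  fixes q :: "'t::topological_space \<Rightarrow> 'e::euclidean_space \<Rightarrow> 'e \<Rightarrow> real"
  assumes "\<And>s. s \<in> S \<Longrightarrow> bilinear (q s)" "\<And>i j. continuous_on S (\<lambda>s. q s i j)"
    and "continuous_on S v" "continuous_on S w"
  shows "continuous_on S (\<lambda>s. q s (v s) (w s))"
proof -
  have "continuous_on S (\<lambda>s. \<Sum>i\<in>Basis. \<Sum>j\<in>Basis. (v s \<bullet> i) * (w s \<bullet> j) * q s i j)"
    using assms by (intro continuous_intros)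
  moreover have "q s (v s) (w s) = (\<Sum>i\<in>Basis. \<Sum>j\<in>Basis. (v s \<bullet> i) * (w s \<bullet> j) * q s i j)"
    if "s \<in> S" for s
    by (rule bilinear_expand[OF assms(1)[OF that]])
  ultimately show ?thesis by simp
qed

lemma abs_sqrt_diff_le: "a \<ge> 0 \<Longrightarrow> b \<ge> 0 \<Longrightarrow> \<bar>sqrt a - sqrt b\<bar> \<le> sqrt \<bar>a - b\<bar>"
proof (induction a b rule: linorder_wlog)
  case (le a b)
  have "sqrt b \<le> sqrt a + sqrt (b - a)"
    using sqrt_add_le_add_sqrt[of a "b - a"] le by simp
  with le show ?case by (simp add: abs_minus_commute)
next
  case (sym a b)
  then show ?case by (simp add: abs_minus_commute)
qed

lemma inner_product_form_D:
  assumes "inner_product_form q"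
  shows "bilinear q" "q v w = q w v" "v \<noteq> 0 \<Longrightarrow> 0 < q v v" "0 \<le> q v v"
proof -
  show b: "bilinear q" and "q v w = q w v" and p: "v \<noteq> 0 \<Longrightarrow> 0 < q v v"
    using assms by (auto simp: inner_product_form_def)
  show "0 \<le> q v v"
    using p bilinear_lzero[OF b] by (cases "v = 0") auto
qed

text \<open>On the compact unit sphere the norm of \<open>q\<close> is continuous and positive, so
  it attains extreme values there; homogeneity carries them to all vectors.\<close>

lemma inner_product_form_bounds:
  fixes q :: "'e::euclidean_space \<Rightarrow> 'e \<Rightarrow> real"
  assumes q: "inner_product_form q"
  obtains m K where "m > 0" "K > 0" "\<And>v. m * norm v \<le> sqrt (q v v)" "\<And>v. sqrt (q v v) \<le> K * norm v"
proof -
  let ?S = "sphere 0 1 :: 'e set"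
  let ?f = "\<lambda>v. sqrt (q v v)"
  have b: "bilinear q" by (rule inner_product_form_D(1)[OF q])
  have c: "continuous_on ?S ?f"
    by (subst bilinear_expand[OF b]) (intro continuous_intros)
  have ne: "?S \<noteq> {}" by simp
  obtain a where a: "a \<in> ?S" "\<And>y. y \<in> ?S \<Longrightarrow> ?f a \<le> ?f y"
    using continuous_attains_inf[OF compact_sphere ne c] by blast
  obtain a' where a': "a' \<in> ?S" "\<And>y. y \<in> ?S \<Longrightarrow> ?f y \<le> ?f a'"
    using continuous_attains_sup[OF compact_sphere ne c] by blast
  have pos: "?f y > 0" if "y \<in> ?S" for y
    using inner_product_form_D(3)[OF q, of y] that by (cases "y = 0") auto
  have sc: "?f v = norm v * ?f (v /\<^sub>R norm v)" if "v \<noteq> 0" for v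
  proof -
    have "q (v /\<^sub>R norm v) (v /\<^sub>R norm v) = q v v / (norm v)\<^sup>2"
      by (simp add: bilinear_lmul[OF b] bilinear_rmul[OF b] power2_eq_square divide_inverse)
    then show ?thesis using that by (simp add: real_sqrt_divide)
  qed
  have n: "v /\<^sub>R norm v \<in> ?S" if "v \<noteq> 0" for v using that by simp
  show thesis
  proof
    show "?f a > 0" "?f a' > 0" using pos a a' by auto
    show "?f a * norm v \<le> ?f v" for v
    proof (cases "v = 0")
      case False
      then show ?thesis using sc[OF False] a(2)[OF n[OF False]] by (simp add: mult.commute)
    qed (simp add: bilinear_lzero[OF b])
    show "?f v \<le> ?f a' * norm v" for v
    proof (cases "v = 0")
      case False
      then show ?thesis using sc[OF False] a'(2)[OF n[OF False]] by (simp add: mult.commute)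
    qed (simp add: bilinear_lzero[OF b])
  qed
qed

context metric_manifold
begin

lemma speed_nonneg [simp]: "c \<in> A \<Longrightarrow> x \<in> fst c \<Longrightarrow> 0 \<le> speed g c x v"
  unfolding speed_def using inner_product_form_D(4)[OF form] by simp

lemma speed_scaleR: "c \<in> A \<Longrightarrow> x \<in> fst c \<Longrightarrow> speed g c x (a *\<^sub>R v) = \<bar>a\<bar> * speed g c x v"
  using inner_product_form_D(1)[OF form, of c x]
  by (simp add: speed_def bilinear_lmul bilinear_rmul real_sqrt_mult flip: mult.assoc)

lemma continuous_on_metric:
  assumes "c \<in> A" "continuous_on S z" "z ` S \<subseteq> snd c ` fst c"
    and "continuous_on S v" "continuous_on S w"
  shows "continuous_on S (\<lambda>s. g c (chart_inv c (z s)) (v s) (w s))"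
proof (rule continuous_on_form[OF _ _ assms(4,5)])
  show "bilinear (g c (chart_inv c (z s)))" if "s \<in> S" for s
    using assms that by (intro inner_product_form_D form) auto
  show "continuous_on S (\<lambda>s. g c (chart_inv c (z s)) i j)" for i j
    by (rule continuous_on_compose2[OF coefficient_continuous assms(2,3)]) fact
qed

lemma continuous_on_speed:
  assumes "c \<in> A" "continuous_on S z" "z ` S \<subseteq> snd c ` fst c" "continuous_on S v"
  shows "continuous_on S (\<lambda>s. speed g c (chart_inv c (z s)) (v s))"
  unfolding speed_def using assms by (intro continuous_intros continuous_on_metric)

lemma speed_bounds:
  assumes "c \<in> A" "x \<in> fst c"
  obtains m K where "m > 0" "K > 0"
    "\<And>v. m * norm v \<le> speed g c x v" "\<And>v. speed g c x v \<le> K * norm v"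
  using inner_product_form_bounds[OF form[OF assms]] unfolding speed_def by blast

text \<open>The error is proportional to \<open>norm v\<close>, so one radius serves all vectors and
  the coefficients may be frozen at \<open>x\<close>. The finitely many coefficient differences are
  collected in the continuous function \<open>h\<close>, which vanishes at the centre.\<close>

lemma speed_near:
  assumes c: "c \<in> A" "x \<in> fst c" and "\<epsilon> > 0"
  obtains \<delta> where "\<delta> > 0" "ball (snd c x) \<delta> \<subseteq> snd c ` fst c"
    "\<And>z v. z \<in> ball (snd c x) \<delta> \<Longrightarrow> \<bar>speed g c (chart_inv c z) v - speed g c x v\<bar> \<le> \<epsilon> * norm v"
proof -
  define h where "h z = (\<Sum>i\<in>Basis. \<Sum>j\<in>Basis. \<bar>g c (chart_inv c z) i j - g c x i j\<bar>)" for z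
  have "continuous_on (snd c ` fst c) h"
    unfolding h_def using c by (intro continuous_intros coefficient_continuous)
  then have "isCont h (snd c x)"
    using c open_chart_range by (simp add: continuous_on_eq_continuous_at)
  moreover have "h (snd c x) = 0" using c by (simp add: h_def)
  \<comment> \<open>The square root is only Hoelder continuous of exponent 1/2 at 0, so the
    coefficients are made to agree up to \<open>\<epsilon>\<^sup>2\<close> in order that the speeds
    agree up to \<epsilon>.\<close>
  ultimately obtain \<delta>1 where \<delta>1: "\<delta>1 > 0" "\<And>z. dist z (snd c x) < \<delta>1 \<Longrightarrow> \<bar>h z\<bar> < \<epsilon>\<^sup>2"
    using \<open>\<epsilon> > 0\<close> unfolding continuous_at_eps_delta dist_real_def
    by (metis diff_zero zero_less_power)
  obtain \<delta>2 where \<delta>2: "\<delta>2 > 0" "ball (snd c x) \<delta>2 \<subseteq> snd c ` fst c"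
    using chart_neighbourhood[OF c] .
  show thesis
  proof
    show "min \<delta>1 \<delta>2 > 0" "ball (snd c x) (min \<delta>1 \<delta>2) \<subseteq> snd c ` fst c"
      using \<delta>1 \<delta>2 by auto
    fix z v assume z: "z \<in> ball (snd c x) (min \<delta>1 \<delta>2)"
    then have zU: "z \<in> snd c ` fst c" using \<delta>2 by auto
    let ?q = "g c (chart_inv c z)" and ?p = "g c x"
    have f: "inner_product_form ?q" "inner_product_form ?p" using c zU form by auto
    have "\<bar>?q v v - ?p v v\<bar> = \<bar>\<Sum>i\<in>Basis. \<Sum>j\<in>Basis. (v \<bullet> i) * (v \<bullet> j) * (?q i j - ?p i j)\<bar>"
      unfolding bilinear_expand[OF inner_product_form_D(1)[OF f(1)], of v v]
        bilinear_expand[OF inner_product_form_D(1)[OF f(2)], of v v]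
      by (simp add: sum_subtractf[symmetric] right_diff_distrib)
    also have "\<dots> \<le> (\<Sum>i\<in>Basis. \<Sum>j\<in>Basis. \<bar>(v \<bullet> i) * (v \<bullet> j) * (?q i j - ?p i j)\<bar>)"
      by (intro order_trans[OF sum_abs] sum_mono order_refl)
    also have "\<dots> \<le> (\<Sum>i\<in>Basis. \<Sum>j\<in>Basis. (norm v)\<^sup>2 * \<bar>?q i j - ?p i j\<bar>)"
      by (intro sum_mono)
        (auto simp: abs_mult power2_eq_square Basis_le_norm intro!: mult_mono)
    also have "\<dots> = (norm v)\<^sup>2 * h z" by (simp add: h_def sum_distrib_left)
    also have "\<dots> \<le> (norm v)\<^sup>2 * \<epsilon>\<^sup>2"
      using \<delta>1(2)[of z] z by (intro mult_left_mono) (auto simp: dist_commute)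
    finally have "sqrt \<bar>?q v v - ?p v v\<bar> \<le> sqrt ((\<epsilon> * norm v)\<^sup>2)"
      by (simp add: power_mult_distrib mult.commute)
    also have "\<dots> = \<epsilon> * norm v" using \<open>\<epsilon> > 0\<close> by simp
    finally show "\<bar>speed g c (chart_inv c z) v - speed g c x v\<bar> \<le> \<epsilon> * norm v"
      unfolding speed_def
      using abs_sqrt_diff_le[OF inner_product_form_D(4)[OF f(1)] inner_product_form_D(4)[OF f(2)],
          of v v] by linarith
  qed
qed

end

section \<open>Curves and their lengths\<close>

lemma C1_piece_derivative:
  assumes "C1_piece c a b \<gamma>" "a < b"
  obtains D where "continuous_on {a..b} D" "\<gamma> ` {a..b} \<subseteq> fst c"
    "\<And>s. s \<in> {a..b} \<Longrightarrow> ((snd c \<circ> \<gamma>) has_vector_derivative D s) (at s within {a..b})"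
    "piece_length g c a b \<gamma> = integral {a..b} (\<lambda>s. speed g c (\<gamma> s) (D s))"
proof -
  obtain D where D: "continuous_on {a..b} D" "\<gamma> ` {a..b} \<subseteq> fst c"
    "\<And>s. s \<in> {a..b} \<Longrightarrow> ((snd c \<circ> \<gamma>) has_vector_derivative D s) (at s within {a..b})"
    using assms unfolding C1_piece_def by auto
  have "vector_derivative (snd c \<circ> \<gamma>) (at s within {a..b}) = D s" if "s \<in> {a..b}" for s
    using vector_derivative_within_closed_interval[OF assms(2) that D(3)[OF that]] .
  then have "piece_length g c a b \<gamma> = integral {a..b} (\<lambda>s. speed g c (\<gamma> s) (D s))"
    unfolding piece_length_def speed_def by (intro integral_cong) (simp add: Let_def)
  with D that show ?thesis by blast
qed

text \<open>Derivatives are taken within the closed interval, so changing a curve elsewhere, as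
  concatenation does, affects neither the piece nor its length, even at the endpoints.\<close>

lemma C1_piece_cong:
  assumes "C1_piece c a b \<gamma>" "a < b" "\<And>s. s \<in> {a..b} \<Longrightarrow> \<eta> s = \<gamma> s"
  shows "C1_piece c a b \<eta>" "piece_length g c a b \<eta> = piece_length g c a b \<gamma>"
proof -
  obtain D where D: "continuous_on {a..b} D" "\<gamma> ` {a..b} \<subseteq> fst c"
    "\<And>s. s \<in> {a..b} \<Longrightarrow> ((snd c \<circ> \<gamma>) has_vector_derivative D s) (at s within {a..b})"
    "piece_length g c a b \<gamma> = integral {a..b} (\<lambda>s. speed g c (\<gamma> s) (D s))"
    using C1_piece_derivative[OF assms(1,2)] by metis
  have E: "((snd c \<circ> \<eta>) has_vector_derivative D s) (at s within {a..b})" if "s \<in> {a..b}" for s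
    using D(3)[OF that] by (rule has_vector_derivative_transform[OF that, rotated]) (simp add: assms(3))
  have sub: "\<eta> ` {a..b} \<subseteq> fst c" using D(2) assms(3) by force
  show C: "C1_piece c a b \<eta>"
    unfolding C1_piece_def using sub D(1) E by blast
  have "vector_derivative (snd c \<circ> \<eta>) (at s within {a..b}) = D s" if "s \<in> {a..b}" for s
    using vector_derivative_within_closed_interval[OF assms(2) that E[OF that]] .
  then have "piece_length g c a b \<eta> = integral {a..b} (\<lambda>s. speed g c (\<gamma> s) (D s))"
    unfolding piece_length_def speed_def using assms(3) by (intro integral_cong) (simp add: Let_def)
  with D(4) show "piece_length g c a b \<eta> = piece_length g c a b \<gamma>" by simp
qed

text \<open>Each piece is reparametrised over \<open>[0, 1]\<close>, so that curves can be concatenated and reversed by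
  induction.\<close>

inductive curve_chain ::
  "('a, 'e::euclidean_space) chart set \<Rightarrow> ('a, 'e) tensor2 \<Rightarrow> 'a \<Rightarrow> 'a \<Rightarrow> real \<Rightarrow> bool"
  for A g
where
  single: "\<lbrakk>c \<in> A; C1_piece c 0 1 \<gamma>\<rbrakk>
    \<Longrightarrow> curve_chain A g (\<gamma> 0) (\<gamma> 1) (piece_length g c 0 1 \<gamma>)"
| append: "\<lbrakk>curve_chain A g x (\<gamma> 0) l; c \<in> A; C1_piece c 0 1 \<gamma>\<rbrakk>
    \<Longrightarrow> curve_chain A g x (\<gamma> 1) (l + piece_length g c 0 1 \<gamma>)"

lemma curve_chain_trans:
  assumes "curve_chain A g y z l'" "curve_chain A g x y l"
  shows "curve_chain A g x z (l + l')"
  using assms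
proof induction
  case (append y \<gamma> l' c)
  then have "curve_chain A g x (\<gamma> 1) ((l + l') + piece_length g c 0 1 \<gamma>)"
    by (intro curve_chain.append) auto
  then show ?case by (simp add: add.assoc)
qed (auto intro: curve_chain.append)

section \<open>Reparametrisation, concatenation and reversal of curves\<close>

context metric_manifold
begin

lemma continuous_on_piece_speed:
  assumes "c \<in> A" "continuous_on {a..b} D" "\<gamma> ` {a..b} \<subseteq> fst c"
    "\<And>s. s \<in> {a..b} \<Longrightarrow> ((snd c \<circ> \<gamma>) has_vector_derivative D s) (at s within {a..b})"
  shows "continuous_on {a..b} (\<lambda>s. speed g c (\<gamma> s) (D s))"
proof -
  have "continuous_on {a..b} (snd c \<circ> \<gamma>)"
    using assms(4) has_vector_derivative_continuous continuous_on_eq_continuous_within by blast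
  then have "continuous_on {a..b} (\<lambda>s. speed g c (chart_inv c ((snd c \<circ> \<gamma>) s)) (D s))"
    using assms by (intro continuous_on_speed) auto
  then show ?thesis
  proof (rule continuous_on_eq)
    fix s assume "s \<in> {a..b}"
    then have "\<gamma> s \<in> fst c" using assms(3) by blast
    then show "speed g c (chart_inv c ((snd c \<circ> \<gamma>) s)) (D s) = speed g c (\<gamma> s) (D s)"
      using assms(1) by simp
  qed
qed

text \<open>The slope \<open>m\<close> may be negative: positive slopes rescale pieces for
  subdivision and concatenation, and \<open>m = -1\<close> reverses a piece. The factor
  \<open>\<bar>m\<bar>\<close> from the homogeneity of the speed cancels the one from the
  substitution.\<close>

lemma piece_affine:
  assumes c: "c \<in> A" and C: "C1_piece c a b \<gamma>" and "a < b" "a' < b'" "m \<noteq> 0"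
    and im: "(\<lambda>s. m * s + k) ` {a'..b'} = {a..b}"
  shows "C1_piece c a' b' (\<lambda>s. \<gamma> (m * s + k))"
    and "piece_length g c a' b' (\<lambda>s. \<gamma> (m * s + k)) = piece_length g c a b \<gamma>"
proof -
  obtain D where D: "continuous_on {a..b} D" "\<gamma> ` {a..b} \<subseteq> fst c"
    "\<And>s. s \<in> {a..b} \<Longrightarrow> ((snd c \<circ> \<gamma>) has_vector_derivative D s) (at s within {a..b})"
    "piece_length g c a b \<gamma> = integral {a..b} (\<lambda>s. speed g c (\<gamma> s) (D s))"
    using C1_piece_derivative[OF C \<open>a < b\<close>] by metis
  let ?E = "\<lambda>s. m *\<^sub>R D (m * s + k)"
  have in': "m * s + k \<in> {a..b}" if "s \<in> {a'..b'}" for s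
    using im that by (metis image_eqI)
  have E: "((snd c \<circ> (\<lambda>s. \<gamma> (m * s + k))) has_vector_derivative ?E s) (at s within {a'..b'})"
    if "s \<in> {a'..b'}" for s
  proof -
    have "((\<lambda>s. m * s + k) has_vector_derivative m) (at s within {a'..b'})"
      by (auto intro!: derivative_eq_intros simp: has_real_derivative_iff_has_vector_derivative[symmetric])
    from vector_diff_chain_within[OF this, of "snd c \<circ> \<gamma>" "D (m * s + k)"]
    show ?thesis using D(3)[OF in'[OF that]] by (simp add: im o_def)
  qed
  have cE: "continuous_on {a'..b'} ?E"
    by (intro continuous_intros continuous_on_compose2[OF D(1)]) (use im in auto)
  have sub: "(\<lambda>s. \<gamma> (m * s + k)) ` {a'..b'} \<subseteq> fst c" using D(2) in' by blast
  show C': "C1_piece c a' b' (\<lambda>s. \<gamma> (m * s + k))"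
    unfolding C1_piece_def using sub cE E by blast
  have "vector_derivative (snd c \<circ> (\<lambda>s. \<gamma> (m * s + k))) (at s within {a'..b'}) = ?E s"
    if "s \<in> {a'..b'}" for s
    using vector_derivative_within_closed_interval[OF \<open>a' < b'\<close> that E[OF that]] .
  then have len: "piece_length g c a' b' (\<lambda>s. \<gamma> (m * s + k))
      = integral {a'..b'} (\<lambda>s. speed g c (\<gamma> (m * s + k)) (?E s))"
    unfolding piece_length_def speed_def by (intro integral_cong) (simp add: Let_def)
  have inv: "(\<lambda>x. (1 / m) * x - k / m) ` {a..b} = {a'..b'}"
    unfolding im[symmetric] image_image using \<open>m \<noteq> 0\<close> by (simp add: field_simps)
  have "(\<lambda>s. speed g c (\<gamma> s) (D s)) integrable_on {a..b}"
    using continuous_on_piece_speed[OF c D(1-3)] integrable_continuous_real by blast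
  then have "((\<lambda>s. speed g c (\<gamma> s) (D s)) has_integral piece_length g c a b \<gamma>) (cbox a b)"
    unfolding D(4) by (simp add: integrable_integral)
  from has_integral_affinity[OF this \<open>m \<noteq> 0\<close>, of k]
  have "((\<lambda>s. speed g c (\<gamma> (m * s + k)) (D (m * s + k))) has_integral
      (1 / \<bar>m\<bar>) * piece_length g c a b \<gamma>) {a'..b'}"
    using inv by simp
  from has_integral_mult_right[OF this, of "\<bar>m\<bar>"]
  have "((\<lambda>s. \<bar>m\<bar> * speed g c (\<gamma> (m * s + k)) (D (m * s + k))) has_integral
      piece_length g c a b \<gamma>) {a'..b'}"
    using \<open>m \<noteq> 0\<close> by simp
  moreover have "\<bar>m\<bar> * speed g c (\<gamma> (m * s + k)) (D (m * s + k)) = speed g c (\<gamma> (m * s + k)) (?E s)"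
    if "s \<in> {a'..b'}" for s
    using speed_scaleR[OF c, of "\<gamma> (m * s + k)" m "D (m * s + k)"] D(2) in'[OF that]
    by (metis image_subset_iff)
  ultimately have "((\<lambda>s. speed g c (\<gamma> (m * s + k)) (?E s)) has_integral
      piece_length g c a b \<gamma>) {a'..b'}"
    by (rule has_integral_eq[rotated]) auto
  then show "piece_length g c a' b' (\<lambda>s. \<gamma> (m * s + k)) = piece_length g c a b \<gamma>"
    unfolding len by (rule integral_unique)
qed

lemma piece_length_nonneg:
  assumes "c \<in> A" "C1_piece c a b \<gamma>" "a < b"
  shows "0 \<le> piece_length g c a b \<gamma>"
proof -
  obtain D where D: "continuous_on {a..b} D" "\<gamma> ` {a..b} \<subseteq> fst c"
    "\<And>s. s \<in> {a..b} \<Longrightarrow> ((snd c \<circ> \<gamma>) has_vector_derivative D s) (at s within {a..b})"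
    "piece_length g c a b \<gamma> = integral {a..b} (\<lambda>s. speed g c (\<gamma> s) (D s))"
    using C1_piece_derivative[OF assms(2,3)] by metis
  have "(\<lambda>s. speed g c (\<gamma> s) (D s)) integrable_on {a..b}"
    using continuous_on_piece_speed[OF assms(1) D(1-3)] integrable_continuous_real by blast
  then show ?thesis
    unfolding D(4) using D(2) assms(1) by (intro integral_nonneg speed_nonneg) (auto simp: image_subset_iff)
qed

lemma curve_lengths_imp_chain:
  assumes "l \<in> curve_lengths A g x y"
  shows "curve_chain A g x y l"
proof -
  obtain \<gamma> k t c where *: "\<gamma> 0 = x" "\<gamma> 1 = y" "t 0 = 0" "t k = 1"
    "\<And>i. i < k \<Longrightarrow> t i < t (Suc i) \<and> c i \<in> A \<and> C1_piece (c i) (t i) (t (Suc i)) \<gamma>"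
    "l = (\<Sum>i<k. piece_length g (c i) (t i) (t (Suc i)) \<gamma>)"
    using assms unfolding curve_lengths_def mem_Collect_eq by blast
  let ?\<eta> = "\<lambda>i s. \<gamma> ((t (Suc i) - t i) * s + t i)"
  have piece: "C1_piece (c i) 0 1 (?\<eta> i)"
    "piece_length g (c i) 0 1 (?\<eta> i) = piece_length g (c i) (t i) (t (Suc i)) \<gamma>" if "i < k" for i
  proof -
    have "(\<lambda>s. (t (Suc i) - t i) * s + t i) ` {0..1} = {t i..t (Suc i)}"
      using *(5)[OF that] by (subst image_affinity_atLeastAtMost) auto
    then show "C1_piece (c i) 0 1 (?\<eta> i)"
      "piece_length g (c i) 0 1 (?\<eta> i) = piece_length g (c i) (t i) (t (Suc i)) \<gamma>"
      using *(5)[OF that] piece_affine[of "c i" "t i" "t (Suc i)" \<gamma> 0 1 "t (Suc i) - t i" "t i"]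
      by auto
  qed
  have step: "i < k \<Longrightarrow> curve_chain A g (\<gamma> 0) (\<gamma> (t (Suc i)))
      (\<Sum>j<Suc i. piece_length g (c j) (t j) (t (Suc j)) \<gamma>)" for i
  proof (induction i)
    case 0
    then show ?case using curve_chain.single[OF _ piece(1)[OF 0], of A g] *(5)[OF 0] piece(2)[OF 0] *(3) by simp
  next
    case (Suc i)
    then have "curve_chain A g (\<gamma> 0) (?\<eta> (Suc i) 0)
      (\<Sum>j<Suc i. piece_length g (c j) (t j) (t (Suc j)) \<gamma>)" by simp
    from curve_chain.append[OF this _ piece(1)[OF Suc.prems]]
    show ?case using *(5)[OF Suc.prems] piece(2)[OF Suc.prems] by simp
  qed
  obtain k' where k': "k = Suc k'" using *(3,4) by (cases k) auto
  show ?thesis using step[of k'] *(1,2,4,6) unfolding k' by simp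
qed

lemma chain_imp_curve_lengths:
  assumes "curve_chain A g x y l"
  shows "l \<in> curve_lengths A g x y"
  using assms
proof induction
  case (single c \<gamma>)
  show ?case
    unfolding curve_lengths_def mem_Collect_eq
    by (rule exI[of _ \<gamma>], rule exI[of _ "Suc 0"], rule exI[of _ real], rule exI[of _ "\<lambda>_. c"])
      (simp add: single)
next
  case (append x \<eta> l c)
  obtain \<gamma> k t c0 where *: "\<gamma> 0 = x" "\<gamma> 1 = \<eta> 0" "t 0 = 0" "t k = 1"
    "\<And>i. i < k \<Longrightarrow> t i < t (Suc i) \<and> c0 i \<in> A \<and> C1_piece (c0 i) (t i) (t (Suc i)) \<gamma>"
    "l = (\<Sum>i<k. piece_length g (c0 i) (t i) (t (Suc i)) \<gamma>)"
    using append.IH unfolding curve_lengths_def mem_Collect_eq by blast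
  \<comment> \<open>The old curve runs at double speed on the first half, the new piece on the
    second. The trivial summand \<open>+ 0\<close> gives the argument the form that
    \<open>piece_affine\<close> expects.\<close>
  define \<gamma>' where "\<gamma>' s = (if s \<le> 1/2 then \<gamma> (2 * s + 0) else \<eta> (2 * s + (-1)))" for s :: real
  \<comment> \<open>As \<open>t k = 1\<close>, the halved partition ends at 1/2; the one extra point
    1 has index \<open>Suc k\<close>.\<close>
  define t' where "t' i = (if i \<le> k then t i / 2 else 1)" for i
  define c' where "c' i = (if i < k then c0 i else c)" for i
  have mono: "i \<le> k \<Longrightarrow> t i \<le> 1" for i
  proof (induction rule: inc_induct)
    case (step n)
    then show ?case using *(5)[of n] by auto
  qed (use * in auto)
  have p1: "C1_piece (c' i) (t' i) (t' (Suc i)) \<gamma>'"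
    "piece_length g (c' i) (t' i) (t' (Suc i)) \<gamma>' = piece_length g (c0 i) (t i) (t (Suc i)) \<gamma>"
    "t' i < t' (Suc i)"
    if "i < k" for i
  proof -
    note i = *(5)[OF that]
    have "(\<lambda>s. 2 * s + 0) ` {t i / 2..t (Suc i) / 2} = {t i..t (Suc i)}"
      using i by (subst image_affinity_atLeastAtMost) auto
    then have a: "C1_piece (c0 i) (t i / 2) (t (Suc i) / 2) (\<lambda>s. \<gamma> (2 * s + 0))"
      "piece_length g (c0 i) (t i / 2) (t (Suc i) / 2) (\<lambda>s. \<gamma> (2 * s + 0))
        = piece_length g (c0 i) (t i) (t (Suc i)) \<gamma>"
      using i piece_affine[of "c0 i" "t i" "t (Suc i)" \<gamma> "t i / 2" "t (Suc i) / 2" 2 0] by auto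
    have eq: "\<gamma>' s = \<gamma> (2 * s + 0)" if "s \<in> {t i / 2..t (Suc i) / 2}" for s
      using that mono[of "Suc i"] \<open>i < k\<close> by (auto simp: \<gamma>'_def)
    have lt: "t i / 2 < t (Suc i) / 2" using i by simp
    show "C1_piece (c' i) (t' i) (t' (Suc i)) \<gamma>'"
      "piece_length g (c' i) (t' i) (t' (Suc i)) \<gamma>' = piece_length g (c0 i) (t i) (t (Suc i)) \<gamma>"
      "t' i < t' (Suc i)"
      using C1_piece_cong[OF a(1) lt eq] a(2) that lt by (auto simp: c'_def t'_def)
  qed
  have p2: "C1_piece (c' k) (t' k) (t' (Suc k)) \<gamma>'"
    "piece_length g (c' k) (t' k) (t' (Suc k)) \<gamma>' = piece_length g c 0 1 \<eta>"
  proof -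
    have "(\<lambda>s. 2 * s + (-1)) ` {1/2..1} = {0..1::real}"
      by (subst image_affinity_atLeastAtMost) auto
    then have a: "C1_piece c (1/2) 1 (\<lambda>s. \<eta> (2 * s + (-1)))"
      "piece_length g c (1/2) 1 (\<lambda>s. \<eta> (2 * s + (-1))) = piece_length g c 0 1 \<eta>"
      using append piece_affine[of c 0 1 \<eta> "1/2" 1 2 "-1"] by auto
    \<comment> \<open>At the junction \<open>\<gamma>'\<close> is given by the first branch; the two
      formulas agree there because \<open>\<gamma> 1 = \<eta> 0\<close>.\<close>
    have eq: "\<gamma>' s = \<eta> (2 * s + (-1))" if "s \<in> {1/2..1}" for s
    proof (cases "s = 1/2")
      case True
      then show ?thesis using *(2) by (simp add: \<gamma>'_def \<open>s = 1/2\<close>)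
    qed (use that in \<open>auto simp: \<gamma>'_def\<close>)
    show "C1_piece (c' k) (t' k) (t' (Suc k)) \<gamma>'"
      "piece_length g (c' k) (t' k) (t' (Suc k)) \<gamma>' = piece_length g c 0 1 \<eta>"
      using C1_piece_cong[OF a(1) _ eq] a(2) *(4) by (auto simp: c'_def t'_def)
  qed
  have "\<gamma>' 0 = x" "\<gamma>' 1 = \<eta> 1" "t' 0 = 0" "t' (Suc k) = 1"
    using *(1,3) by (simp_all add: \<gamma>'_def t'_def)
  moreover have "t' i < t' (Suc i) \<and> c' i \<in> A \<and> C1_piece (c' i) (t' i) (t' (Suc i)) \<gamma>'"
    if "i < Suc k" for i
  proof (cases "i = k")
    case True
    then show ?thesis using p2(1) append.hyps *(4) by (simp add: t'_def c'_def)
  next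
    case False
    with that have "i < k" by simp
    then show ?thesis using p1(1,3)[of i] *(5)[of i] by (simp add: c'_def)
  qed
  moreover have "l + piece_length g c 0 1 \<eta> =
      (\<Sum>i<Suc k. piece_length g (c' i) (t' i) (t' (Suc i)) \<gamma>')"
    using *(6) p1(2) p2(2) by simp
  ultimately show ?case
    unfolding curve_lengths_def mem_Collect_eq
    by (intro exI[of _ \<gamma>'] exI[of _ "Suc k"] exI[of _ t'] exI[of _ c']) simp
qed

lemma curve_lengths_eq: "curve_lengths A g x y = {l. curve_chain A g x y l}"
  using curve_lengths_imp_chain chain_imp_curve_lengths by blast

lemma curve_chain_sym:
  assumes "curve_chain A g x y l" shows "curve_chain A g y x l"
proof -
  have rev: "curve_chain A g (\<gamma> 1) (\<gamma> 0) (piece_length g c 0 1 \<gamma>)"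
    if c: "c \<in> A" "C1_piece c 0 1 \<gamma>" for c \<gamma>
  proof -
    have "(\<lambda>s. (-1) * s + 1) ` {0..1} = {0..1::real}"
      by (subst image_affinity_atLeastAtMost) auto
    note a = piece_affine[OF c zero_less_one zero_less_one _ this]
    show ?thesis
      using curve_chain.single[OF c(1), of "\<lambda>s. \<gamma> ((-1) * s + 1)" g] a by simp
  qed
  show ?thesis using assms
  proof induction
    case (append x \<gamma> l c)
    then have "curve_chain A g (\<gamma> 1) x (piece_length g c 0 1 \<gamma> + l)"
      by (intro curve_chain_trans[of A g "\<gamma> 0"] rev)
    then show ?case by (simp add: add.commute)
  qed (rule rev)
qed

lemma curve_chain_nonneg: "curve_chain A g x y l \<Longrightarrow> 0 \<le> l"
  by (induction rule: curve_chain.induct) (simp_all add: piece_length_nonneg)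

text \<open>A mean value inequality for a function that need not be differentiable. Near every
  parameter the increments of \<open>F\<close> and of the arc length \<open>I\<close> are compared
  to first order (\<open>Fl\<close> and \<open>Il\<close>), and bisection adds the local
  inequalities up along the interval.\<close>

lemma piece_compare:
  fixes F :: "'a \<Rightarrow> real"
  assumes c: "c \<in> A" and C: "C1_piece c 0 1 \<gamma>"
    and F: "\<And>p \<epsilon>. p \<in> fst c \<Longrightarrow> \<epsilon> > 0 \<Longrightarrow> \<exists>\<delta>>0. \<forall>q\<in>fst c. norm (snd c q - snd c p) < \<delta> \<longrightarrow>
      \<bar>F q - F p\<bar> \<le> speed g c p (snd c q - snd c p) + \<epsilon> * norm (snd c q - snd c p)"
  shows "\<bar>F (\<gamma> 1) - F (\<gamma> 0)\<bar> \<le> piece_length g c 0 1 \<gamma>"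
proof -
  obtain D where D: "continuous_on {0..1} D" "\<gamma> ` {0..1} \<subseteq> fst c"
    "\<And>s. s \<in> {0..1} \<Longrightarrow> ((snd c \<circ> \<gamma>) has_vector_derivative D s) (at s within {0..1})"
    "piece_length g c 0 1 \<gamma> = integral {0..1} (\<lambda>s. speed g c (\<gamma> s) (D s))"
    using C1_piece_derivative[OF C zero_less_one, where g = g] by blast
  define \<sigma> where "\<sigma> s = speed g c (\<gamma> s) (D s)" for s
  define I where "I s = integral {0..s} \<sigma>" for s
  have \<sigma>: "continuous_on {0..1} \<sigma>"
    unfolding \<sigma>_def by (rule continuous_on_piece_speed[OF c D(1-3)])
  have Fl: "\<exists>d>0. \<forall>s'\<in>{0..1}. \<bar>s' - s\<bar> < d \<longrightarrow> \<bar>F (\<gamma> s') - F (\<gamma> s)\<bar> \<le> \<bar>s' - s\<bar> * (\<sigma> s + e)"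
    if s: "s \<in> {0..1}" and "e > 0" for s e
  proof -
    let ?p = "\<gamma> s"
    \<comment> \<open>Close to \<open>s\<close> the displacement is at most
      \<open>\<bar>s' - s\<bar> * ?n\<close>, so dividing the tolerance by \<open>?n\<close> makes
      the error at most \<open>e / 2\<close> per unit of time. The 1 keeps \<open>?n\<close>
      positive where the velocity vanishes.\<close>
    let ?n = "norm (D s) + 1"
    have p: "?p \<in> fst c" using D(2) s by auto
    have n: "?n > 0" using norm_ge_zero[of "D s"] by linarith
    obtain \<delta> where \<delta>: "\<delta> > 0" "\<And>q. q \<in> fst c \<Longrightarrow> norm (snd c q - snd c ?p) < \<delta> \<Longrightarrow>
      \<bar>F q - F ?p\<bar> \<le> speed g c ?p (snd c q - snd c ?p) + e / 2 / ?n * norm (snd c q - snd c ?p)"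
      using F[OF p, of "e / 2 / ?n"] \<open>e > 0\<close> n by auto
    \<comment> \<open>The other half of \<open>e\<close> pays for replacing the derivative by the
      difference quotient inside the speed at \<open>?p\<close>.\<close>
    have "continuous_on UNIV (\<lambda>v. speed g c (chart_inv c (snd c ?p)) v)"
      using c p by (intro continuous_on_speed) (auto intro: continuous_intros)
    then have "isCont (speed g c ?p) (D s)"
      using c p by (simp add: continuous_on_eq_continuous_at)
    then obtain r where r: "r > 0"
      "\<And>v. norm (v - D s) < r \<Longrightarrow> \<bar>speed g c ?p v - speed g c ?p (D s)\<bar> < e / 2"
      using \<open>e > 0\<close> unfolding continuous_at_eps_delta by (metis dist_norm dist_real_def half_gt_zero)
    define \<eta> where "\<eta> = min (r / 2) 1"
    have \<eta>: "\<eta> > 0" "\<eta> < r" "\<eta> \<le> 1" using r(1) by (auto simp: \<eta>_def)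
    obtain d where d: "d > 0" "\<And>s'. s' \<in> {0..1} \<Longrightarrow> \<bar>s' - s\<bar> < d \<Longrightarrow>
        norm (snd c (\<gamma> s') - snd c ?p - (s' - s) *\<^sub>R D s) \<le> \<eta> * \<bar>s' - s\<bar>"
      using D(3)[OF s] \<eta>(1) unfolding has_vector_derivative_def has_derivative_within_alt
      by (auto simp: o_def)
    have "\<bar>F (\<gamma> s') - F ?p\<bar> \<le> \<bar>s' - s\<bar> * (\<sigma> s + e)"
      if s': "s' \<in> {0..1}" "\<bar>s' - s\<bar> < min d (\<delta> / ?n)" for s'
    proof (cases "s' = s")
      case False
      define h where "h = s' - s"
      define w where "w = snd c (\<gamma> s') - snd c ?p"
      have h: "h \<noteq> 0" using False by (simp add: h_def)
      have w: "norm (w - h *\<^sub>R D s) \<le> \<eta> * \<bar>h\<bar>"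
        using d(2)[OF s'(1)] s'(2) by (simp add: w_def h_def)
      have "norm w \<le> norm (h *\<^sub>R D s) + norm (w - h *\<^sub>R D s)"
        using norm_triangle_ineq[of "h *\<^sub>R D s" "w - h *\<^sub>R D s"] by simp
      also have "\<dots> \<le> \<bar>h\<bar> * norm (D s) + 1 * \<bar>h\<bar>"
        using w mult_right_mono[OF \<eta>(3) abs_ge_zero[of h]] by simp
      finally have nw: "norm w \<le> \<bar>h\<bar> * ?n" by (simp add: algebra_simps)
      also have "\<dots> < \<delta>" using s'(2) n by (simp add: h_def pos_less_divide_eq)
      finally have "norm w < \<delta>" .
      then have 1: "\<bar>F (\<gamma> s') - F ?p\<bar> \<le> speed g c ?p w + e / 2 / ?n * norm w"
        using \<delta>(2)[of "\<gamma> s'"] D(2) s'(1) unfolding w_def by (metis image_subset_iff)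
      have "w /\<^sub>R h - D s = (w - h *\<^sub>R D s) /\<^sub>R h" using h by (simp add: scaleR_diff_right)
      then have "norm (w /\<^sub>R h - D s) = norm (w - h *\<^sub>R D s) / \<bar>h\<bar>"
        by (simp add: divide_inverse mult.commute)
      also have "\<dots> \<le> \<eta>" using w h by (simp add: pos_divide_le_eq)
      finally have "speed g c ?p (w /\<^sub>R h) \<le> \<sigma> s + e / 2"
        using r(2)[of "w /\<^sub>R h"] \<eta>(2) unfolding \<sigma>_def by linarith
      then have "\<bar>h\<bar> * speed g c ?p (w /\<^sub>R h) \<le> \<bar>h\<bar> * (\<sigma> s + e / 2)"
        by (intro mult_left_mono) auto
      moreover have "\<bar>h\<bar> * speed g c ?p (w /\<^sub>R h) = speed g c ?p w"
        using speed_scaleR[OF c p, of h "w /\<^sub>R h"] h by simp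
      moreover have "e / 2 / ?n * norm w \<le> e / 2 / ?n * (\<bar>h\<bar> * ?n)"
        using nw \<open>e > 0\<close> n by (intro mult_left_mono) auto
      moreover have "e / 2 / k * (\<bar>h\<bar> * k) = \<bar>h\<bar> * (e / 2)" if "k > 0" for k
        using that by simp
      note this[OF n]
      ultimately have "\<bar>F (\<gamma> s') - F ?p\<bar> \<le> \<bar>h\<bar> * (\<sigma> s + e / 2) + \<bar>h\<bar> * (e / 2)"
        using 1 by linarith
      also have "\<dots> = \<bar>h\<bar> * (\<sigma> s + e)" by (simp add: algebra_simps)
      finally show ?thesis by (simp add: h_def)
    qed simp
    moreover have "min d (\<delta> / ?n) > 0" using d(1) \<delta>(1) n by simp
    ultimately show ?thesis by blast
  qed
  have Il: "\<exists>d>0. \<forall>s'\<in>{0..1}. \<bar>s' - s\<bar> < d \<longrightarrow> \<bar>I s' - I s - (s' - s) * \<sigma> s\<bar> \<le> e * \<bar>s' - s\<bar>"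
    if s: "s \<in> {0..1}" and "e > 0" for s e
    using integral_has_vector_derivative[OF \<sigma> s] \<open>e > 0\<close>
    unfolding has_vector_derivative_def has_derivative_within_alt I_def by auto
  have "\<bar>F (\<gamma> 1) - F (\<gamma> 0)\<bar> \<le> I 1 - I 0 + e" if "e > 0" for e
  proof -
    \<comment> \<open>Both \<open>I b - I a\<close> and the slack \<open>e * (b - a)\<close> are
      additive, so the inequality passes from two adjacent intervals to their union. The guard makes
      it vacuous outside the unit interval.\<close>
    define P where "P a b \<longleftrightarrow> (0 \<le> a \<and> b \<le> 1 \<longrightarrow> \<bar>F (\<gamma> b) - F (\<gamma> a)\<bar> \<le> I b - I a + e * (b - a))"
      for a b
    have "P 0 1"
    proof (rule Bolzano)
      show "P a c" if "P a b" "P b c" "a \<le> b" "b \<le> c" for a b c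
        using that unfolding P_def by (auto simp: algebra_simps)
      fix s :: real assume "0 \<le> s" "s \<le> 1"
      then have s: "s \<in> {0..1}" by simp
      obtain d1 where d1: "d1 > 0" "\<And>s'. s' \<in> {0..1} \<Longrightarrow> \<bar>s' - s\<bar> < d1 \<Longrightarrow>
          \<bar>F (\<gamma> s') - F (\<gamma> s)\<bar> \<le> \<bar>s' - s\<bar> * (\<sigma> s + e / 2)"
        using Fl[OF s, of "e / 2"] \<open>e > 0\<close> by auto
      obtain d2 where d2: "d2 > 0" "\<And>s'. s' \<in> {0..1} \<Longrightarrow> \<bar>s' - s\<bar> < d2 \<Longrightarrow>
          \<bar>I s' - I s - (s' - s) * \<sigma> s\<bar> \<le> e / 2 * \<bar>s' - s\<bar>"
        using Il[OF s, of "e / 2"] \<open>e > 0\<close> by auto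
      \<comment> \<open>Only intervals around \<open>s\<close> are compared, since both increments
        are measured from \<open>s\<close>. The estimates for \<open>F\<close> and for
        \<open>I\<close> use up \<open>e / 2\<close> each.\<close>
      have "P a b" if ab: "a \<le> s" "s \<le> b" "b - a < min d1 d2" for a b
        unfolding P_def
      proof
        assume "0 \<le> a \<and> b \<le> 1"
        then have "a \<in> {0..1}" "b \<in> {0..1}" using ab s by auto
        moreover have "\<bar>a - s\<bar> = s - a" "\<bar>b - s\<bar> = b - s" "s - a < d1" "b - s < d1" "s - a < d2" "b - s < d2"
          using ab by auto
        ultimately have "\<bar>F (\<gamma> a) - F (\<gamma> s)\<bar> \<le> (s - a) * (\<sigma> s + e / 2)"
          "\<bar>F (\<gamma> b) - F (\<gamma> s)\<bar> \<le> (b - s) * (\<sigma> s + e / 2)"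
          "\<bar>I a - I s - (a - s) * \<sigma> s\<bar> \<le> e / 2 * (s - a)"
          "\<bar>I b - I s - (b - s) * \<sigma> s\<bar> \<le> e / 2 * (b - s)"
          using d1(2)[of a] d1(2)[of b] d2(2)[of a] d2(2)[of b] by auto
        moreover have "(s - a) * (\<sigma> s + e / 2) = (s - a) * \<sigma> s + e / 2 * (s - a)"
          "(b - s) * (\<sigma> s + e / 2) = (b - s) * \<sigma> s + e / 2 * (b - s)"
          "(a - s) * \<sigma> s = - ((s - a) * \<sigma> s)"
          "e * (b - a) = 2 * (e / 2 * (s - a)) + 2 * (e / 2 * (b - s))"
          by (simp_all add: field_simps)
        ultimately show "\<bar>F (\<gamma> b) - F (\<gamma> a)\<bar> \<le> I b - I a + e * (b - a)"
          by linarith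
      qed
      then show "\<exists>d>0. \<forall>a b. a \<le> s \<and> s \<le> b \<and> b - a < d \<longrightarrow> P a b"
        using d1(1) d2(1) by (intro exI[of _ "min d1 d2"]) auto
    qed simp
    then show ?thesis by (simp add: P_def)
  qed
  then have "\<bar>F (\<gamma> 1) - F (\<gamma> 0)\<bar> \<le> I 1 - I 0" by (rule field_le_epsilon)
  moreover have "I 0 = 0" "I 1 = piece_length g c 0 1 \<gamma>"
    unfolding D(4) I_def \<sigma>_def by auto
  ultimately show ?thesis by simp
qed


lemma curve_chain_compare:
  fixes F :: "'a \<Rightarrow> real"
  assumes F: "\<And>c p \<epsilon>. c \<in> A \<Longrightarrow> p \<in> fst c \<Longrightarrow> \<epsilon> > 0 \<Longrightarrow>
      \<exists>\<delta>>0. \<forall>q\<in>fst c. norm (snd c q - snd c p) < \<delta> \<longrightarrow>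
        \<bar>F q - F p\<bar> \<le> speed g c p (snd c q - snd c p) + \<epsilon> * norm (snd c q - snd c p)"
    and "curve_chain A g x y l"
  shows "\<bar>F y - F x\<bar> \<le> l"
  using assms(2)
proof induction
  case (single c \<gamma>)
  then show ?case using F by (intro piece_compare) auto
next
  case (append x \<gamma> l c)
  have "\<bar>F (\<gamma> 1) - F (\<gamma> 0)\<bar> \<le> piece_length g c 0 1 \<gamma>"
    using append.hyps F by (intro piece_compare) auto
  with append.IH show ?case by linarith
qed

text \<open>Straight segments in charts are the only curves constructed outright; every other one is
  made from given curves. The velocity is constant in the chart, so the length is the average of its
  speeds along the segment.\<close>

lemma curve_chain_segment:
  assumes c: "c \<in> A" and sub: "closed_segment z w \<subseteq> snd c ` fst c"
    and B: "\<And>p. p \<in> closed_segment z w \<Longrightarrow> speed g c (chart_inv c p) (w - z) \<le> B"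
  shows "\<exists>l\<le>B. curve_chain A g (chart_inv c z) (chart_inv c w) l"
proof -
  define p where "p s = z + s *\<^sub>R (w - z)" for s :: real
  define \<gamma> where "\<gamma> s = chart_inv c (p s)" for s
  have p: "p s \<in> closed_segment z w" if "s \<in> {0..1}" for s
    using that by (auto simp: p_def closed_segment_def algebra_simps intro!: exI[of _ s])
  have pU: "p s \<in> snd c ` fst c" if "s \<in> {0..1}" for s using p[OF that] sub by blast
  have \<gamma>U: "\<gamma> ` {0..1} \<subseteq> fst c"
    using chart_inv_mem[OF pU] unfolding \<gamma>_def by (rule image_subsetI)
  have D: "((snd c \<circ> \<gamma>) has_vector_derivative (w - z)) (at s within {0..1})" if s: "s \<in> {0..1}" for s
  proof -
    have "(p has_vector_derivative (w - z)) (at s within {0..1})"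
      unfolding p_def by (auto intro!: derivative_eq_intros)
    then show ?thesis
    proof (rule has_vector_derivative_transform[OF s, rotated])
      show "(snd c \<circ> \<gamma>) t = p t" if "t \<in> {0..1}" for t
        using chart_inv_right[OF pU[OF that]] by (simp add: \<gamma>_def)
    qed
  qed
  have C: "C1_piece c 0 1 \<gamma>"
    unfolding C1_piece_def using \<gamma>U D continuous_on_const by blast
  have "vector_derivative (snd c \<circ> \<gamma>) (at s within {0..1}) = w - z" if "s \<in> {0..1}" for s
    by (rule vector_derivative_within_closed_interval[OF zero_less_one that D[OF that]])
  then have "piece_length g c 0 1 \<gamma> = integral {0..1} (\<lambda>s. speed g c (\<gamma> s) (w - z))"
    unfolding piece_length_def speed_def by (intro integral_cong) (simp add: Let_def)
  also have "\<dots> \<le> integral {0..1} (\<lambda>s::real. B)"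
  proof (rule integral_le)
    show "(\<lambda>s. speed g c (\<gamma> s) (w - z)) integrable_on {0..1}"
      using continuous_on_piece_speed[OF c continuous_on_const \<gamma>U D] integrable_continuous_real by blast
    show "speed g c (\<gamma> s) (w - z) \<le> B" if "s \<in> {0..1}" for s
      unfolding \<gamma>_def using B p[OF that] by blast
  qed (rule integrable_continuous_real[OF continuous_on_const])
  finally have "piece_length g c 0 1 \<gamma> \<le> B" by simp
  moreover have "\<gamma> 0 = chart_inv c z" "\<gamma> 1 = chart_inv c w" by (simp_all add: \<gamma>_def p_def)
  ultimately show ?thesis using curve_chain.single[OF c C, of g] by auto
qed

lemma curve_chain_local:
  assumes c: "c \<in> A" "x \<in> fst c"
  obtains \<delta> K where "\<delta> > 0" "K > 0" "ball (snd c x) \<delta> \<subseteq> snd c ` fst c"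
    "\<And>z w. z \<in> ball (snd c x) \<delta> \<Longrightarrow> w \<in> ball (snd c x) \<delta> \<Longrightarrow>
      \<exists>l \<le> K * norm (w - z). curve_chain A g (chart_inv c z) (chart_inv c w) l"
proof -
  obtain \<delta> where \<delta>: "\<delta> > 0" "ball (snd c x) \<delta> \<subseteq> snd c ` fst c"
    "\<And>z v. z \<in> ball (snd c x) \<delta> \<Longrightarrow> \<bar>speed g c (chart_inv c z) v - speed g c x v\<bar> \<le> 1 * norm v"
    using speed_near[OF c zero_less_one] by metis
  obtain m K where K: "m > 0" "K > 0" "\<And>v. m * norm v \<le> speed g c x v" "\<And>v. speed g c x v \<le> K * norm v"
    using speed_bounds[OF c] by metis
  have "\<exists>l \<le> (K + 1) * norm (w - z). curve_chain A g (chart_inv c z) (chart_inv c w) l"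
    if "z \<in> ball (snd c x) \<delta>" "w \<in> ball (snd c x) \<delta>" for z w
  proof (rule curve_chain_segment[OF c(1)])
    have seg: "closed_segment z w \<subseteq> ball (snd c x) \<delta>"
      using that by (simp add: closed_segment_subset)
    then show "closed_segment z w \<subseteq> snd c ` fst c" using \<delta>(2) by blast
    fix p assume "p \<in> closed_segment z w"
    then have "p \<in> ball (snd c x) \<delta>" using seg by blast
    from \<delta>(3)[OF this, of "w - z"] K(4)[of "w - z"]
    show "speed g c (chart_inv c p) (w - z) \<le> (K + 1) * norm (w - z)"
      by (simp add: algebra_simps)
  qed
  moreover have "K + 1 > 0" using K by simp
  ultimately show thesis using that \<delta>(1,2) by blast
qed

end

section \<open>The Riemannian distance\<close>

text \<open>Equivalence classes are open; the complement of a class is a union of classes and hence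
  open too, so connectedness leaves a single class.\<close>

lemma connected_space_equivalence:
  assumes X: "connected_space X" and xy: "x \<in> topspace X" "y \<in> topspace X"
    and sym: "\<And>x y. R x y \<Longrightarrow> R y x" and trans: "\<And>x y z. R x y \<Longrightarrow> R y z \<Longrightarrow> R x z"
    and loc: "\<And>x. x \<in> topspace X \<Longrightarrow> \<exists>U. openin X U \<and> x \<in> U \<and> (\<forall>y\<in>U. R x y)"
  shows "R x y"
proof -
  define S where "S = {y \<in> topspace X. R x y}"
  have "openin X S"
    unfolding openin_subopen[of X S]
  proof
    fix a assume a: "a \<in> S"
    then obtain U where U: "openin X U" "a \<in> U" "\<forall>y\<in>U. R a y" using loc unfolding S_def by blast
    then have "U \<subseteq> S" using a trans openin_subset[OF U(1)] unfolding S_def by blast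
    with U show "\<exists>T. openin X T \<and> a \<in> T \<and> T \<subseteq> S" by blast
  qed
  moreover have "openin X (topspace X - S)"
    unfolding openin_subopen[of X "topspace X - S"]
  proof
    fix a assume a: "a \<in> topspace X - S"
    then obtain U where U: "openin X U" "a \<in> U" "\<forall>y\<in>U. R a y" using loc by blast
    then have "U \<subseteq> topspace X - S" using a trans sym openin_subset[OF U(1)] unfolding S_def by blast
    with U show "\<exists>T. openin X T \<and> a \<in> T \<and> T \<subseteq> topspace X - S" by blast
  qed
  moreover have "x \<in> S"
    using loc[OF xy(1)] sym trans xy(1) unfolding S_def by blast
  ultimately have "S = topspace X"
    using X unfolding connected_space_clopen_in closedin_def S_def by auto
  then show ?thesis using xy(2) unfolding S_def by blast
qed

section \<open>Finiteness, triangle inequality and positivity of the distance\<close>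

locale connected_metric_manifold = metric_manifold +
  assumes connected: "connected_space X"
begin

abbreviation (input) "d \<equiv> riemannian_dist A g"

text \<open>Ensures that the infimum defining the distance is taken over a nonempty set; over the
  empty set its value would carry no information.\<close>

lemma curve_chain_exists:
  assumes "x \<in> topspace X" "y \<in> topspace X"
  shows "\<exists>l. curve_chain A g x y l"
proof (rule connected_space_equivalence[OF connected assms])
  show "\<exists>U. openin X U \<and> x \<in> U \<and> (\<forall>y\<in>U. \<exists>l. curve_chain A g x y l)" if "x \<in> topspace X" for x
  proof -
    obtain c where c: "c \<in> A" "x \<in> fst c" using chart_cover \<open>x \<in> topspace X\<close> by blast
    obtain \<delta> K where *: "\<delta> > 0" "\<And>z w. z \<in> ball (snd c x) \<delta> \<Longrightarrow> w \<in> ball (snd c x) \<delta> \<Longrightarrow>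
      \<exists>l \<le> K * norm (w - z). curve_chain A g (chart_inv c z) (chart_inv c w) l"
      by (rule curve_chain_local[OF c]) blast
    let ?U = "{y \<in> fst c. snd c y \<in> ball (snd c x) \<delta>}"
    have "\<exists>l. curve_chain A g x y l" if "y \<in> ?U" for y
      using *(2)[of "snd c x" "snd c y"] that c *(1) by auto
    moreover have "openin X ?U" "x \<in> ?U"
      using openin_chart_preimage[OF c(1) open_ball] c *(1) by auto
    ultimately show ?thesis by blast
  qed
  show "\<exists>l. curve_chain A g y x l" if "\<exists>l. curve_chain A g x y l" for x y
    using that curve_chain_sym by blast
  show "\<exists>l. curve_chain A g x z l"
    if "\<exists>l. curve_chain A g x y l" "\<exists>l. curve_chain A g y z l" for x y z
    using that curve_chain_trans[of A g y z _ x] by blast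
qed

lemma bdd_below_curve_lengths: "bdd_below (curve_lengths A g x y)"
  by (rule bdd_belowI[of _ 0]) (simp add: curve_lengths_eq curve_chain_nonneg)

lemma dist_le: "curve_chain A g x y l \<Longrightarrow> d x y \<le> l"
  unfolding riemannian_dist_def
  by (rule cInf_lower[OF _ bdd_below_curve_lengths]) (simp add: curve_lengths_eq)

lemma dist_approx:
  assumes "x \<in> topspace X" "y \<in> topspace X" "e > 0"
  obtains l where "curve_chain A g x y l" "l < d x y + e"
proof -
  have "\<exists>l\<in>curve_lengths A g x y. l < d x y + e"
  proof (rule cInf_lessD)
    show "curve_lengths A g x y \<noteq> {}"
      using curve_chain_exists[OF assms(1,2)] by (simp add: curve_lengths_eq)
    show "Inf (curve_lengths A g x y) < d x y + e"
      using \<open>e > 0\<close> by (simp add: riemannian_dist_def)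
  qed
  then show thesis using that unfolding curve_lengths_eq by blast
qed

lemma dist_ge:
  assumes "x \<in> topspace X" "y \<in> topspace X" "\<And>l. curve_chain A g x y l \<Longrightarrow> B \<le> l"
  shows "B \<le> d x y"
  unfolding riemannian_dist_def
proof (rule cInf_greatest)
  show "curve_lengths A g x y \<noteq> {}"
    using curve_chain_exists[OF assms(1,2)] by (simp add: curve_lengths_eq)
qed (use assms(3) in \<open>simp add: curve_lengths_eq\<close>)

lemma dist_nonneg: "x \<in> topspace X \<Longrightarrow> y \<in> topspace X \<Longrightarrow> 0 \<le> d x y"
  by (intro dist_ge curve_chain_nonneg)

lemma dist_sym: "d x y = d y x"
proof -
  have "curve_lengths A g x y = curve_lengths A g y x"
    unfolding curve_lengths_eq using curve_chain_sym by blast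
  then show ?thesis by (simp add: riemannian_dist_def)
qed

lemma dist_triangle:
  assumes "x \<in> topspace X" "y \<in> topspace X" "z \<in> topspace X"
  shows "d x z \<le> d x y + d y z"
proof (rule field_le_epsilon)
  fix e :: real assume "e > 0"
  obtain l where l: "curve_chain A g x y l" "l < d x y + e / 2"
    using dist_approx[OF assms(1,2), of "e / 2"] \<open>e > 0\<close> by auto
  obtain l' where l': "curve_chain A g y z l'" "l' < d y z + e / 2"
    using dist_approx[OF assms(2,3), of "e / 2"] \<open>e > 0\<close> by auto
  show "d x z \<le> d x y + d y z + e"
    using dist_le[OF curve_chain_trans[OF l'(1) l(1)]] l(2) l'(2) by simp
qed

lemma dist_local:
  assumes c: "c \<in> A" "x \<in> fst c"
  obtains \<delta> K where "\<delta> > 0" "K > 0" "ball (snd c x) \<delta> \<subseteq> snd c ` fst c"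
    "\<And>z w. z \<in> ball (snd c x) \<delta> \<Longrightarrow> w \<in> ball (snd c x) \<delta> \<Longrightarrow>
      d (chart_inv c z) (chart_inv c w) \<le> K * norm (w - z)"
proof (rule curve_chain_local[OF c])
  fix \<delta> K :: real
  assume *: "\<delta> > 0" "K > 0" "ball (snd c x) \<delta> \<subseteq> snd c ` fst c"
    "\<And>z w. z \<in> ball (snd c x) \<delta> \<Longrightarrow> w \<in> ball (snd c x) \<delta> \<Longrightarrow>
      \<exists>l \<le> K * norm (w - z). curve_chain A g (chart_inv c z) (chart_inv c w) l"
  have "d (chart_inv c z) (chart_inv c w) \<le> K * norm (w - z)"
    if "z \<in> ball (snd c x) \<delta>" "w \<in> ball (snd c x) \<delta>" for z w
    using *(4)[OF that] dist_le by fastforce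
  with *(1-3) show thesis by (rule that)
qed

lemma dist_segment:
  assumes "c \<in> A" "closed_segment z w \<subseteq> snd c ` fst c"
    "\<And>p. p \<in> closed_segment z w \<Longrightarrow> speed g c (chart_inv c p) (w - z) \<le> B"
  shows "d (chart_inv c z) (chart_inv c w) \<le> B"
proof -
  obtain l where "l \<le> B" "curve_chain A g (chart_inv c z) (chart_inv c w) l"
    using curve_chain_segment[OF assms] by blast
  then show ?thesis using dist_le by fastforce
qed

lemma dist_refl: "x \<in> topspace X \<Longrightarrow> d x x = 0"
proof -
  assume x: "x \<in> topspace X"
  obtain c where c: "c \<in> A" "x \<in> fst c" using chart_cover x by blast
  obtain \<delta> K where *: "\<delta> > 0" "\<And>z w. z \<in> ball (snd c x) \<delta> \<Longrightarrow> w \<in> ball (snd c x) \<delta> \<Longrightarrow>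
      d (chart_inv c z) (chart_inv c w) \<le> K * norm (w - z)"
    by (rule dist_local[OF c]) blast
  have "d x x \<le> 0" using *(2)[of "snd c x" "snd c x"] *(1) c by simp
  with dist_nonneg[OF x x] show ?thesis by simp
qed

text \<open>The metric topology is coarser than that of \<open>X\<close>, which lets compactness of
  \<open>X\<close> pass to the metric spaces and provides finite nets.\<close>

lemma openin_dist_ball:
  assumes x: "x \<in> topspace X"
  shows "openin X {y \<in> topspace X. d x y < r}"
  unfolding openin_subopen[of X "{y \<in> topspace X. d x y < r}"]
proof
  fix a assume "a \<in> {y \<in> topspace X. d x y < r}"
  then have a: "a \<in> topspace X" "d x a < r" by auto
  obtain c where c: "c \<in> A" "a \<in> fst c" using chart_cover a by blast
  obtain \<delta> K where *: "\<delta> > 0" "K > 0" "\<And>z w. z \<in> ball (snd c a) \<delta> \<Longrightarrow> w \<in> ball (snd c a) \<delta> \<Longrightarrow>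
      d (chart_inv c z) (chart_inv c w) \<le> K * norm (w - z)"
    by (rule dist_local[OF c]) blast
  define \<eta> where "\<eta> = min \<delta> ((r - d x a) / K)"
  have \<eta>: "\<eta> > 0" using * a by (simp add: \<eta>_def)
  let ?U = "{y \<in> fst c. snd c y \<in> ball (snd c a) \<eta>}"
  have "d x y < r" if y: "y \<in> ?U" for y
  proof -
    have yX: "y \<in> topspace X" using y topspace_chart[OF c(1)] by blast
    have "norm (snd c y - snd c a) < (r - d x a) / K"
      using y by (auto simp: \<eta>_def dist_norm norm_minus_commute)
    then have "K * norm (snd c y - snd c a) < r - d x a"
      using *(2) by (simp add: pos_less_divide_eq mult.commute)
    moreover have "d a y \<le> K * norm (snd c y - snd c a)"
      using *(3)[of "snd c a" "snd c y"] y c *(1) by (auto simp: \<eta>_def)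
    ultimately show ?thesis using dist_triangle[OF x a(1) yX] by linarith
  qed
  then have "?U \<subseteq> {y \<in> topspace X. d x y < r}" using topspace_chart[OF c(1)] by blast
  moreover have "openin X ?U" "a \<in> ?U"
    using openin_chart_preimage[OF c(1) open_ball] c \<eta> by auto
  ultimately show "\<exists>T. openin X T \<and> a \<in> T \<and> T \<subseteq> {y \<in> topspace X. d x y < r}" by blast
qed

text \<open>The test function for \<open>curve_chain_compare\<close> is the coordinate distance from
  \<open>x\<close>, cut off at radius \<open>r\<close>: it is 0 at \<open>x\<close> and
  \<open>r\<close> at \<open>y\<close>, and \<open>m / 2\<close> times it grows no faster than the
  length. A curve near \<open>x\<close> may be recorded in any chart, so its velocity must be
  translated into \<open>c\<close>, which is the role of \<open>law\<close>.\<close>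

lemma dist_pos:
  assumes H: "Hausdorff_space X"
    and law: "\<And>c c' x v. \<lbrakk>c \<in> A; c' \<in> A; x \<in> fst c \<inter> fst c'\<rbrakk> \<Longrightarrow>
      speed g c x v = speed g c' x (frechet_derivative (transition c c') (at (snd c x)) v)"
    and xy: "x \<in> topspace X" "y \<in> topspace X" "x \<noteq> y"
  shows "0 < d x y"
proof -
  obtain c where c: "c \<in> A" "x \<in> fst c" using chart_cover xy(1) by blast
  obtain m K where m: "m > 0" "\<And>v. m * norm v \<le> speed g c x v"
    using speed_bounds[OF c] by metis
  obtain \<delta> where \<delta>: "\<delta> > 0" "ball (snd c x) \<delta> \<subseteq> snd c ` fst c"
    "\<And>z v. z \<in> ball (snd c x) \<delta> \<Longrightarrow> \<bar>speed g c (chart_inv c z) v - speed g c x v\<bar> \<le> m / 2 * norm v"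
    using speed_near[OF c, of "m / 2"] m(1) by (metis half_gt_zero)
  \<comment> \<open>Half of \<open>m\<close> is given up to the variation of the coefficients over
    the ball.\<close>
  have lower: "m / 2 * norm v \<le> speed g c p v" if "p \<in> fst c" "snd c p \<in> ball (snd c x) \<delta>" for p v
    using abs_le_D2[OF \<delta>(3)[OF that(2), of v]] m(2)[of v] that(1) c(1) by (simp add: field_simps)
  \<comment> \<open>Being below \<delta> keeps the closed ball of radius \<open>r\<close> in the
    chart; being at most the coordinate distance to \<open>y\<close>, if \<open>y\<close> lies in
    the chart, makes the cut-off take effect there.\<close>
  define r where "r = (if y \<in> fst c then min (\<delta> / 2) (norm (snd c y - snd c x)) else \<delta> / 2)"
  have "snd c y \<noteq> snd c x" if "y \<in> fst c"
    using chart_inj[OF c(1)] that c(2) xy(3) by (auto dest: inj_onD)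
  then have r: "r > 0" "r < \<delta>" "y \<in> fst c \<Longrightarrow> r \<le> norm (snd c y - snd c x)"
    using \<delta>(1) by (auto simp: r_def)
  \<comment> \<open>up to a constant, the distance from \<open>x\<close> in the chart, truncated so that it extends to the manifold\<close>
  define F where "F p = (if p \<in> fst c then min r (norm (snd c p - snd c x)) else r)" for p
  define V where "V = {p \<in> fst c. snd c p \<in> cball (snd c x) r}"
  have Fout: "F p = r" if "p \<notin> V" for p
    using that by (auto simp: F_def V_def dist_norm norm_minus_commute)
  have "cball (snd c x) r \<subseteq> snd c ` fst c" using \<delta>(2) r(2) by (auto simp: subset_iff)
  then have V: "closedin X V"
    unfolding V_def by (intro closedin_chart_compact[OF c(1) H]) auto
  have "\<exists>\<eta>>0. \<forall>q\<in>fst c'. norm (snd c' q - snd c' p) < \<eta> \<longrightarrow>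
      \<bar>m / 2 * F q - m / 2 * F p\<bar> \<le> speed g c' p (snd c' q - snd c' p) + \<epsilon> * norm (snd c' q - snd c' p)"
    if c': "c' \<in> A" "p \<in> fst c'" and "\<epsilon> > 0" for c' p \<epsilon>
  proof (cases "p \<in> V")
    case True
    then have p: "p \<in> fst c' \<inter> fst c" "snd c p \<in> ball (snd c x) \<delta>"
      using c' r(2) by (auto simp: V_def)
    define \<tau> where "\<tau> = transition c' c"
    define D where "D = frechet_derivative \<tau> (at (snd c' p))"
    have "smooth_on (snd c' ` (fst c' \<inter> fst c)) \<tau>"
      using atlas c(1) c'(1) unfolding smooth_atlas_def \<tau>_def by blast
    then have "Ck_on (Suc 0) (snd c' ` (fst c' \<inter> fst c)) \<tau>" unfolding smooth_on_def by blast
    then have "\<tau> differentiable (at (snd c' p))" using p(1) by auto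
    then have "(\<tau> has_derivative D) (at (snd c' p))"
      unfolding D_def by (simp add: frechet_derivative_works)
    \<comment> \<open>After multiplication by \<open>m / 2\<close>, a remainder of
      \<open>\<epsilon> / m\<close> per unit length becomes \<open>\<epsilon> / 2\<close>, within
      the permitted error.\<close>
    moreover have "\<epsilon> / m > 0" using \<open>\<epsilon> > 0\<close> m(1) by simp
    ultimately obtain \<eta>1 where \<eta>1: "\<eta>1 > 0"
      "\<And>w. norm (w - snd c' p) < \<eta>1 \<Longrightarrow>
        norm (\<tau> w - \<tau> (snd c' p) - D (w - snd c' p)) \<le> \<epsilon> / m * norm (w - snd c' p)"
      unfolding has_derivative_within_alt by blast
    have "open (snd c' ` (fst c' \<inter> fst c))"
      by (intro open_chart_image openin_chart c c')
    then obtain \<eta>2 where \<eta>2: "\<eta>2 > 0" "ball (snd c' p) \<eta>2 \<subseteq> snd c' ` (fst c' \<inter> fst c)"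
      using p(1) open_contains_ball by blast
    have "\<bar>m / 2 * F q - m / 2 * F p\<bar> \<le> speed g c' p (snd c' q - snd c' p) + \<epsilon> * norm (snd c' q - snd c' p)"
      if q: "q \<in> fst c'" "norm (snd c' q - snd c' p) < min \<eta>1 \<eta>2" for q
    proof -
      define w where "w = snd c' q - snd c' p"
      have "snd c' q \<in> snd c' ` (fst c' \<inter> fst c)"
        using \<eta>2(2) q(2) by (auto simp: subset_iff dist_norm norm_minus_commute)
      then have qc: "q \<in> fst c" using q(1) chart_inj[OF c'(1)] by (auto dest: inj_onD)
      have \<tau>: "\<tau> (snd c' q) = snd c q" "\<tau> (snd c' p) = snd c p"
        using q(1) p(1) c'(1) by (simp_all add: \<tau>_def transition_def)
      have "\<bar>F q - F p\<bar> \<le> norm (snd c q - snd c p)"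
        using qc p(1) norm_triangle_ineq3[of "snd c q - snd c x" "snd c p - snd c x"]
        by (auto simp: F_def min_def)
      also have "\<dots> \<le> norm (D w) + \<epsilon> / m * norm w"
        using \<eta>1(2)[of "snd c' q"] q(2) norm_triangle_sub[of "snd c q - snd c p" "D w"]
        by (auto simp: \<tau> w_def)
      finally have "m / 2 * \<bar>F q - F p\<bar> \<le> m / 2 * (norm (D w) + \<epsilon> / m * norm w)"
        using m(1) by (intro mult_left_mono) auto
      also have "\<dots> = m / 2 * norm (D w) + \<epsilon> / 2 * norm w" using m(1) by (simp add: field_simps)
      also have "\<dots> \<le> speed g c p (D w) + \<epsilon> * norm w"
        using lower[of p "D w"] p \<open>\<epsilon> > 0\<close> by (intro add_mono) auto
      also have "speed g c p (D w) = speed g c' p w"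
        using law[OF c'(1) c(1) p(1)] by (simp add: D_def \<tau>_def)
      finally have "m / 2 * \<bar>F q - F p\<bar> \<le> speed g c' p w + \<epsilon> * norm w" .
      moreover have "m / 2 * \<bar>F q - F p\<bar> = \<bar>m / 2 * F q - m / 2 * F p\<bar>"
        using m(1) abs_mult[of "m / 2" "F q - F p"] by (simp add: right_diff_distrib)
      ultimately show ?thesis unfolding w_def by simp
    qed
    moreover have "min \<eta>1 \<eta>2 > 0" using \<eta>1 \<eta>2 by simp
    ultimately show ?thesis by blast
  next
    case False
    \<comment> \<open>Off the closed set \<open>V\<close> the test function is locally constant, so
      its increment is 0.\<close>
    have "openin X (topspace X - V)" using V by (rule openin_diff[OF openin_topspace])
    then have "open (snd c' ` (fst c' \<inter> (topspace X - V)))" by (rule open_chart_image[OF c'(1)])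
    moreover have "p \<in> fst c' \<inter> (topspace X - V)" using False c' topspace_chart by blast
    ultimately obtain \<eta> where \<eta>: "\<eta> > 0" "ball (snd c' p) \<eta> \<subseteq> snd c' ` (fst c' \<inter> (topspace X - V))"
      using open_contains_ball by blast
    have "\<bar>m / 2 * F q - m / 2 * F p\<bar> \<le> speed g c' p (snd c' q - snd c' p) + \<epsilon> * norm (snd c' q - snd c' p)"
      if q: "q \<in> fst c'" "norm (snd c' q - snd c' p) < \<eta>" for q
    proof -
      have "snd c' q \<in> snd c' ` (fst c' \<inter> (topspace X - V))"
        using \<eta>(2) q(2) by (auto simp: subset_iff dist_norm norm_minus_commute)
      then have "q \<notin> V" using q(1) chart_inj[OF c'(1)] by (auto dest: inj_onD)
      then show ?thesis using Fout False c' \<open>\<epsilon> > 0\<close> by simp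
    qed
    with \<eta>(1) show ?thesis by blast
  qed
  then have "\<bar>m / 2 * F y - m / 2 * F x\<bar> \<le> l" if "curve_chain A g x y l" for l
    using curve_chain_compare[of "\<lambda>p. m / 2 * F p", OF _ that] by blast
  moreover have "F x = 0" "F y = r" using c(2) r by (auto simp: F_def)
  ultimately have "m / 2 * r \<le> d x y"
    using m(1) r(1) by (intro dist_ge xy(1,2)) auto
  moreover have "0 < m / 2 * r" using m(1) r(1) by simp
  ultimately show ?thesis by linarith
qed

end

lemma curve_chain_mono:
  assumes "metric_manifold X A g" "metric_manifold X A g'"
    and le: "\<And>c x v. \<lbrakk>c \<in> A; x \<in> fst c\<rbrakk> \<Longrightarrow> speed g' c x v \<le> K * speed g c x v"
    and "curve_chain A g x y l"
  shows "\<exists>l' \<le> K * l. curve_chain A g' x y l'"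
proof -
  interpret g: metric_manifold X A g by fact
  interpret g': metric_manifold X A g' by fact
  have piece: "piece_length g' c 0 1 \<gamma> \<le> K * piece_length g c 0 1 \<gamma>"
    if c: "c \<in> A" "C1_piece c 0 1 \<gamma>" for c \<gamma>
  proof -
    obtain D where D: "continuous_on {0..1} D" "\<gamma> ` {0..1} \<subseteq> fst c"
      "\<And>s. s \<in> {0..1} \<Longrightarrow> ((snd c \<circ> \<gamma>) has_vector_derivative D s) (at s within {0..1})"
      using c(2) unfolding C1_piece_def by blast
    have vd: "vector_derivative (snd c \<circ> \<gamma>) (at s within {0..1}) = D s" if "s \<in> {0..1}" for s
      by (rule vector_derivative_within_closed_interval[OF zero_less_one that D(3)[OF that]])
    have len: "piece_length h c 0 1 \<gamma> = integral {0..1} (\<lambda>s. speed h c (\<gamma> s) (D s))" for h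
      unfolding piece_length_def speed_def using vd by (intro integral_cong) (simp add: Let_def)
    have i: "(\<lambda>s. speed g c (\<gamma> s) (D s)) integrable_on {0..1}"
      "(\<lambda>s. speed g' c (\<gamma> s) (D s)) integrable_on {0..1}"
      using g.continuous_on_piece_speed[OF c(1) D] g'.continuous_on_piece_speed[OF c(1) D]
        integrable_continuous_real by blast+
    have "piece_length g' c 0 1 \<gamma> \<le> integral {0..1} (\<lambda>s. K * speed g c (\<gamma> s) (D s))"
      unfolding len
    proof (rule integral_le[OF i(2) integrable_on_mult_right[OF i(1)]])
      show "speed g' c (\<gamma> s) (D s) \<le> K * speed g c (\<gamma> s) (D s)" if "s \<in> {0..1}" for s
        using le c(1) D(2) that by blast
    qed
    then show ?thesis by (simp add: len)
  qed
  show ?thesis using assms(4)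
  proof induction
    case (single c \<gamma>)
    then show ?case using piece curve_chain.single by blast
  next
    case (append x \<gamma> l c)
    then obtain l' where l': "l' \<le> K * l" "curve_chain A g' x (\<gamma> 0) l'" by blast
    have "l' + piece_length g' c 0 1 \<gamma> \<le> K * (l + piece_length g c 0 1 \<gamma>)"
      using l'(1) piece[OF append.hyps(2,3)] by (simp add: distrib_left)
    then show ?case using curve_chain.append[OF l'(2) append.hyps(2,3)] by blast
  qed
qed

text \<open>Serves in both directions: with \<open>K = 1\<close> because warping shortens vectors,
  and with \<open>K\<close> the inverse of the minimum of the warping function to compare
  back.\<close>

lemma riemannian_dist_mono:
  assumes g: "connected_metric_manifold X A g" and g': "connected_metric_manifold X A g'"
    and le: "\<And>c x v. \<lbrakk>c \<in> A; x \<in> fst c\<rbrakk> \<Longrightarrow> speed g' c x v \<le> K * speed g c x v"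
    and "K > 0" and xy: "x \<in> topspace X" "y \<in> topspace X"
  shows "riemannian_dist A g' x y \<le> K * riemannian_dist A g x y"
proof -
  interpret g: connected_metric_manifold X A g by fact
  interpret g': connected_metric_manifold X A g' by fact
  have "riemannian_dist A g' x y / K \<le> riemannian_dist A g x y"
  proof (rule g.dist_ge[OF xy])
    fix l assume "curve_chain A g x y l"
    then obtain l' where "l' \<le> K * l" "curve_chain A g' x y l'"
      using curve_chain_mono[OF g.metric_manifold_axioms g'.metric_manifold_axioms le] by blast
    then show "riemannian_dist A g' x y / K \<le> l"
      using g'.dist_le \<open>K > 0\<close> by (force simp: pos_divide_le_eq mult.commute)
  qed
  then show ?thesis using \<open>K > 0\<close> by (simp add: pos_divide_le_eq mult.commute)
qed

section \<open>Warped metrics\<close>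

lemma inner_product_form_pythagoras:
  assumes q: "inner_product_form q" and "q (v - u) u = 0"
  shows "q v v = q u u + q (v - u) (v - u)"
proof -
  note b = inner_product_form_D(1)[OF q]
  have "q v v = q (u + (v - u)) (u + (v - u))" by simp
  also have "\<dots> = q u u + q (v - u) u + (q u (v - u) + q (v - u) (v - u))"
    by (simp only: bilinear_ladd[OF b] bilinear_radd[OF b])
  finally show ?thesis using assms(2) inner_product_form_D(2)[OF q, of u "v - u"] by simp
qed

text \<open>In the expansion by tangential and perpendicular parts the mixed terms vanish. Unlike
  the definite description behind \<open>warped_metric\<close>, the formula shows how the form
  depends on the point.\<close>

lemma is_warped_form_eq:
  assumes h: "is_warped_form T r q h"
    and p: "\<And>v. p v \<in> T" "\<And>v u. u \<in> T \<Longrightarrow> q (v - p v) u = 0" and q: "inner_product_form q"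
  shows "h v w = r\<^sup>2 * q (p v) (p w) + q (v - p v) (w - p w)"
proof -
  have b: "bilinear h"
    and T: "\<And>v w. v \<in> T \<Longrightarrow> w \<in> T \<Longrightarrow> h v w = r\<^sup>2 * q v w"
    and P: "\<And>v w. (\<forall>u\<in>T. q v u = 0) \<or> (\<forall>u\<in>T. q w u = 0) \<Longrightarrow> h v w = q v w"
    using h unfolding is_warped_form_def by blast+
  have o: "\<forall>u\<in>T. q (a - p a) u = 0" for a using p(2) by blast
  have "h v w = h (p v + (v - p v)) (p w + (w - p w))" by simp
  also have "\<dots> = h (p v) (p w) + h (v - p v) (p w) + (h (p v) (w - p w) + h (v - p v) (w - p w))"
    by (simp only: bilinear_ladd[OF b] bilinear_radd[OF b])
  also have "\<dots> = r\<^sup>2 * q (p v) (p w) + q (v - p v) (p w) + (q (p v) (w - p w) + q (v - p v) (w - p w))"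
    using T[OF p(1) p(1)] P o by simp
  also have "q (v - p v) (p w) = 0" by (rule p(2)[OF p(1)])
  also have "q (p v) (w - p w) = 0"
    using p(2)[OF p(1)] inner_product_form_D(2)[OF q, of "p v"] by simp
  finally show ?thesis by simp
qed

text \<open>Gram-Schmidt with a parameter. The basis does not depend on \<open>s\<close>; each step
  subtracts a projection that is continuous by induction and divides by a continuous function
  without zeros.\<close>

lemma continuous_orthogonal_projection:
  fixes q :: "'t::topological_space \<Rightarrow> 'e::euclidean_space \<Rightarrow> 'e \<Rightarrow> real"
  assumes q: "\<And>s. s \<in> S \<Longrightarrow> inner_product_form (q s)"
    and cont: "\<And>v w. continuous_on S (\<lambda>s. q s v w)" and "finite B" "independent B"
  shows "\<exists>p. (\<forall>s v. p s v \<in> span B) \<and> (\<forall>s\<in>S. \<forall>v. \<forall>w\<in>span B. q s (v - p s v) w = 0) \<and>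
    (\<forall>v. continuous_on S (\<lambda>s. p s v))"
  using assms(3,4)
proof (induction B)
  case empty
  have "q s v 0 = 0" if "s \<in> S" for s v
    by (rule bilinear_rzero[OF inner_product_form_D(1)[OF q[OF that]]])
  then show ?case by (intro exI[of _ "\<lambda>_ _. 0"]) auto
next
  case (insert b B)
  have B: "b \<notin> span B" "independent B"
    using insert.hyps insert.prems by (auto simp: independent_insert)
  obtain p where p: "\<And>s v. p s v \<in> span B"
    "\<And>s v w. s \<in> S \<Longrightarrow> w \<in> span B \<Longrightarrow> q s (v - p s v) w = 0" "\<And>v. continuous_on S (\<lambda>s. p s v)"
    using insert.IH[OF B(2)] by blast
  define b' where "b' s = b - p s b" for s
  have b'0: "q s (b' s) w = 0" if "s \<in> S" "w \<in> span B" for s w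
    using p(2)[OF that] by (simp add: b'_def)
  \<comment> \<open>Independence of the basis makes this vector nonzero for every \<open>s\<close>,
    so the denominator in \<open>p'\<close> never vanishes on \<open>S\<close>.\<close>
  have b'nz: "b' s \<noteq> 0" for s using B(1) p(1)[of s b] by (auto simp: b'_def)
  have sub: "span B \<subseteq> span (insert b B)" by (simp add: span_mono subset_insertI)
  have b'in: "b' s \<in> span (insert b B)" for s
    unfolding b'_def using p(1) sub by (intro span_diff) (auto intro: span_base)
  have b'c: "continuous_on S b'" unfolding b'_def by (intro continuous_intros p(3))
  define p' where "p' s v = p s v + (q s v (b' s) / q s (b' s) (b' s)) *\<^sub>R b' s" for s v
  have "p' s v \<in> span (insert b B)" for s v
    unfolding p'_def using p(1) sub b'in by (intro span_add span_scale) auto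
  moreover have "q s (v - p' s v) w = 0" if s: "s \<in> S" and w: "w \<in> span (insert b B)" for s v w
  proof -
    note bl = inner_product_form_D(1)[OF q[OF s]]
    note bs = bilinear_ladd[OF bl] bilinear_radd[OF bl] bilinear_lmul[OF bl] bilinear_rmul[OF bl]
      bilinear_lsub[OF bl] bilinear_rsub[OF bl]
    obtain m where m: "w - m *\<^sub>R b \<in> span B"
      using w span_breakdown_eq[of w b B] by blast
    define u where "u = w - m *\<^sub>R b' s"
    have "u = (w - m *\<^sub>R b) + m *\<^sub>R p s b" by (simp add: u_def b'_def scaleR_diff_right)
    then have u: "u \<in> span B" using m p(1) by (simp add: span_add span_scale)
    have "q s (b' s) (b' s) \<noteq> 0" using inner_product_form_D(3)[OF q[OF s] b'nz] by (simp add: less_imp_neq[symmetric])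
    then have k: "q s v (b' s) / q s (b' s) (b' s) * q s (b' s) (b' s) = q s v (b' s)" by simp
    have 1: "q s (v - p' s v) u = 0"
      using p(2)[OF s u, of v] b'0[OF s u] by (simp add: p'_def bs)
    have 2: "q s (v - p' s v) (b' s) = 0"
      using k b'0[OF s p(1)[of s v]] inner_product_form_D(2)[OF q[OF s], of "p s v"] by (simp add: p'_def bs)
    have "w = u + m *\<^sub>R b' s" by (simp add: u_def)
    then show ?thesis using 1 2 by (simp add: bs)
  qed
  moreover have "continuous_on S (\<lambda>s. p' s v)" for v
  proof -
    have bl: "bilinear (q s)" if "s \<in> S" for s using inner_product_form_D(1)[OF q[OF that]] .
    have "continuous_on S (\<lambda>s. q s v (b' s))"
      by (rule continuous_on_form[of S q, OF bl cont continuous_on_const b'c])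
    moreover have "continuous_on S (\<lambda>s. q s (b' s) (b' s))"
      by (rule continuous_on_form[of S q, OF bl cont b'c b'c])
    moreover have "\<forall>s\<in>S. q s (b' s) (b' s) \<noteq> 0"
      using inner_product_form_D(3)[OF q b'nz] by (metis less_irrefl)
    ultimately show ?thesis
      unfolding p'_def by (intro continuous_on_add continuous_on_scaleR continuous_on_divide p(3) b'c)
  qed
  ultimately show ?case
    by (intro exI[of _ p'] conjI allI ballI)
qed

section \<open>Speeds and continuity of a warped metric\<close>

context metric_manifold
begin

lemma warped_form:
  assumes "c \<in> A" "x \<in> fst c" "subspace T"
  shows "is_warped_form T (f x) (g c x) (warped_metric T f g c x)"
  unfolding warped_metric_def by (rule theI'[OF warped_form_unique_exists[OF form[OF assms(1,2)] assms(3)]])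

text \<open>Pythagoras for the tangential and perpendicular parts of \<open>v\<close>: warping
  multiplies the first square by \<open>(f x)\<^sup>2\<close>, which is below 1, and keeps the
  second. In the fourth claim \<open>u\<close> is the tangential part, so \<open>v - u\<close> is
  the perpendicular one.\<close>

lemma warped_speed:
  assumes c: "c \<in> A" "x \<in> fst c" and T: "subspace T" and f: "0 < f x" "f x < 1"
  shows "speed (warped_metric T f g) c x v \<le> speed g c x v"
    and "f x * speed g c x v \<le> speed (warped_metric T f g) c x v"
    and "v \<in> T \<Longrightarrow> speed (warped_metric T f g) c x v = f x * speed g c x v"
    and "\<exists>u\<in>T. speed g c x (v - u) \<le> speed (warped_metric T f g) c x v"
    and "inner_product_form (warped_metric T f g c x)"
proof -
  let ?h = "warped_metric T f g c x" and ?q = "g c x"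
  note q = form[OF c]
  note D = inner_product_form_D[OF q]
  note h = warped_form[OF c T, of f]
  obtain p where p: "\<And>v. p v \<in> T" "\<And>v w. w \<in> T \<Longrightarrow> ?q (v - p v) w = 0"
    using orthogonal_decomposition[OF q T] by metis
  have eq: "?h v w = (f x)\<^sup>2 * ?q (p v) (p w) + ?q (v - p v) (w - p w)" for v w
    by (rule is_warped_form_eq[OF h p q])
  have pyth: "?q v v = ?q (p v) (p v) + ?q (v - p v) (v - p v)" for v
    by (rule inner_product_form_pythagoras[OF q p(2)[OF p(1)]])
  have f2: "0 \<le> (f x)\<^sup>2" "(f x)\<^sup>2 \<le> 1" using f by (auto intro: power_le_one)
  have fs: "sqrt ((f x)\<^sup>2 * a) = f x * sqrt a" for a
    using f(1) by (simp add: real_sqrt_mult)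
  show "speed (warped_metric T f g) c x v \<le> speed g c x v"
    unfolding speed_def eq pyth[of v] using mult_right_mono[OF f2(2) D(4)[of "p v"]] by simp
  show "f x * speed g c x v \<le> speed (warped_metric T f g) c x v"
    unfolding speed_def eq pyth[of v] fs[symmetric]
    using mult_right_mono[OF f2(2) D(4)[of "v - p v"]] by (simp add: distrib_left)
  show "speed (warped_metric T f g) c x v = f x * speed g c x v" if "v \<in> T"
    using h that unfolding is_warped_form_def speed_def fs[symmetric] by simp
  have "speed g c x (v - p v) \<le> speed (warped_metric T f g) c x v"
    unfolding speed_def eq using mult_nonneg_nonneg[OF f2(1) D(4)[of "p v"]] by simp
  with p(1) show "\<exists>u\<in>T. speed g c x (v - u) \<le> speed (warped_metric T f g) c x v" by blast
  show "inner_product_form ?h"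
    unfolding inner_product_form_def
  proof (intro conjI allI impI)
    show "bilinear ?h" using h by (simp add: is_warped_form_def)
    show "?h v w = ?h w v" for v w
      unfolding eq using D(2)[of "p v" "p w"] D(2)[of "v - p v" "w - p w"] by simp
    show "0 < ?h v v" if "v \<noteq> 0" for v
    proof -
      have "0 < (f x)\<^sup>2 * ?q v v" using f D(3)[OF that] by simp
      also have "\<dots> \<le> ?h v v"
        unfolding eq pyth[of v] using mult_right_mono[OF f2(2) D(4)[of "v - p v"]]
        by (simp add: distrib_left)
      finally show ?thesis .
    qed
  qed
qed

lemma warped_metric_manifold:
  assumes T: "subspace T" and f: "\<And>x. x \<in> topspace X \<Longrightarrow> 0 < f x \<and> f x < 1"
    and fc: "\<And>c. c \<in> A \<Longrightarrow> continuous_on (snd c ` fst c) (f \<circ> chart_inv c)"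
  shows "metric_manifold X A (warped_metric T f g)"
proof
  fix c x assume c: "c \<in> A" "x \<in> fst c"
  then show "inner_product_form (warped_metric T f g c x)"
    using f topspace_chart by (intro warped_speed(5)[OF _ _ T]) blast+
next
  fix c v w assume c: "c \<in> A"
  let ?S = "snd c ` fst c"
  let ?q = "\<lambda>z. g c (chart_inv c z)"
  obtain B where B: "B \<subseteq> T" "independent B" "span B = T" "finite B"
    by (metis T basis_exists finiteI_independent span_subspace)
  have q: "inner_product_form (?q z)" if "z \<in> ?S" for z using form c that by simp
  obtain p where p: "\<And>z v. p z v \<in> T"
    "\<And>z v u. z \<in> ?S \<Longrightarrow> u \<in> T \<Longrightarrow> ?q z (v - p z v) u = 0" "\<And>v. continuous_on ?S (\<lambda>z. p z v)"
    using continuous_orthogonal_projection[of ?S ?q B, OF q coefficient_continuous[OF c] B(4,2)]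
    unfolding B(3) by blast
  have bl: "bilinear (?q z)" if "z \<in> ?S" for z using inner_product_form_D(1)[OF q[OF that]] .
  have cq: "continuous_on ?S (\<lambda>z. ?q z (v' z) (w' z))"
    if "continuous_on ?S v'" "continuous_on ?S w'" for v' w'
    by (rule continuous_on_form[of ?S ?q, OF bl coefficient_continuous[OF c] that])
  have pc: "continuous_on ?S (\<lambda>z. v - p z v)" for v
    by (intro continuous_on_diff continuous_on_const p(3))
  have "continuous_on ?S (\<lambda>z. ((f \<circ> chart_inv c) z)\<^sup>2 * ?q z (p z v) (p z w) + ?q z (v - p z v) (w - p z w))"
    by (intro continuous_on_add continuous_on_mult continuous_on_power fc c
        cq[OF p(3) p(3)] cq[OF pc pc])
  then show "continuous_on ?S (\<lambda>z. warped_metric T f g c (chart_inv c z) v w)"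
  proof (rule continuous_on_eq)
    fix z assume z: "z \<in> ?S"
    show "((f \<circ> chart_inv c) z)\<^sup>2 * ?q z (p z v) (p z w) + ?q z (v - p z v) (w - p z w)
      = warped_metric T f g c (chart_inv c z) v w"
      using is_warped_form_eq[OF warped_form[OF c chart_inv_mem[OF z] T] p(1) p(2)[OF z] q[OF z]] by simp
  qed
qed

end

section \<open>The leaf space and Gromov--Hausdorff distances\<close>

text \<open>The sums in the definition of \<open>leaf_rho\<close>, with lists replaced by an
  induction so that chains are easily concatenated and reversed. The rule \<open>stay\<close> is the
  list with one leaf and an empty sum.\<close>

inductive leaf_chain :: "'a set set \<Rightarrow> ('a \<Rightarrow> 'a \<Rightarrow> real) \<Rightarrow> 'a set \<Rightarrow> 'a set \<Rightarrow> real \<Rightarrow> bool"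
  for \<L> d
where
  stay: "L \<in> \<L> \<Longrightarrow> leaf_chain \<L> d L L 0"
| step: "\<lbrakk>L \<in> \<L>; leaf_chain \<L> d L' L'' s\<rbrakk> \<Longrightarrow> leaf_chain \<L> d L L'' (leaf_dist d L L' + s)"

lemma leaf_chain_in: "leaf_chain \<L> d L L' s \<Longrightarrow> L \<in> \<L> \<and> L' \<in> \<L>"
  by (induction rule: leaf_chain.induct) auto

lemma leaf_chain_trans:
  "leaf_chain \<L> d L L' s \<Longrightarrow> leaf_chain \<L> d L' L'' s' \<Longrightarrow> leaf_chain \<L> d L L'' (s + s')"
  by (induction rule: leaf_chain.induct) (auto simp: add.assoc intro: leaf_chain.step)

lemma leaf_chain_sym:
  assumes "\<And>x y. d x y = d y x" and "leaf_chain \<L> d L L' s"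
  shows "leaf_chain \<L> d L' L s"
  using assms(2)
proof induction
  case (step L L' L'' s)
  have "leaf_dist d L L' = leaf_dist d L' L"
    unfolding leaf_dist_def using assms(1) by (intro arg_cong[of _ _ Inf]) blast
  then have "leaf_chain \<L> d L' L (leaf_dist d L L' + 0)"
    using leaf_chain.step[OF conjunct1[OF leaf_chain_in[OF step.hyps(2)]] leaf_chain.stay[OF step.hyps(1)], of d]
    by simp
  from leaf_chain_trans[OF step.IH this] show ?case by (simp add: add.commute)
qed (rule leaf_chain.stay)

lemma sum_list_steps:
  "(\<Sum>i<length (L # L' # Ls) - 1. f ((L # L' # Ls) ! i) ((L # L' # Ls) ! Suc i)) =
    f L L' + (\<Sum>i<length (L' # Ls) - 1. f ((L' # Ls) ! i) ((L' # Ls) ! Suc i) :: real)"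
  by (simp add: sum.lessThan_Suc_shift del: sum.lessThan_Suc)

lemma leaf_rho_eq: "leaf_rho \<L> d L L' = Inf {s. leaf_chain \<L> d L L' s}"
proof -
  have list: "leaf_chain \<L> d (hd Ls) (last Ls) (\<Sum>i<length Ls - 1. leaf_dist d (Ls ! i) (Ls ! Suc i))"
    if "Ls \<noteq> []" "set Ls \<subseteq> \<L>" for Ls
    using that
  proof (induction Ls rule: induct_list012)
    case (3 L L' Ls)
    then have "leaf_chain \<L> d (hd (L' # Ls)) (last (L' # Ls))
        (\<Sum>i<length (L' # Ls) - 1. leaf_dist d ((L' # Ls) ! i) ((L' # Ls) ! Suc i))" by simp
    from leaf_chain.step[OF _ this, of L] 3(4) show ?case
      unfolding sum_list_steps by (simp del: length_Cons)
  qed (auto intro: leaf_chain.stay)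
  have chain: "\<exists>Ls. s = (\<Sum>i<length Ls - 1. leaf_dist d (Ls ! i) (Ls ! Suc i)) \<and>
      Ls \<noteq> [] \<and> set Ls \<subseteq> \<L> \<and> hd Ls = L \<and> last Ls = L'"
    if "leaf_chain \<L> d L L' s" for L L' s
    using that
  proof induction
    case (stay L)
    then show ?case by (intro exI[of _ "[L]"]) simp
  next
    case (step L L' L'' s)
    then obtain Ls where Ls: "s = (\<Sum>i<length (L' # Ls) - 1. leaf_dist d ((L' # Ls) ! i) ((L' # Ls) ! Suc i))"
      "set (L' # Ls) \<subseteq> \<L>" "last (L' # Ls) = L''"
      by (metis list.collapse)
    show ?case
      by (rule exI[of _ "L # L' # Ls"], unfold sum_list_steps) (use Ls step.hyps in auto)
  qed
  have "{\<Sum>i<length Ls - 1. leaf_dist d (Ls ! i) (Ls ! Suc i) | Ls.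
      Ls \<noteq> [] \<and> set Ls \<subseteq> \<L> \<and> hd Ls = L \<and> last Ls = L'} = {s. leaf_chain \<L> d L L' s}"
    using list chain by blast
  then show ?thesis by (simp add: leaf_rho_def)
qed

text \<open>Isolates what the construction of the Hausdorff leaf space uses of a foliation: a leaf
  through each point and a symmetric function, non-negative on the manifold.\<close>

locale leaf_space =
  fixes M :: "'a set" and \<L> :: "'a set set" and d :: "'a \<Rightarrow> 'a \<Rightarrow> real" and leaf :: "'a \<Rightarrow> 'a set"
  assumes leaf_in: "x \<in> M \<Longrightarrow> leaf x \<in> \<L>" and leaf_self: "x \<in> M \<Longrightarrow> x \<in> leaf x"
    and leaf_cases: "L \<in> \<L> \<Longrightarrow> \<exists>x\<in>M. L = leaf x" and leaf_subset: "L \<in> \<L> \<Longrightarrow> L \<subseteq> M"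
    and nonneg: "x \<in> M \<Longrightarrow> y \<in> M \<Longrightarrow> 0 \<le> d x y" and commute: "d x y = d y x"
begin

abbreviation "\<rho> \<equiv> leaf_rho \<L> d"

lemma leaf_dist_bounds:
  assumes "L \<in> \<L>" "L' \<in> \<L>"
  shows "0 \<le> leaf_dist d L L'" "x \<in> L \<Longrightarrow> y \<in> L' \<Longrightarrow> leaf_dist d L L' \<le> d x y"
    "e > 0 \<Longrightarrow> \<exists>x\<in>L. \<exists>y\<in>L'. d x y < leaf_dist d L L' + e"
proof -
  let ?S = "{d x y | x y. x \<in> L \<and> y \<in> L'}"
  obtain a b where "a \<in> M" "L = leaf a" "b \<in> M" "L' = leaf b"
    using leaf_cases[OF assms(1)] leaf_cases[OF assms(2)] by blast
  then have "d a b \<in> ?S" using leaf_self[of a] leaf_self[of b] by blast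
  then have ne: "?S \<noteq> {}" by (metis empty_iff)
  have s0: "0 \<le> s" if "s \<in> ?S" for s
    using that leaf_subset[OF assms(1)] leaf_subset[OF assms(2)] nonneg by blast
  show "0 \<le> leaf_dist d L L'" unfolding leaf_dist_def by (rule cInf_greatest[OF ne s0])
  have bdd: "bdd_below ?S" using s0 by (rule bdd_belowI)
  show "leaf_dist d L L' \<le> d x y" if "x \<in> L" "y \<in> L'"
  proof -
    have "d x y \<in> ?S" using that by blast
    then show ?thesis unfolding leaf_dist_def by (rule cInf_lower[OF _ bdd])
  qed
  show "\<exists>x\<in>L. \<exists>y\<in>L'. d x y < leaf_dist d L L' + e" if "e > 0"
  proof -
    have "Inf ?S < leaf_dist d L L' + e" using that by (simp add: leaf_dist_def)
    from cInf_lessD[OF ne this] show ?thesis by blast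
  qed
qed

lemma leaf_chain_nonneg: "leaf_chain \<L> d L L' s \<Longrightarrow> 0 \<le> s"
proof (induction rule: leaf_chain.induct)
  case (step L L' L'' s)
  then show ?case using leaf_dist_bounds(1)[of L L'] leaf_chain_in[OF step.hyps(2)] by simp
qed simp

lemma rho_le: "leaf_chain \<L> d L L' s \<Longrightarrow> \<rho> L L' \<le> s"
  unfolding leaf_rho_eq
proof (rule cInf_lower)
  show "bdd_below {s. leaf_chain \<L> d L L' s}"
    by (rule bdd_belowI[of _ 0]) (simp add: leaf_chain_nonneg)
qed simp

lemma rho_le_leaf_dist: "L \<in> \<L> \<Longrightarrow> L' \<in> \<L> \<Longrightarrow> \<rho> L L' \<le> leaf_dist d L L'"
  using rho_le[OF leaf_chain.step[OF _ leaf_chain.stay]] by simp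

lemma ex_leaf_chain: "L \<in> \<L> \<Longrightarrow> L' \<in> \<L> \<Longrightarrow> {s. leaf_chain \<L> d L L' s} \<noteq> {}"
  using leaf_chain.step[OF _ leaf_chain.stay] by blast

lemma rho_approx:
  assumes "L \<in> \<L>" "L' \<in> \<L>" "e > 0"
  obtains s where "leaf_chain \<L> d L L' s" "s < \<rho> L L' + e"
proof -
  have "Inf {s. leaf_chain \<L> d L L' s} < \<rho> L L' + e"
    using \<open>e > 0\<close> by (simp add: leaf_rho_eq)
  from cInf_lessD[OF ex_leaf_chain[OF assms(1,2)] this] show thesis using that by blast
qed

lemma rho_nonneg: "L \<in> \<L> \<Longrightarrow> L' \<in> \<L> \<Longrightarrow> 0 \<le> \<rho> L L'"
  unfolding leaf_rho_eq by (rule cInf_greatest[OF ex_leaf_chain]) (simp_all add: leaf_chain_nonneg)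

lemma rho_refl: "L \<in> \<L> \<Longrightarrow> \<rho> L L = 0"
  using rho_le[OF leaf_chain.stay] rho_nonneg by (intro antisym)

lemma rho_sym: "\<rho> L L' = \<rho> L' L"
proof -
  have "{s. leaf_chain \<L> d L L' s} = {s. leaf_chain \<L> d L' L s}"
    using leaf_chain_sym[of d \<L> L L'] leaf_chain_sym[of d \<L> L' L] commute by blast
  then show ?thesis by (simp add: leaf_rho_eq)
qed

text \<open>Leaf distances themselves may violate the triangle inequality, since \<open>L'\<close>
  can be approached from \<open>L\<close> and from \<open>L''\<close> at points far apart;
  concatenating chains restores it.\<close>

lemma rho_triangle:
  assumes "L \<in> \<L>" "L' \<in> \<L>" "L'' \<in> \<L>"
  shows "\<rho> L L'' \<le> \<rho> L L' + \<rho> L' L''"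
proof (rule field_le_epsilon)
  fix e :: real assume "e > 0"
  then have e: "e / 2 > 0" by simp
  obtain s where s: "leaf_chain \<L> d L L' s" "s < \<rho> L L' + e / 2"
    using rho_approx[OF assms(1,2) e] .
  obtain s' where s': "leaf_chain \<L> d L' L'' s'" "s' < \<rho> L' L'' + e / 2"
    using rho_approx[OF assms(2,3) e] .
  show "\<rho> L L'' \<le> \<rho> L L' + \<rho> L' L'' + e"
    using rho_le[OF leaf_chain_trans[OF s(1) s'(1)]] s(2) s'(2) by linarith
qed

lemma rho_le_dist:
  assumes "x \<in> M" "y \<in> M"
  shows "\<rho> (leaf x) (leaf y) \<le> d x y"
  using rho_le_leaf_dist[OF leaf_in[OF assms(1)] leaf_in[OF assms(2)]]
    leaf_dist_bounds(2)[OF leaf_in[OF assms(1)] leaf_in[OF assms(2)] leaf_self[OF assms(1)] leaf_self[OF assms(2)]]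
  by linarith

text \<open>The class of the leaf through \<open>x\<close>. It is a map on points because its
  distortion is measured against distances on the manifold.\<close>

definition proj :: "'a \<Rightarrow> 'a set set" where
  "proj x = {L \<in> \<L>. \<rho> (leaf x) L = 0}"

lemma HLS_eq: "HLS \<L> d = proj ` M"
proof -
  have "{(L, L'). L \<in> \<L> \<and> L' \<in> \<L> \<and> \<rho> L L' = 0} `` {leaf x} = proj x" if "x \<in> M" for x
    using leaf_in[OF that] by (auto simp: proj_def)
  moreover have "\<L> = leaf ` M" using leaf_in leaf_cases by auto
  ultimately show ?thesis
    unfolding HLS_def quotient_def by (auto simp: image_def)
qed

text \<open>The chosen representatives are at \<rho>-distance 0 from the leaves of \<open>x\<close>
  and \<open>y\<close>, so the triangle inequality in both directions makes the choice
  irrelevant.\<close>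

lemma HLS_dist_proj:
  assumes x: "x \<in> M" and y: "y \<in> M"
  shows "HLS_dist \<L> d (proj x) (proj y) = \<rho> (leaf x) (leaf y)"
proof -
  have some: "(SOME L. L \<in> proj z) \<in> \<L> \<and> \<rho> (leaf z) (SOME L. L \<in> proj z) = 0" if "z \<in> M" for z
  proof -
    have "leaf z \<in> proj z" using leaf_in[OF that] rho_refl by (simp add: proj_def)
    then have "(SOME L. L \<in> proj z) \<in> proj z" by (rule someI)
    then show ?thesis by (simp add: proj_def)
  qed
  define L L' where "L = (SOME L. L \<in> proj x)" and "L' = (SOME L. L \<in> proj y)"
  have L: "L \<in> \<L>" "\<rho> (leaf x) L = 0" "L' \<in> \<L>" "\<rho> (leaf y) L' = 0"
    using some[OF x] some[OF y] by (auto simp: L_def L'_def)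
  note lx = leaf_in[OF x] and ly = leaf_in[OF y]
  have "\<rho> L L' \<le> \<rho> (leaf x) (leaf y)"
    using rho_triangle[OF L(1) lx L(3)] rho_triangle[OF lx ly L(3)] L rho_sym[of L "leaf x"] by linarith
  moreover have "\<rho> (leaf x) (leaf y) \<le> \<rho> L L'"
    using rho_triangle[OF lx L(1) ly] rho_triangle[OF L(1) L(3) ly] L rho_sym[of L' "leaf y"] by linarith
  ultimately show ?thesis unfolding HLS_dist_def L_def[symmetric] L'_def[symmetric] by simp
qed

lemma proj_eq:
  assumes x: "x \<in> M" and y: "y \<in> M" and 0: "\<rho> (leaf x) (leaf y) = 0"
  shows "proj x = proj y"
proof -
  note lx = leaf_in[OF x] and ly = leaf_in[OF y]
  have "\<rho> (leaf x) L = \<rho> (leaf y) L" if "L \<in> \<L>" for L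
    using rho_triangle[OF lx ly that] rho_triangle[OF ly lx that] 0 rho_sym[of "leaf x" "leaf y"] by linarith
  then show ?thesis unfolding proj_def by auto
qed

lemma HLS_Metric_space: "Metric_space (HLS \<L> d) (dist_on (HLS \<L> d) (HLS_dist \<L> d))"
proof
  show "0 \<le> dist_on (HLS \<L> d) (HLS_dist \<L> d) P Q" for P Q
    by (auto simp: dist_on_def HLS_eq HLS_dist_proj rho_nonneg leaf_in)
  show "dist_on (HLS \<L> d) (HLS_dist \<L> d) P Q = dist_on (HLS \<L> d) (HLS_dist \<L> d) Q P" for P Q
    using rho_sym by (simp add: dist_on_def HLS_dist_def)
  fix P Q assume "P \<in> HLS \<L> d" and "Q \<in> HLS \<L> d"
  then obtain x y where x: "x \<in> M" "P = proj x" and y: "y \<in> M" "Q = proj y"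
    unfolding HLS_eq by blast
  have on: "dist_on (HLS \<L> d) (HLS_dist \<L> d) (proj a) (proj b) = \<rho> (leaf a) (leaf b)"
    if "a \<in> M" "b \<in> M" for a b
    using that HLS_dist_proj[OF that] by (simp add: dist_on_def HLS_eq)
  have "\<rho> (leaf x) (leaf y) = 0" if "proj x = proj y"
    using HLS_dist_proj[OF x(1) y(1)] HLS_dist_proj[OF x(1) x(1)] rho_refl[OF leaf_in[OF x(1)]] that
    by simp
  then show "dist_on (HLS \<L> d) (HLS_dist \<L> d) P Q = 0 \<longleftrightarrow> P = Q"
    using on[OF x(1) y(1)] proj_eq[OF x(1) y(1)] x(2) y(2) by auto
  fix R assume "R \<in> HLS \<L> d"
  then obtain z where z: "z \<in> M" "R = proj z" unfolding HLS_eq by blast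
  show "dist_on (HLS \<L> d) (HLS_dist \<L> d) P R
      \<le> dist_on (HLS \<L> d) (HLS_dist \<L> d) P Q + dist_on (HLS \<L> d) (HLS_dist \<L> d) Q R"
    unfolding x(2) y(2) z(2) on[OF x(1) y(1)] on[OF x(1) z(1)] on[OF y(1) z(1)]
    by (intro rho_triangle leaf_in x y z)
qed

end

text \<open>A continuous image of a compact space is compact. The map will be the identity for the
  warped distances and \<open>proj\<close> for the leaf space.\<close>

lemma compact_metric_space_image:
  assumes X: "compact_space X" "topspace X \<noteq> {}" and N: "\<pi> ` topspace X = N"
    and metric: "Metric_space N (dist_on N e)"
    and cont: "\<And>x r. x \<in> topspace X \<Longrightarrow> r > 0 \<Longrightarrow>
      \<exists>U. openin X U \<and> x \<in> U \<and> (\<forall>y\<in>U. e (\<pi> x) (\<pi> y) < r)"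
  shows "compact_metric_space N e"
proof -
  interpret Metric_space N "dist_on N e" by fact
  have "continuous_map X mtopology \<pi>"
    unfolding continuous_map_def topspace_mtopology
  proof (intro conjI allI impI)
    show "\<pi> \<in> topspace X \<rightarrow> N" using N by auto
    fix V assume V: "openin mtopology V"
    show "openin X {x \<in> topspace X. \<pi> x \<in> V}"
      unfolding openin_subopen[of X "{x \<in> topspace X. \<pi> x \<in> V}"]
    proof
      fix x assume x: "x \<in> {x \<in> topspace X. \<pi> x \<in> V}"
      then obtain r where r: "r > 0" "mball (\<pi> x) r \<subseteq> V"
        using V unfolding openin_mtopology by blast
      obtain U where U: "openin X U" "x \<in> U" "\<forall>y\<in>U. e (\<pi> x) (\<pi> y) < r"
        using cont x r(1) by blast
      have "y \<in> topspace X \<and> \<pi> y \<in> V" if "y \<in> U" for y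
      proof -
        have y: "y \<in> topspace X" using openin_subset[OF U(1)] that by blast
        then have "\<pi> y \<in> mball (\<pi> x) r"
          using U(3) that x N by (auto simp: dist_on_def)
        with r(2) y show ?thesis by blast
      qed
      with U show "\<exists>U. openin X U \<and> x \<in> U \<and> U \<subseteq> {x \<in> topspace X. \<pi> x \<in> V}" by blast
    qed
  qed
  then have "compactin mtopology (\<pi> ` topspace X)"
    using X(1) by (simp add: compact_space_def image_compactin)
  then show ?thesis
    unfolding compact_metric_space_def compact_space_def using metric X(2) N by auto
qed

section \<open>Estimates of Hausdorff and Gromov-Hausdorff distances\<close>

lemma hausdorff_dist_nonneg:
  assumes Z: "Metric_space Z \<delta>"
    and S: "S \<subseteq> Z" "S \<noteq> {}" "\<And>x y. x \<in> S \<Longrightarrow> y \<in> S \<Longrightarrow> \<delta> x y \<le> K"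
    and S': "S' \<subseteq> Z" "S' \<noteq> {}" "\<And>x y. x \<in> S' \<Longrightarrow> y \<in> S' \<Longrightarrow> \<delta> x y \<le> K'"
  shows "0 \<le> hausdorff_dist \<delta> S S'"
  unfolding hausdorff_dist_def
proof (rule cInf_greatest)
  interpret Metric_space Z \<delta> by fact
  obtain a b where ab: "a \<in> S" "b \<in> S'" using S(2) S'(2) by blast
  \<comment> \<open>A radius above all distances from \<open>S\<close> to \<open>b\<close> and from
    \<open>a\<close> to \<open>S'\<close> is admissible, so the infimum is not over the empty set.
    The 1 makes the inequalities strict.\<close>
  define r where "r = \<bar>K\<bar> + \<bar>K'\<bar> + \<delta> a b + 1"
  have "\<delta> s b < r" if "s \<in> S" for s
    using triangle[of s a b] S(1) S'(1) S(3)[OF that ab(1)] that ab by (force simp: r_def)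
  moreover have "\<delta> a s' < r" if "s' \<in> S'" for s'
    using triangle[of a b s'] S(1) S'(1) S'(3)[OF ab(2) that] that ab by (force simp: r_def)
  moreover have "0 < r" using nonneg[of a b] by (simp add: r_def add_nonneg_pos)
  ultimately show "{r. 0 < r \<and> (\<forall>s\<in>S. \<exists>s'\<in>S'. \<delta> s s' < r) \<and> (\<forall>s'\<in>S'. \<exists>s\<in>S. \<delta> s s' < r)} \<noteq> {}"
    using ab by blast
qed auto

lemma hausdorff_dist_le:
  assumes "0 < r" "\<And>s. s \<in> S \<Longrightarrow> \<exists>s'\<in>S'. \<delta> s s' < r" "\<And>s'. s' \<in> S' \<Longrightarrow> \<exists>s\<in>S. \<delta> s s' < r"
  shows "hausdorff_dist \<delta> S S' \<le> r"
  unfolding hausdorff_dist_def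
  by (rule cInf_lower) (use assms in \<open>auto intro!: bdd_belowI[of _ 0]\<close>)

text \<open>The spaces are glued by placing \<open>x\<close> and \<open>v\<close> at distance
  \<open>e (\<pi> x) v + \<epsilon>\<close>. A detour from \<open>M\<close> through \<open>N\<close>
  and back costs \<open>2 * \<epsilon>\<close> extra, exactly the distortion allowed by
  \<open>upper\<close>, so the triangle inequality survives.\<close>

lemma GH_dist_bounds:
  fixes M :: "'a set" and N :: "'b set"
  assumes M: "Metric_space M (dist_on M d)" "M \<noteq> {}" "\<And>x y. x \<in> M \<Longrightarrow> y \<in> M \<Longrightarrow> d x y \<le> K"
    and N: "Metric_space N (dist_on N e)" and \<pi>: "\<pi> ` M = N"
    and lower: "\<And>x y. x \<in> M \<Longrightarrow> y \<in> M \<Longrightarrow> e (\<pi> x) (\<pi> y) \<le> d x y"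
    and upper: "\<And>x y. x \<in> M \<Longrightarrow> y \<in> M \<Longrightarrow> d x y \<le> e (\<pi> x) (\<pi> y) + 2 * \<epsilon>" and "\<epsilon> > 0"
  shows "0 \<le> GH_dist M d N e" "GH_dist M d N e \<le> 2 * \<epsilon>"
proof -
  interpret M: Metric_space M "dist_on M d" by fact
  interpret N: Metric_space N "dist_on N e" by fact
  \<comment> \<open>The default 0 off the carriers keeps the function non-negative and symmetric
    everywhere, as \<open>Metric_space\<close> demands.\<close>
  define \<delta> where "\<delta> p q = (case (p, q) of
      (Inl x, Inl y) \<Rightarrow> dist_on M d x y
    | (Inr u, Inr v) \<Rightarrow> dist_on N e u v
    | (Inl x, Inr v) \<Rightarrow> if x \<in> M \<and> v \<in> N then e (\<pi> x) v + \<epsilon> else 0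
    | (Inr u, Inl y) \<Rightarrow> if y \<in> M \<and> u \<in> N then e (\<pi> y) u + \<epsilon> else 0)" for p q :: "'a + 'b"
  let ?Z = "Inl ` M \<union> Inr ` N :: ('a + 'b) set"
  have \<pi>N: "\<pi> x \<in> N" if "x \<in> M" for x using \<pi> that by blast
  have d0: "0 \<le> d x y" "d x y = d y x" "d x y = 0 \<longleftrightarrow> x = y" if "x \<in> M" "y \<in> M" for x y
    using M.nonneg[of x y] M.commute[of x y] M.zero[OF that] that by (simp_all add: dist_on_def)
  have e0: "0 \<le> e u v" "e u v = e v u" "e u v = 0 \<longleftrightarrow> u = v" if "u \<in> N" "v \<in> N" for u v
    using N.nonneg[of u v] N.commute[of u v] N.zero[OF that] that by (simp_all add: dist_on_def)
  have dt: "d x z \<le> d x y + d y z" if "x \<in> M" "y \<in> M" "z \<in> M" for x y z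
    using M.triangle[OF that] that by (simp add: dist_on_def)
  have et: "e u w \<le> e u v + e v w" if "u \<in> N" "v \<in> N" "w \<in> N" for u v w
    using N.triangle[OF that] that by (simp add: dist_on_def)
  have Z: "Metric_space ?Z \<delta>"
  proof
    show "0 \<le> \<delta> p q" for p q
      using \<open>\<epsilon> > 0\<close> e0(1) \<pi>N by (auto simp: \<delta>_def split: sum.split intro: add_nonneg_nonneg)
    show "\<delta> p q = \<delta> q p" for p q
      using M.commute N.commute by (auto simp: \<delta>_def split: sum.split)
    show "\<delta> p q = 0 \<longleftrightarrow> p = q" if "p \<in> ?Z" "q \<in> ?Z" for p q
    proof -
      have "e (\<pi> x) v + \<epsilon> \<noteq> 0" if "x \<in> M" "v \<in> N" for x v
        using e0(1)[OF \<pi>N[OF that(1)] that(2)] \<open>\<epsilon> > 0\<close> by linarith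
      then show ?thesis using that by (auto simp: \<delta>_def)
    qed
    have 1: "d x z \<le> (e (\<pi> x) v + \<epsilon>) + (e (\<pi> z) v + \<epsilon>)" if "x \<in> M" "z \<in> M" "v \<in> N" for x z v
      using upper[OF that(1,2)] et[OF \<pi>N[OF that(1)] that(3) \<pi>N[OF that(2)]] e0(2)[OF that(3) \<pi>N[OF that(2)]]
      by linarith
    have 2: "e u w \<le> (e (\<pi> x) u + \<epsilon>) + (e (\<pi> x) w + \<epsilon>)" if "x \<in> M" "u \<in> N" "w \<in> N" for x u w
      using et[OF that(2) \<pi>N[OF that(1)] that(3)] e0(2)[OF that(2) \<pi>N[OF that(1)]] \<open>\<epsilon> > 0\<close> by linarith
    \<comment> \<open>Moving within \<open>M\<close> before crossing to \<open>N\<close> is harmless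
      because \<pi> does not increase distances.\<close>
    have 3: "e (\<pi> x) v \<le> d x y + e (\<pi> y) v" if "x \<in> M" "y \<in> M" "v \<in> N" for x y v
      using et[OF \<pi>N[OF that(1)] \<pi>N[OF that(2)] that(3)] lower[OF that(1,2)] by linarith
    show "\<delta> p r \<le> \<delta> p q + \<delta> q r" if pqr: "p \<in> ?Z" "q \<in> ?Z" "r \<in> ?Z" for p q r
    proof (cases p; cases q; cases r)
      fix x y z assume "p = Inl x" "q = Inl y" "r = Inl z"
      then show ?thesis using pqr dt by (auto simp: \<delta>_def dist_on_def)
    next
      fix x y z assume "p = Inl x" "q = Inl y" "r = Inr z"
      then show ?thesis using pqr 3[of x y z] by (auto simp: \<delta>_def dist_on_def)
    next
      fix x y z assume "p = Inl x" "q = Inr y" "r = Inl z"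
      then show ?thesis using pqr 1[of x z y] by (auto simp: \<delta>_def dist_on_def)
    next
      fix x y z assume "p = Inl x" "q = Inr y" "r = Inr z"
      then show ?thesis using pqr et[of "\<pi> x" y z] \<pi>N by (auto simp: \<delta>_def dist_on_def)
    next
      fix x y z assume "p = Inr x" "q = Inl y" "r = Inl z"
      then show ?thesis using pqr 3[of z y x] d0(2)[of z y] by (auto simp: \<delta>_def dist_on_def)
    next
      fix x y z assume "p = Inr x" "q = Inl y" "r = Inr z"
      then show ?thesis using pqr 2[of y x z] by (auto simp: \<delta>_def dist_on_def)
    next
      fix x y z assume "p = Inr x" "q = Inr y" "r = Inl z"
      then show ?thesis using pqr et[of "\<pi> z" y x] \<pi>N e0(2)[of x y] by (auto simp: \<delta>_def dist_on_def)
    next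
      fix x y z assume "p = Inr x" "q = Inr y" "r = Inr z"
      then show ?thesis using pqr et by (auto simp: \<delta>_def dist_on_def)
    qed
  qed
  let ?S = "{hausdorff_dist \<delta> (\<phi> ` M) (\<psi> ` N) | (Z :: ('a + 'b) set) \<delta> \<phi> \<psi>.
            Metric_space Z \<delta> \<and> isometric_embedding M d Z \<delta> \<phi> \<and> isometric_embedding N e Z \<delta> \<psi>}"
  have "isometric_embedding M d ?Z \<delta> Inl" "isometric_embedding N e ?Z \<delta> Inr"
    by (auto simp: isometric_embedding_def \<delta>_def dist_on_def)
  with Z have mem: "hausdorff_dist \<delta> (Inl ` M) (Inr ` N) \<in> ?S" by blast
  have eK: "e u v \<le> K" if "u \<in> N" "v \<in> N" for u v
    using that \<pi> lower M(3) by (blast intro: order_trans)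
  \<comment> \<open>All ambient spaces matter here, not only the glued one: an infimum is below its
    elements only if the set is bounded below. \<open>K\<close> bounds both diameters, as \<pi> is
    onto and does not increase distances.\<close>
  have pos: "0 \<le> h" if h: "h \<in> ?S" for h
  proof -
    obtain Z :: "('a + 'b) set" and \<delta> \<phi> \<psi> where *: "h = hausdorff_dist \<delta> (\<phi> ` M) (\<psi> ` N)"
      "Metric_space Z \<delta>" "isometric_embedding M d Z \<delta> \<phi>" "isometric_embedding N e Z \<delta> \<psi>"
      using h by blast
    show ?thesis
      unfolding *(1)
      by (rule hausdorff_dist_nonneg[OF *(2), of _ K _ K])
        (use *(3,4) M(2,3) eK \<pi> in \<open>auto simp: isometric_embedding_def\<close>)
  qed
  show "0 \<le> GH_dist M d N e"
    unfolding GH_dist_def by (rule cInf_greatest) (use mem pos in blast)+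
  have "GH_dist M d N e \<le> hausdorff_dist \<delta> (Inl ` M) (Inr ` N)"
    unfolding GH_dist_def by (rule cInf_lower[OF mem bdd_belowI[OF pos]])
  also have "\<dots> \<le> 2 * \<epsilon>"
  proof (rule hausdorff_dist_le)
    \<comment> \<open>The distance is exactly \<epsilon>, but radii must exceed it strictly, hence
      the factor 2.\<close>
    have eq: "\<delta> (Inl x) (Inr (\<pi> x)) < 2 * \<epsilon>" if "x \<in> M" for x
      using that \<pi>N[OF that] e0(3)[of "\<pi> x" "\<pi> x"] \<open>\<epsilon> > 0\<close> by (simp add: \<delta>_def)
    show "\<exists>s'\<in>Inr ` N. \<delta> s s' < 2 * \<epsilon>" if "s \<in> Inl ` M" for s
      using that eq \<pi>N by blast
    show "\<exists>s\<in>Inl ` M. \<delta> s s' < 2 * \<epsilon>" if "s' \<in> Inr ` N" for s'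
      using that eq \<pi> by blast
  qed (use \<open>\<epsilon> > 0\<close> in simp)
  finally show "GH_dist M d N e \<le> 2 * \<epsilon>" .
qed

section \<open>The leaf distance and warped distances\<close>

lemma (in smooth_manifold) continuous_map_chartwise:
  fixes f :: "'a \<Rightarrow> 'b::topological_space"
  assumes "\<And>c. c \<in> A \<Longrightarrow> continuous_on (snd c ` fst c) (f \<circ> chart_inv c)"
  shows "continuous_map X euclidean f"
  unfolding continuous_map_def
proof (intro conjI allI impI)
  fix V :: "'b set" assume "openin euclidean V"
  then have V: "open V" by simp
  show "openin X {x \<in> topspace X. f x \<in> V}"
    unfolding openin_subopen[of X "{x \<in> topspace X. f x \<in> V}"]
  proof
    fix x assume x: "x \<in> {x \<in> topspace X. f x \<in> V}"
    then obtain c where c: "c \<in> A" "x \<in> fst c" using chart_cover by blast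
    define W where "W = (f \<circ> chart_inv c) -` V \<inter> snd c ` fst c"
    have "open W"
      unfolding W_def
      using assms[OF c(1)] V open_chart_range[OF c(1)] continuous_on_open_vimage by blast
    then have "openin X {y \<in> fst c. snd c y \<in> W}" by (rule openin_chart_preimage[OF c(1)])
    moreover have "y \<in> topspace X \<and> f y \<in> V" if "y \<in> fst c" "snd c y \<in> W" for y
      using that c(1) topspace_chart[OF c(1)] by (simp add: W_def subset_iff)
    then have "{y \<in> fst c. snd c y \<in> W} \<subseteq> {x \<in> topspace X. f x \<in> V}" by blast
    moreover have "x \<in> {y \<in> fst c. snd c y \<in> W}" using c x by (simp add: W_def)
    ultimately show "\<exists>U. openin X U \<and> x \<in> U \<and> U \<subseteq> {x \<in> topspace X. f x \<in> V}" by blast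
  qed
qed simp

lemma smooth_on_imp_continuous_on: "smooth_on S h \<Longrightarrow> continuous_on S h"
  unfolding smooth_on_def by (metis Ck_on.simps(1))

lemma same_plaque_iff:
  "(x, y) \<in> same_plaque A T \<longleftrightarrow> (\<exists>c\<in>A. x \<in> fst c \<and> y \<in> fst c \<and>
    connected_component (snd c ` fst c \<inter> (\<lambda>v. snd c x + v) ` T) (snd c x) (snd c y))"
  by (simp add: same_plaque_def case_prod_beta)

section \<open>Leaves and their infinitesimal distance\<close>

locale compact_foliated_manifold =
  fixes X :: "'a topology" and A :: "('a, 'e::euclidean_space) chart set" and T :: "'e set"
    and g :: "('a, 'e) tensor2"
  assumes foliated: "foliated_riemannian_manifold X A T g"
    and compact: "compact_space X" and connected_space: "connected_space X"

sublocale compact_foliated_manifold \<subseteq> connected_metric_manifold X A g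
proof
  note defs = foliated_riemannian_manifold_def foliated_manifold_def foliated_atlas_def
  show "smooth_atlas X A" using foliated by (simp add: defs)
  show "inner_product_form (g c x)" if "c \<in> A" "x \<in> fst c" for c x
    using foliated that by (simp add: defs riemannian_metric_def)
  show "continuous_on (snd c ` fst c) (\<lambda>z. g c (chart_inv c z) v w)" if "c \<in> A" for c v w
    using foliated that by (intro smooth_on_imp_continuous_on) (simp add: defs riemannian_metric_def)
qed (rule connected_space)

context compact_foliated_manifold
begin

abbreviation "plaque_rel \<equiv> same_plaque A T"

abbreviation (input) "leaf x \<equiv> plaque_rel\<^sup>* `` {x}"

lemma subspace_T: "subspace T" and topspace_nonempty: "topspace X \<noteq> {}"
  and Hausdorff: "Hausdorff_space X" and metric: "riemannian_metric A g"
  using foliated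
  by (auto simp: foliated_riemannian_manifold_def foliated_manifold_def foliated_atlas_def)

lemma same_plaque_topspace: "(x, y) \<in> plaque_rel \<Longrightarrow> x \<in> topspace X \<and> y \<in> topspace X"
  unfolding same_plaque_iff using topspace_chart by blast

text \<open>The slices through \<open>x\<close> and through \<open>y\<close> coincide, because the
  coordinates differ by an element of the subspace \<open>T\<close>.\<close>

lemma sym_same_plaque: "sym plaque_rel"
proof (rule symI)
  fix x y assume "(x, y) \<in> plaque_rel"
  then obtain c where c: "c \<in> A" "x \<in> fst c" "y \<in> fst c"
    "connected_component (snd c ` fst c \<inter> (\<lambda>v. snd c x + v) ` T) (snd c x) (snd c y)"
    unfolding same_plaque_iff by blast
  have "snd c y \<in> (\<lambda>v. snd c x + v) ` T" using connected_component_in[OF c(4)] by blast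
  then obtain u where u: "u \<in> T" "snd c y = snd c x + u" by blast
  have "(\<lambda>v. snd c y + v) ` T = (\<lambda>v. snd c x + v) ` T"
  proof (intro equalityI image_subsetI)
    fix v assume v: "v \<in> T"
    show "snd c y + v \<in> (\<lambda>v. snd c x + v) ` T"
      using subspace_add[OF subspace_T u(1) v] u(2) by (intro image_eqI[of _ _ "u + v"]) auto
    show "snd c x + v \<in> (\<lambda>v. snd c y + v) ` T"
      using subspace_diff[OF subspace_T v u(1)] u(2) by (intro image_eqI[of _ _ "v - u"]) auto
  qed
  then have "connected_component (snd c ` fst c \<inter> (\<lambda>v. snd c y + v) ` T) (snd c y) (snd c x)"
    using c(4) connected_component_sym by metis
  then show "(y, x) \<in> plaque_rel"
    unfolding same_plaque_iff using c by blast
qed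

lemma leaf_topspace: "(x, y) \<in> plaque_rel\<^sup>* \<Longrightarrow> x \<in> topspace X \<Longrightarrow> y \<in> topspace X"
  by (induction rule: rtrancl_induct) (use same_plaque_topspace in auto)

lemma leaf_eq:
  assumes "(x, y) \<in> plaque_rel\<^sup>*" shows "leaf x = leaf y"
proof -
  have "(y, x) \<in> plaque_rel\<^sup>*" using sym_rtrancl[OF sym_same_plaque] assms by (rule symD)
  with assms show ?thesis by (auto intro: rtrancl_trans)
qed

sublocale leaf_space "topspace X" "leaves X A T" "riemannian_dist A g" "\<lambda>x. leaf x"
proof
  show "leaf x \<in> leaves X A T" if "x \<in> topspace X" for x
    unfolding leaves_def by (rule quotientI[OF that])
  show "\<exists>x\<in>topspace X. L = leaf x" if "L \<in> leaves X A T" for L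
    using that unfolding leaves_def by (auto elim: quotientE)
  then show "L \<subseteq> topspace X" if "L \<in> leaves X A T" for L
    using that leaf_topspace by fast
qed (use dist_nonneg dist_sym in auto)

lemma segment_in_leaf:
  assumes c: "c \<in> A" and seg: "closed_segment z w \<subseteq> snd c ` fst c" and T: "w - z \<in> T"
  shows "(chart_inv c z, chart_inv c w) \<in> plaque_rel"
proof -
  have zw: "z \<in> snd c ` fst c" "w \<in> snd c ` fst c" using seg by auto
  have "closed_segment z w \<subseteq> (\<lambda>v. z + v) ` T"
  proof
    fix p assume "p \<in> closed_segment z w"
    then obtain s where "p = (1 - s) *\<^sub>R z + s *\<^sub>R w" unfolding closed_segment_def by blast
    then have "p = z + s *\<^sub>R (w - z)" by (simp add: algebra_simps)
    then show "p \<in> (\<lambda>v. z + v) ` T" using subspace_scale[OF subspace_T T] by blast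
  qed
  then have "connected_component (snd c ` fst c \<inter> (\<lambda>v. z + v) ` T) z w"
    unfolding connected_component_def using seg
    by (intro exI[of _ "closed_segment z w"]) auto
  then show ?thesis
    unfolding same_plaque_iff using c zw by (intro bexI[of _ c]) simp_all
qed

text \<open>With \<open>v\<close> the displacement in coordinates, go first along
  \<open>v - u\<close> to a point \<open>z\<close> and then along \<open>u\<close> to
  \<open>q\<close>. The second segment stays in the leaf of \<open>q\<close> and is free for \<rho>.
  The bound on the speed of \<open>v - u\<close> keeps \<open>z\<close> in the ball, so one \<delta>
  works for all \<open>u\<close>.\<close>

lemma rho_chart_le:
  assumes c: "c \<in> A" "p \<in> fst c" and "\<epsilon> > 0"
  shows "\<exists>\<delta>>0. \<forall>q\<in>fst c. norm (snd c q - snd c p) < \<delta> \<longrightarrow>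
    (\<forall>u\<in>T. speed g c p (snd c q - snd c p - u) \<le> speed g c p (snd c q - snd c p) \<longrightarrow>
      \<rho> (leaf p) (leaf q) \<le> speed g c p (snd c q - snd c p - u) + \<epsilon> * norm (snd c q - snd c p))"
proof -
  obtain m K where K: "m > 0" "K > 0" "\<And>v. m * norm v \<le> speed g c p v" "\<And>v. speed g c p v \<le> K * norm v"
    using speed_bounds[OF c] by metis
  \<comment> \<open>The speed bound on \<open>w\<close> gives
    \<open>m * norm w \<le> K * norm v\<close>. The factor \<open>m / K\<close> compensates for
    this, here in the tolerance and below in the second radius
    \<open>\<delta> * m / K\<close>.\<close>
  have "\<epsilon> * m / K > 0" using K(1,2) \<open>\<epsilon> > 0\<close> by simp
  then obtain \<delta> where \<delta>: "\<delta> > 0" "ball (snd c p) \<delta> \<subseteq> snd c ` fst c"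
    "\<And>z v. z \<in> ball (snd c p) \<delta> \<Longrightarrow> \<bar>speed g c (chart_inv c z) v - speed g c p v\<bar> \<le> \<epsilon> * m / K * norm v"
    using speed_near[OF c] by metis
  have "\<rho> (leaf p) (leaf q) \<le> speed g c p (snd c q - snd c p - u) + \<epsilon> * norm (snd c q - snd c p)"
    if q: "q \<in> fst c" "norm (snd c q - snd c p) < min \<delta> (\<delta> * m / K)" and u: "u \<in> T"
      "speed g c p (snd c q - snd c p - u) \<le> speed g c p (snd c q - snd c p)" for q u
  proof -
    define v where "v = snd c q - snd c p"
    define w where "w = v - u"
    define z where "z = snd c p + w"
    have mw: "m * norm w \<le> K * norm v"
      using K(3)[of w] K(4)[of v] u(2) by (simp add: v_def w_def)
    also have "\<dots> < m * \<delta>" using q(2) K(1,2) by (simp add: v_def pos_less_divide_eq mult_ac)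
    finally have "norm w < \<delta>" using K(1) by simp
    then have zb: "z \<in> ball (snd c p) \<delta>" by (simp add: z_def dist_norm)
    have pb: "snd c p \<in> ball (snd c p) \<delta>" using \<delta>(1) by simp
    have qb: "snd c q \<in> ball (snd c p) \<delta>" using q(2) by (simp add: dist_norm norm_minus_commute)
    have s1: "closed_segment (snd c p) z \<subseteq> ball (snd c p) \<delta>"
      and s2: "closed_segment z (snd c q) \<subseteq> ball (snd c p) \<delta>"
      using zb pb qb by (simp_all add: closed_segment_subset)
    have d1: "riemannian_dist A g (chart_inv c (snd c p)) (chart_inv c z)
        \<le> speed g c p w + \<epsilon> * m / K * norm w"
    proof (rule dist_segment[OF c(1)])
      show "closed_segment (snd c p) z \<subseteq> snd c ` fst c" using s1 \<delta>(2) by blast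
      show "speed g c (chart_inv c y) (z - snd c p) \<le> speed g c p w + \<epsilon> * m / K * norm w"
        if "y \<in> closed_segment (snd c p) z" for y
        using abs_le_D1[OF \<delta>(3)[of y w]] s1 that by (auto simp: z_def)
    qed
    have zU: "z \<in> snd c ` fst c" using zb \<delta>(2) by blast
    have "snd c q - z = u" by (simp add: z_def w_def v_def)
    then have "(chart_inv c z, chart_inv c (snd c q)) \<in> plaque_rel"
      using s2 \<delta>(2) u(1) by (intro segment_in_leaf[OF c(1)]) auto
    then have leaf: "leaf (chart_inv c z) = leaf q"
      using leaf_eq[OF r_into_rtrancl] c(1) q(1) by simp
    have pM: "p \<in> topspace X" "chart_inv c z \<in> topspace X"
      using topspace_chart[OF c(1)] c(2) chart_inv_mem[OF zU] by auto
    have "\<rho> (leaf p) (leaf q) \<le> speed g c p w + \<epsilon> * m / K * norm w"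
      using rho_le_dist[OF pM] d1 c unfolding leaf by simp
    also have "\<epsilon> * m / K * norm w = \<epsilon> / K * (m * norm w)" by simp
    also have "\<dots> \<le> \<epsilon> / K * (K * norm v)"
      using mw K(2) \<open>\<epsilon> > 0\<close> by (intro mult_left_mono) auto
    also have "\<dots> = \<epsilon> * norm v" using K(2) by simp
    finally show ?thesis by (simp add: v_def w_def)
  qed
  moreover have "min \<delta> (\<delta> * m / K) > 0" using \<delta>(1) K(1,2) by simp
  ultimately show ?thesis by blast
qed

end

section \<open>A single warped foliation: the lower bound and compactness\<close>

locale warped_foliation = compact_foliated_manifold +
  fixes f :: "'a \<Rightarrow> real"
  assumes warping: "warping_function X A T f"
    and range: "x \<in> topspace X \<Longrightarrow> f x \<in> {0<..<1}"
begin

abbreviation (input) "h \<equiv> warped_metric T f g"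

lemma f_bounds: "x \<in> topspace X \<Longrightarrow> 0 < f x" "x \<in> topspace X \<Longrightarrow> f x < 1"
  using range by auto

lemma f_continuous: "c \<in> A \<Longrightarrow> continuous_on (snd c ` fst c) (f \<circ> chart_inv c)"
  by (rule smooth_on_imp_continuous_on, rule bspec[OF conjunct1[OF warping[unfolded warping_function_def]]])

lemma f_plaque: "x \<in> topspace X \<Longrightarrow> (x, y) \<in> plaque_rel \<Longrightarrow> f x = f y"
proof -
  assume x: "x \<in> topspace X" and xy: "(x, y) \<in> plaque_rel"
  have "\<forall>L\<in>leaves X A T. \<forall>x\<in>L. \<forall>y\<in>L. f x = f y"
    by (rule conjunct2[OF conjunct2[OF warping[unfolded warping_function_def]]])
  moreover have "y \<in> leaf x" using xy by auto
  ultimately show "f x = f y" using leaf_in[OF x] leaf_self[OF x] by (meson bspec)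
qed

sublocale warped: connected_metric_manifold X A h
proof -
  interpret metric_manifold X A h
    by (rule warped_metric_manifold[OF subspace_T _ f_continuous]) (simp add: f_bounds)
  show "connected_metric_manifold X A h"
    by unfold_locales (rule connected_space)
qed

lemma warped_speed_topspace:
  assumes "c \<in> A" "x \<in> fst c"
  shows "speed h c x v \<le> speed g c x v"
    and "f x * speed g c x v \<le> speed h c x v"
    and "v \<in> T \<Longrightarrow> speed h c x v = f x * speed g c x v"
    and "\<exists>u\<in>T. speed g c x (v - u) \<le> speed h c x v"
proof -
  have x: "x \<in> topspace X" using topspace_chart[OF assms(1)] assms(2) by blast
  note w = warped_speed[where f = f, OF assms subspace_T f_bounds(1)[OF x] f_bounds(2)[OF x]]
  show "speed h c x v \<le> speed g c x v" by (rule w(1))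
  show "f x * speed g c x v \<le> speed h c x v" by (rule w(2))
  show "v \<in> T \<Longrightarrow> speed h c x v = f x * speed g c x v" by (rule w(3))
  show "\<exists>u\<in>T. speed g c x (v - u) \<le> speed h c x v" by (rule w(4))
qed

lemma warped_dist_le:
  assumes "x \<in> topspace X" "y \<in> topspace X"
  shows "riemannian_dist A h x y \<le> riemannian_dist A g x y"
proof -
  have "riemannian_dist A h x y \<le> 1 * riemannian_dist A g x y"
    by (rule riemannian_dist_mono[OF connected_metric_manifold_axioms
          warped.connected_metric_manifold_axioms _ zero_less_one assms])
      (simp add: warped_speed_topspace(1))
  then show ?thesis by simp
qed

lemma rho_le_warped_dist:
  assumes x: "x \<in> topspace X" and y: "y \<in> topspace X"
  shows "\<rho> (leaf x) (leaf y) \<le> riemannian_dist A h x y"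
proof (rule warped.dist_ge[OF x y])
  fix l assume l: "curve_chain A h x y l"
  have "\<bar>\<rho> (leaf x) (leaf y) - \<rho> (leaf x) (leaf x)\<bar> \<le> l"
  proof (rule warped.curve_chain_compare[OF _ l, of "\<lambda>p. \<rho> (leaf x) (leaf p)"])
    fix c p and \<epsilon> :: real assume c: "c \<in> A" "p \<in> fst c" and "\<epsilon> > 0"
    obtain \<delta> where \<delta>: "\<delta> > 0" "\<And>q u. q \<in> fst c \<Longrightarrow> norm (snd c q - snd c p) < \<delta> \<Longrightarrow> u \<in> T \<Longrightarrow>
      speed g c p (snd c q - snd c p - u) \<le> speed g c p (snd c q - snd c p) \<Longrightarrow>
      \<rho> (leaf p) (leaf q) \<le> speed g c p (snd c q - snd c p - u) + \<epsilon> * norm (snd c q - snd c p)"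
      using rho_chart_le[OF c \<open>\<epsilon> > 0\<close>] by blast
    have "\<bar>\<rho> (leaf x) (leaf q) - \<rho> (leaf x) (leaf p)\<bar>
        \<le> speed h c p (snd c q - snd c p) + \<epsilon> * norm (snd c q - snd c p)"
      if q: "q \<in> fst c" "norm (snd c q - snd c p) < \<delta>" for q
    proof -
      obtain u where u: "u \<in> T" "speed g c p (snd c q - snd c p - u) \<le> speed h c p (snd c q - snd c p)"
        using warped_speed_topspace(4)[OF c] by blast
      \<comment> \<open>The remainder after removing \<open>u\<close> is no longer than the warped
        displacement, hence no longer than the unwarped one, as \<open>rho_chart_le\<close>
        requires.\<close>
      have "\<rho> (leaf p) (leaf q) \<le> speed g c p (snd c q - snd c p - u) + \<epsilon> * norm (snd c q - snd c p)"
        using \<delta>(2)[OF q u(1)] u(2) warped_speed_topspace(1)[OF c] by (meson order_trans)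
      moreover have pq: "p \<in> topspace X" "q \<in> topspace X" using c q(1) topspace_chart by blast+
      have "\<rho> (leaf x) (leaf q) \<le> \<rho> (leaf x) (leaf p) + \<rho> (leaf p) (leaf q)"
        by (rule rho_triangle[OF leaf_in[OF x] leaf_in[OF pq(1)] leaf_in[OF pq(2)]])
      moreover have "\<rho> (leaf x) (leaf p) \<le> \<rho> (leaf x) (leaf q) + \<rho> (leaf q) (leaf p)"
        by (rule rho_triangle[OF leaf_in[OF x] leaf_in[OF pq(2)] leaf_in[OF pq(1)]])
      moreover have "\<rho> (leaf q) (leaf p) = \<rho> (leaf p) (leaf q)" by (rule rho_sym)
      ultimately show ?thesis using u(2) by linarith
    qed
    with \<delta>(1) show "\<exists>\<delta>>0. \<forall>q\<in>fst c. norm (snd c q - snd c p) < \<delta> \<longrightarrow>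
      \<bar>\<rho> (leaf x) (leaf q) - \<rho> (leaf x) (leaf p)\<bar>
        \<le> speed h c p (snd c q - snd c p) + \<epsilon> * norm (snd c q - snd c p)" by blast
  qed
  then show "\<rho> (leaf x) (leaf y) \<le> l" using rho_refl[OF leaf_in[OF x]] by linarith
qed

text \<open>By compactness the warping function has a positive minimum, so the warped speed
  dominates a multiple of the speed for \<open>g\<close>. Positivity is then inherited from
  \<open>g\<close>, whose transformation law is part of being a Riemannian metric.\<close>

lemma warped_dist_pos:
  assumes "x \<in> topspace X" "y \<in> topspace X" "x \<noteq> y"
  shows "0 < riemannian_dist A h x y"
proof -
  have "continuous_map X euclidean f" by (rule continuous_map_chartwise[OF f_continuous])
  moreover have "compactin X (topspace X)" using compact by (simp add: compact_space_def)
  ultimately have "compactin euclidean (f ` topspace X)" by (rule image_compactin[rotated])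
  then have "compact (f ` topspace X)" by simp
  then obtain a where a: "a \<in> topspace X" "\<And>x. x \<in> topspace X \<Longrightarrow> f a \<le> f x"
    using compact_attains_inf[of "f ` topspace X"] topspace_nonempty by blast
  have fa: "f a > 0" using f_bounds(1)[OF a(1)] .
  have le: "speed g c p v \<le> 1 / f a * speed h c p v" if c: "c \<in> A" "p \<in> fst c" for c p v
  proof -
    have "f a * speed g c p v \<le> f p * speed g c p v"
      using a(2) topspace_chart[OF c(1)] c by (intro mult_right_mono) auto
    then have "f a * speed g c p v \<le> speed h c p v" using warped_speed_topspace(2)[OF c, of v] by linarith
    then show ?thesis using fa by (simp add: pos_le_divide_eq mult.commute)
  qed
  have "riemannian_dist A g x y \<le> 1 / f a * riemannian_dist A h x y"
    by (rule riemannian_dist_mono[OF warped.connected_metric_manifold_axioms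
          connected_metric_manifold_axioms le divide_pos_pos[OF zero_less_one fa] assms(1,2)])
  moreover have "0 < riemannian_dist A g x y"
  proof (rule dist_pos[OF Hausdorff _ assms])
    fix c c' p v assume c: "c \<in> A" "c' \<in> A" "p \<in> fst c \<inter> fst c'"
    then have "g c p v w = g c' p (frechet_derivative (transition c c') (at (snd c p)) v)
        (frechet_derivative (transition c c') (at (snd c p)) w)" for w
      using metric unfolding riemannian_metric_def by blast
    then show "speed g c p v = speed g c' p (frechet_derivative (transition c c') (at (snd c p)) v)"
      by (simp add: speed_def)
  qed
  ultimately have "0 < 1 / f a * riemannian_dist A h x y" by linarith
  then show ?thesis by (rule zero_less_mult_pos[OF _ divide_pos_pos[OF zero_less_one fa]])
qed

lemma warped_Metric_space: "Metric_space (topspace X) (dist_on (topspace X) (riemannian_dist A h))"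
proof
  show "0 \<le> dist_on (topspace X) (riemannian_dist A h) x y" for x y
    by (simp add: dist_on_def warped.dist_nonneg)
  show "dist_on (topspace X) (riemannian_dist A h) x y = dist_on (topspace X) (riemannian_dist A h) y x" for x y
    by (simp add: dist_on_def warped.dist_sym)
  show "dist_on (topspace X) (riemannian_dist A h) x y = 0 \<longleftrightarrow> x = y"
    if "x \<in> topspace X" "y \<in> topspace X" for x y
    using that warped_dist_pos[OF that] warped.dist_refl[OF that(1)] by (force simp: dist_on_def)
  show "dist_on (topspace X) (riemannian_dist A h) x z
      \<le> dist_on (topspace X) (riemannian_dist A h) x y + dist_on (topspace X) (riemannian_dist A h) y z"
    if "x \<in> topspace X" "y \<in> topspace X" "z \<in> topspace X" for x y z
    using that warped.dist_triangle[OF that] by (simp add: dist_on_def)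
qed

lemma warped_compact: "compact_metric_space (topspace X) (riemannian_dist A h)"
proof (rule compact_metric_space_image[OF compact topspace_nonempty image_ident warped_Metric_space])
  show "\<exists>U. openin X U \<and> x \<in> U \<and> (\<forall>y\<in>U. riemannian_dist A h x y < r)"
    if "x \<in> topspace X" "r > 0" for x r
    using warped.openin_dist_ball[OF that(1), of r] that warped.dist_refl[OF that(1)]
    by (intro exI[of _ "{y \<in> topspace X. riemannian_dist A h x y < r}"]) auto
qed

end

section \<open>Convergence\<close>

locale warped_sequence = compact_foliated_manifold +
  fixes f :: "nat \<Rightarrow> 'a \<Rightarrow> real" and G :: "'a set"
  assumes warped: "warped_foliation X A T g (f n)"
    and dense: "X closure_of G = topspace X"
    and tendsto: "x \<in> G \<Longrightarrow> (\<lambda>n. f n x) \<longlonglongrightarrow> 0"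
begin

abbreviation "D n \<equiv> riemannian_dist A (warped_metric T (f n) g)"

lemma warped_connected: "connected_metric_manifold X A (warped_metric T (f n) g)"
proof -
  interpret w: warped_foliation X A T g "f n" by (rule warped)
  show ?thesis by (rule w.warped.connected_metric_manifold_axioms)
qed

lemmas D_triangle = connected_metric_manifold.dist_triangle[OF warped_connected]
  and D_nonneg = connected_metric_manifold.dist_nonneg[OF warped_connected]
  and D_sym = connected_metric_manifold.dist_sym[OF warped_connected]
  and D_le = warped_foliation.warped_dist_le[OF warped]

section \<open>Collapse of the leaves\<close>

lemma D_tendsto_trans:
  assumes "x \<in> topspace X" "y \<in> topspace X" "z \<in> topspace X"
    and "(\<lambda>n. D n x y) \<longlonglongrightarrow> 0" "(\<lambda>n. D n y z) \<longlonglongrightarrow> 0"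
  shows "(\<lambda>n. D n x z) \<longlonglongrightarrow> 0"
proof (rule tendsto_sandwich[OF _ _ tendsto_const])
  show "(\<lambda>n. D n x y + D n y z) \<longlonglongrightarrow> 0" using tendsto_add[OF assms(4,5)] by simp
qed (simp_all add: D_nonneg D_triangle assms(1-3))

lemma D_tendsto_local:
  assumes c: "c \<in> A" "x \<in> fst c"
  obtains \<delta> where "\<delta> > 0" "ball (snd c x) \<delta> \<subseteq> snd c ` fst c"
    "\<And>w. w \<in> ball (snd c x) \<delta> \<Longrightarrow> w - snd c x \<in> T \<Longrightarrow> (\<lambda>n. D n x (chart_inv c w)) \<longlonglongrightarrow> 0"
proof -
  obtain \<delta>1 K where K: "\<delta>1 > 0" "K > 0" "ball (snd c x) \<delta>1 \<subseteq> snd c ` fst c"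
    "\<And>z w. z \<in> ball (snd c x) \<delta>1 \<Longrightarrow> w \<in> ball (snd c x) \<delta>1 \<Longrightarrow>
      riemannian_dist A g (chart_inv c z) (chart_inv c w) \<le> K * norm (w - z)"
    using dist_local[OF c] by metis
  obtain \<delta>2 where \<delta>2: "\<delta>2 > 0" "ball (snd c x) \<delta>2 \<subseteq> snd c ` fst c"
    "\<And>z v. z \<in> ball (snd c x) \<delta>2 \<Longrightarrow> \<bar>speed g c (chart_inv c z) v - speed g c x v\<bar> \<le> 1 * norm v"
    using speed_near[OF c zero_less_one] by metis
  define \<delta> where "\<delta> = min \<delta>1 \<delta>2"
  have \<delta>: "\<delta> > 0" "\<delta> \<le> \<delta>1" "\<delta> \<le> \<delta>2" using K(1) \<delta>2(1) by (auto simp: \<delta>_def)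
  define z where "z = snd c x"
  have sub: "p \<in> snd c ` fst c" "chart_inv c p \<in> topspace X" "p \<in> ball z \<delta>1" "p \<in> ball z \<delta>2"
    if "p \<in> ball z \<delta>" for p
  proof -
    show p: "p \<in> ball z \<delta>1" "p \<in> ball z \<delta>2" using that \<delta> by auto
    show pU: "p \<in> snd c ` fst c" using p(1) K(3) unfolding z_def by (rule subsetD[rotated])
    show "chart_inv c p \<in> topspace X" by (rule subsetD[OF topspace_chart[OF c(1)] chart_inv_mem[OF pU]])
  qed
  have lim: "(\<lambda>n. D n x (chart_inv c w)) \<longlonglongrightarrow> 0" if w: "w \<in> ball z \<delta>" "w - z \<in> T" for w
  proof -
    define B where "B = speed g c x (w - z) + norm (w - z)"
    have small: "\<forall>\<^sub>F n in sequentially. D n x (chart_inv c w) < e" if "e > 0" for e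
    proof -
      \<comment> \<open>The first term keeps the translated segment in the ball; the second makes
        each displacement of an end cost at most \<open>e / 4\<close>.\<close>
      define \<eta> where "\<eta> = min (\<delta> - dist z w) (e / (4 * K))"
      have "K * \<eta> \<le> K * (e / (4 * K))" using K(2) by (intro mult_left_mono) (auto simp: \<eta>_def)
      also have "\<dots> = e / 4" using K(2) by simp
      finally have K\<eta>: "K * \<eta> \<le> e / 4" .
      have \<eta>: "\<eta> > 0" "\<eta> \<le> \<delta> - dist z w"
        using w(1) K(2) \<open>e > 0\<close> by (auto simp: \<eta>_def)
      then have "\<eta> \<le> \<delta>" using zero_le_dist[of z w] by linarith
      let ?U = "{y \<in> fst c. snd c y \<in> ball z \<eta>}"
      have U: "openin X ?U" "x \<in> ?U"
        using openin_chart_preimage[OF c(1) open_ball] c \<eta>(1) by (simp_all add: z_def)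
      have "x \<in> X closure_of G" using dense c topspace_chart by blast
      then have "\<forall>V. x \<in> V \<and> openin X V \<longrightarrow> (\<exists>a. a \<in> G \<and> a \<in> V)"
        unfolding in_closure_of by (rule conjunct2)
      from spec[OF this, of ?U, THEN mp, OF conjI[OF U(2,1)]]
      obtain a where "a \<in> G" "a \<in> ?U" by (elim exE conjE)
      then have a: "a \<in> G" "a \<in> fst c" "snd c a \<in> ball z \<eta>" by simp_all
      define h where "h = snd c a - z"
      have h: "norm h < \<eta>" using a(3) by (simp add: h_def dist_norm norm_minus_commute)
      have za: "z + h = snd c a" by (simp add: h_def)
      have z: "z \<in> ball z \<delta>" "z + h \<in> ball z \<delta>" "w + h \<in> ball z \<delta>"
      proof -
        show "z \<in> ball z \<delta>" using \<delta>(1) by simp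
        show "z + h \<in> ball z \<delta>" using h \<open>\<eta> \<le> \<delta>\<close> by (simp add: dist_norm)
        have "dist z (w + h) \<le> dist z w + norm h"
          using norm_triangle_ineq4[of "z - w" h] by (simp add: dist_norm diff_diff_eq)
        then show "w + h \<in> ball z \<delta>" using h \<eta>(2) by simp
      qed
      have inv: "chart_inv c z = x" "chart_inv c (z + h) = a"
        using c a(2) za by (simp_all add: z_def)
      have seg: "closed_segment (z + h) (w + h) \<subseteq> ball z \<delta>"
        using z by (simp add: closed_segment_subset)
      have 1: "D n x a \<le> e / 4" for n
      proof -
        have "D n x a \<le> riemannian_dist A g (chart_inv c z) (chart_inv c (z + h))"
          unfolding inv using sub(2)[OF z(1)] sub(2)[OF z(2)] unfolding inv by (rule D_le)
        also have "\<dots> \<le> K * norm h"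
          using K(4)[of z "z + h"] sub(3)[OF z(1)] sub(3)[OF z(2)] by (simp add: z_def)
        also have "\<dots> \<le> K * \<eta>" using h K(2) by simp
        finally show ?thesis using K\<eta> by linarith
      qed
      have 2: "D n (chart_inv c (w + h)) (chart_inv c w) \<le> e / 4" for n
      proof -
        have "D n (chart_inv c (w + h)) (chart_inv c w)
            \<le> riemannian_dist A g (chart_inv c (w + h)) (chart_inv c w)"
          using sub(2)[OF z(3)] sub(2)[OF w(1)] by (rule D_le)
        also have "\<dots> \<le> K * norm h"
          using K(4)[of "w + h" w] sub(3)[OF z(3)] sub(3)[OF w(1)] by (simp add: z_def)
        also have "\<dots> \<le> K * \<eta>" using h K(2) by simp
        finally show ?thesis using K\<eta> by linarith
      qed
      have 3: "D n a (chart_inv c (w + h)) \<le> f n a * B" for n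
      proof -
        interpret w: warped_foliation X A T g "f n" by (rule warped)
        have "D n (chart_inv c (z + h)) (chart_inv c (w + h)) \<le> f n a * B"
        proof (rule w.warped.dist_segment[OF c(1)])
          show "closed_segment (z + h) (w + h) \<subseteq> snd c ` fst c" using seg sub(1) by blast
          fix p assume p: "p \<in> closed_segment (z + h) (w + h)"
          have pb: "p \<in> ball z \<delta>" using p seg by blast
          obtain s where s: "p = (1 - s) *\<^sub>R (z + h) + s *\<^sub>R (w + h)"
            using p unfolding closed_segment_def by blast
          have "p - (z + h) = s *\<^sub>R (w - z)" unfolding s by (simp add: algebra_simps)
          then have "p - (z + h) \<in> T" using subspace_scale[OF subspace_T w(2)] by simp
          moreover have "closed_segment (z + h) p \<subseteq> snd c ` fst c"
            using closed_segment_subset[OF z(2) pb convex_ball] sub(1) by blast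
          ultimately have "(chart_inv c (z + h), chart_inv c p) \<in> plaque_rel"
            by (intro segment_in_leaf[OF c(1)])
          then have fp: "f n a = f n (chart_inv c p)"
            using w.f_plaque[of a "chart_inv c p"] sub(2)[OF z(2)] unfolding inv by blast
          have "speed (warped_metric T (f n) g) c (chart_inv c p) (w + h - (z + h))
              = f n a * speed g c (chart_inv c p) (w - z)"
            using w.warped_speed_topspace(3)[OF c(1) chart_inv_mem[OF sub(1)[OF pb]] w(2)] fp by simp
          also have "\<dots> \<le> f n a * B"
          proof (rule mult_left_mono)
            show "speed g c (chart_inv c p) (w - z) \<le> B"
              using abs_le_D1[OF \<delta>2(3)[of p "w - z"]] sub(4)[OF pb] by (simp add: B_def z_def)
            show "0 \<le> f n a" using w.f_bounds(1)[of a] sub(2)[OF z(2)] unfolding inv by simp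
          qed
          finally show "speed (warped_metric T (f n) g) c (chart_inv c p) (w + h - (z + h)) \<le> f n a * B" .
        qed
        then show ?thesis unfolding inv .
      qed
      \<comment> \<open>The point \<open>a\<close> depends on \<open>e\<close> but not on
        \<open>n\<close>, so convergence at this one point of \<open>G\<close> suffices. The three
        parts of the path add up to less than \<open>3 * e / 4\<close>.\<close>
      have "(\<lambda>n. f n a * B) \<longlonglongrightarrow> 0" using tendsto_mult_left_zero[OF tendsto[OF a(1)]] .
      then have "\<forall>\<^sub>F n in sequentially. f n a * B < e / 4"
        using \<open>e > 0\<close> by (intro order_tendstoD(2)) auto
      then show ?thesis
      proof (rule eventually_mono)
        fix n assume "f n a * B < e / 4"
        moreover note 1[of n] 2[of n] 3[of n]
        moreover have M: "x \<in> topspace X" "a \<in> topspace X" "chart_inv c (w + h) \<in> topspace X"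
          "chart_inv c w \<in> topspace X"
          using sub(2)[OF z(1)] sub(2)[OF z(2)] sub(2)[OF z(3)] sub(2)[OF w(1)] by (simp_all add: inv)
        moreover note D_triangle[OF M(1,2,4), of n] D_triangle[OF M(2,3,4), of n]
        ultimately show "D n x (chart_inv c w) < e" using \<open>e > 0\<close> by linarith
      qed
    qed
    have "x \<in> topspace X" using c topspace_chart by blast
    then have D0: "0 \<le> D n x (chart_inv c w)" for n using sub(2)[OF w(1)] by (rule D_nonneg)
    show ?thesis
    proof (rule order_tendstoI)
      show "\<forall>\<^sub>F n in sequentially. e < D n x (chart_inv c w)" if "e < 0" for e
        by (rule always_eventually) (use less_le_trans[OF that D0] in blast)
    qed (rule small)
  qed
  show thesis
  proof (rule that[OF \<delta>(1)])
    show "ball (snd c x) \<delta> \<subseteq> snd c ` fst c" using sub(1) unfolding z_def by blast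
  qed (use lim in \<open>simp add: z_def\<close>)
qed

text \<open>A plaque need not be convex in the chart, so one segment may not join its points. By the
  local result the relation \<open>?R\<close> has relatively open classes in the connected set
  \<open>C\<close>, which leaves one class.\<close>

lemma D_tendsto_plaque:
  assumes "(x, y) \<in> plaque_rel"
  shows "(\<lambda>n. D n x y) \<longlonglongrightarrow> 0"
proof -
  obtain c where c: "c \<in> A" "x \<in> fst c" "y \<in> fst c"
    "connected_component (snd c ` fst c \<inter> (\<lambda>v. snd c x + v) ` T) (snd c x) (snd c y)"
    using assms unfolding same_plaque_iff by blast
  obtain C where C: "connected C" "C \<subseteq> snd c ` fst c \<inter> (\<lambda>v. snd c x + v) ` T" "snd c x \<in> C" "snd c y \<in> C"
    using c(4) unfolding connected_component_def by blast
  have CX: "chart_inv c z \<in> topspace X" if "z \<in> C" for z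
  proof -
    have "z \<in> snd c ` fst c" using C(2) that by blast
    then show ?thesis by (rule subsetD[OF topspace_chart[OF c(1)] chart_inv_mem])
  qed
  let ?R = "\<lambda>z w. (\<lambda>n. D n (chart_inv c z) (chart_inv c w)) \<longlonglongrightarrow> 0"
  have "?R (snd c x) (snd c y)"
  proof (rule connected_equivalence_relation[OF C(1,3,4), of ?R])
    show "?R w z" if "?R z w" for z w using that by (simp add: D_sym)
    show "?R z p" if "?R z w" "?R w p" "z \<in> C" "w \<in> C" "p \<in> C" for z w p
      by (rule D_tendsto_trans[OF CX[OF that(3)] CX[OF that(4)] CX[OF that(5)] that(1,2)])
    fix a assume a: "a \<in> C"
    then have aU: "a \<in> snd c ` fst c" using C(2) by blast
    obtain \<delta> where \<delta>: "\<delta> > 0" "\<And>w. w \<in> ball a \<delta> \<Longrightarrow> w - a \<in> T \<Longrightarrow> ?R a w"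
      using D_tendsto_local[OF c(1) chart_inv_mem[OF aU]] chart_inv_right[OF aU] by metis
    have "?R a w" if w: "w \<in> C \<inter> ball a \<delta>" for w
    proof -
      obtain u u' where "u \<in> T" "a = snd c x + u" "u' \<in> T" "w = snd c x + u'"
        using C(2) a w by blast
      then have "w - a \<in> T" using subspace_diff[OF subspace_T, of u' u] by simp
      then show ?thesis using \<delta>(2) w by blast
    qed
    then show "\<exists>S. openin (top_of_set C) S \<and> a \<in> S \<and> (\<forall>w\<in>S. ?R a w)"
      using a \<delta>(1) by (intro exI[of _ "C \<inter> ball a \<delta>"]) (simp add: openin_open_Int)
  qed
  then show ?thesis using c by simp
qed

lemma D_tendsto_leaf:
  assumes "x \<in> topspace X" "(x, y) \<in> plaque_rel\<^sup>*"
  shows "(\<lambda>n. D n x y) \<longlonglongrightarrow> 0"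
  using assms(2)
proof (induction rule: rtrancl_induct)
  case base
  have "D n x x = 0" for n
    by (rule connected_metric_manifold.dist_refl[OF warped_connected assms(1)])
  then show ?case by simp
next
  case (step y z)
  have y: "y \<in> topspace X" "z \<in> topspace X" using same_plaque_topspace[OF step.hyps(2)] by auto
  show ?case
    by (rule D_tendsto_trans[OF assms(1) y step.IH D_tendsto_plaque[OF step.hyps(2)]])
qed

lemma D_eventually_leaf:
  assumes L: "L \<in> leaves X A T" and x: "x \<in> L" and y: "y \<in> L" and "e > 0"
  shows "\<forall>\<^sub>F n in sequentially. D n x y < e"
proof -
  obtain z where z: "z \<in> topspace X" "L = plaque_rel\<^sup>* `` {z}" using leaf_cases[OF L] by blast
  have xy: "x \<in> topspace X" "y \<in> topspace X" using leaf_subset[OF L] x y by auto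
  have "(\<lambda>n. D n x z) \<longlonglongrightarrow> 0" "(\<lambda>n. D n z y) \<longlonglongrightarrow> 0"
    using D_tendsto_leaf[OF z(1), of x] D_tendsto_leaf[OF z(1), of y] x y z(2) by (simp_all add: D_sym[of _ x z])
  then have "(\<lambda>n. D n x y) \<longlonglongrightarrow> 0" by (rule D_tendsto_trans[OF xy(1) z(1) xy(2)])
  then show ?thesis using \<open>e > 0\<close> by (rule order_tendstoD(2))
qed

text \<open>Each step of the chain moves inside \<open>L\<close> to an almost nearest point, which
  is free in the limit, and then jumps to \<open>L'\<close>. A third of \<open>e\<close> goes to the
  motion in the leaf, to the approximation of the leaf distance and to the rest of the chain, which
  starts at a new point; hence the generalisation over \<open>x\<close> and
  \<open>e\<close>.\<close>

lemma D_eventually_chain: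
  assumes "leaf_chain (leaves X A T) (riemannian_dist A g) L L' s" "x \<in> L" "y \<in> L'" "e > 0"
  shows "\<forall>\<^sub>F n in sequentially. D n x y < s + e"
  using assms
proof (induction arbitrary: x e)
  case (stay L)
  then show ?case using D_eventually_leaf[of L x y e] by simp
next
  case (step L L' L'' s)
  have L': "L' \<in> leaves X A T" "L'' \<in> leaves X A T" using leaf_chain_in[OF step.hyps(2)] by auto
  have e: "e / 3 > 0" using step.prems by simp
  obtain u v where u: "u \<in> L" "v \<in> L'"
    "riemannian_dist A g u v < leaf_dist (riemannian_dist A g) L L' + e / 3"
    using leaf_dist_bounds(3)[OF step.hyps(1) L'(1) e] by blast
  have M: "x \<in> topspace X" "u \<in> topspace X" "v \<in> topspace X" "y \<in> topspace X"
    using leaf_subset step.hyps(1) L' step.prems u by blast+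
  have "\<forall>\<^sub>F n in sequentially. D n x u < e / 3"
    by (rule D_eventually_leaf[OF step.hyps(1) step.prems(1) u(1) e])
  moreover have "\<forall>\<^sub>F n in sequentially. D n v y < s + e / 3"
    by (rule step.IH[OF u(2) step.prems(2) e])
  ultimately show ?case
  proof eventually_elim
    case (elim n)
    then show ?case
      using D_triangle[OF M(1,2,4), of n] D_triangle[OF M(2,3,4), of n] D_le[OF M(2,3), of n] u(3)
      by linarith
  qed
qed

lemma D_eventually_rho:
  assumes "x \<in> topspace X" "y \<in> topspace X" "e > 0"
  shows "\<forall>\<^sub>F n in sequentially. D n x y < \<rho> (leaf x) (leaf y) + e"
proof -
  have e: "e / 2 > 0" using \<open>e > 0\<close> by simp
  obtain s where s: "leaf_chain (leaves X A T) (riemannian_dist A g) (leaf x) (leaf y) s"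
    "s < \<rho> (leaf x) (leaf y) + e / 2"
    using rho_approx[OF leaf_in[OF assms(1)] leaf_in[OF assms(2)] e] .
  from D_eventually_chain[OF s(1) leaf_self[OF assms(1)] leaf_self[OF assms(2)] e]
  show ?thesis by (rule eventually_mono) (use s(2) in linarith)
qed

section \<open>From pointwise to uniform convergence\<close>

lemma finite_net:
  assumes "e > 0"
  obtains F where "finite F" "F \<subseteq> topspace X"
    "\<And>x. x \<in> topspace X \<Longrightarrow> \<exists>a\<in>F. riemannian_dist A g a x < e"
proof -
  let ?B = "\<lambda>a. {y \<in> topspace X. riemannian_dist A g a y < e}"
  have "\<forall>U\<in>?B ` topspace X. openin X U" using openin_dist_ball by blast
  moreover have "topspace X \<subseteq> \<Union>(?B ` topspace X)"
  proof
    fix x assume x: "x \<in> topspace X"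
    then have "x \<in> ?B x" using dist_refl[OF x] \<open>e > 0\<close> by simp
    with x show "x \<in> \<Union>(?B ` topspace X)" by blast
  qed
  ultimately obtain \<F> where \<F>: "finite \<F>" "\<F> \<subseteq> ?B ` topspace X" "topspace X \<subseteq> \<Union>\<F>"
    using compact unfolding compact_space_alt by meson
  obtain F where F: "F \<subseteq> topspace X" "finite F" "\<F> = ?B ` F"
    using finite_subset_image[OF \<F>(1,2)] by blast
  have "\<exists>a\<in>F. riemannian_dist A g a x < e" if "x \<in> topspace X" for x
    using \<F>(3) that unfolding F(3) by blast
  with F show thesis using that by blast
qed

text \<open>Supplies the diameter bound of \<open>GH_dist_bounds\<close>; since warped distances are
  no larger, it serves all \<open>n\<close>.\<close>

lemma dist_bounded:
  obtains K where "\<And>x y. x \<in> topspace X \<Longrightarrow> y \<in> topspace X \<Longrightarrow> riemannian_dist A g x y \<le> K"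
proof -
  obtain F where F: "finite F" "F \<subseteq> topspace X"
    "\<And>x. x \<in> topspace X \<Longrightarrow> \<exists>a\<in>F. riemannian_dist A g a x < 1"
    using finite_net[of 1] by auto
  define K where "K = Max ((\<lambda>(a, b). riemannian_dist A g a b) ` (F \<times> F))"
  have "riemannian_dist A g x y \<le> K + 2" if xy: "x \<in> topspace X" "y \<in> topspace X" for x y
  proof -
    obtain a b where a: "a \<in> F" "riemannian_dist A g a x < 1" and b: "b \<in> F" "riemannian_dist A g b y < 1"
      using F(3)[OF xy(1)] F(3)[OF xy(2)] by blast
    have M: "a \<in> topspace X" "b \<in> topspace X" using a b F(2) by auto
    have "riemannian_dist A g a b \<le> K"
      unfolding K_def using F(1) a b by (intro Max_ge) auto
    then show ?thesis
      using a b dist_triangle[OF xy(1) M(1) xy(2)] dist_triangle[OF M xy(2)] dist_sym[of x a] by linarith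
  qed
  then show thesis by (rule that)
qed

text \<open>When a point moves, \<open>D n\<close> and \<rho> change by at most the distance moved
  for \<open>g\<close>, whatever \<open>n\<close> is. So the finitely many pairs from a net control
  all pairs.\<close>

lemma D_uniform:
  assumes "e > 0"
  shows "\<forall>\<^sub>F n in sequentially. \<forall>x\<in>topspace X. \<forall>y\<in>topspace X. D n x y \<le> \<rho> (leaf x) (leaf y) + e"
proof -
  \<comment> \<open>Replacing \<open>x\<close> and \<open>y\<close> by points of the net costs
    \<open>e / 8\<close> four times, twice in \<open>D n\<close> and twice in \<rho>; the other half
    of \<open>e\<close> is left for the pairs of the net.\<close>
  have e: "e / 8 > 0" "e / 2 > 0" using \<open>e > 0\<close> by auto
  obtain F where F: "finite F" "F \<subseteq> topspace X"
    "\<And>x. x \<in> topspace X \<Longrightarrow> \<exists>a\<in>F. riemannian_dist A g a x < e / 8"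
    using finite_net[OF e(1)] by metis
  have "\<forall>\<^sub>F n in sequentially. \<forall>a\<in>F. \<forall>b\<in>F. D n a b < \<rho> (leaf a) (leaf b) + e / 2"
    using F(2) by (intro eventually_ball_finite F(1) ballI D_eventually_rho e(2)) auto
  then show ?thesis
  proof (rule eventually_mono, intro ballI)
    fix n x y assume n: "\<forall>a\<in>F. \<forall>b\<in>F. D n a b < \<rho> (leaf a) (leaf b) + e / 2"
      and xy: "x \<in> topspace X" "y \<in> topspace X"
    obtain a b where a: "a \<in> F" "riemannian_dist A g a x < e / 8" and b: "b \<in> F" "riemannian_dist A g b y < e / 8"
      using F(3)[OF xy(1)] F(3)[OF xy(2)] by blast
    have M: "a \<in> topspace X" "b \<in> topspace X" using a b F(2) by auto
    have "D n x y \<le> D n a x + D n a b + D n b y"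
      using D_triangle[OF xy(1) M(1) xy(2), of n] D_triangle[OF M xy(2), of n] D_sym[of n x a] by linarith
    moreover have "D n a x < e / 8" "D n b y < e / 8"
      using D_le[OF M(1) xy(1), of n] D_le[OF M(2) xy(2), of n] a b by linarith+
    moreover have "D n a b < \<rho> (leaf a) (leaf b) + e / 2" using n a b by blast
    moreover have "\<rho> (leaf a) (leaf b) \<le> \<rho> (leaf a) (leaf x) + (\<rho> (leaf x) (leaf y) + \<rho> (leaf y) (leaf b))"
      using rho_triangle[OF leaf_in[OF M(1)] leaf_in[OF xy(1)] leaf_in[OF M(2)]]
        rho_triangle[OF leaf_in[OF xy(1)] leaf_in[OF xy(2)] leaf_in[OF M(2)]] by linarith
    moreover have "\<rho> (leaf a) (leaf x) < e / 8" "\<rho> (leaf y) (leaf b) < e / 8"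
      using rho_le_dist[OF M(1) xy(1)] rho_le_dist[OF xy(2) M(2)] dist_sym[of y b] a b by linarith+
    ultimately show "D n x y \<le> \<rho> (leaf x) (leaf y) + e" using \<open>e > 0\<close> by linarith
  qed
qed

lemma HLS_compact: "compact_metric_space (HLS (leaves X A T) (riemannian_dist A g))
    (HLS_dist (leaves X A T) (riemannian_dist A g))"
proof (rule compact_metric_space_image[OF compact topspace_nonempty HLS_eq[symmetric] HLS_Metric_space])
  fix x and r :: real assume x: "x \<in> topspace X" and "r > 0"
  let ?U = "{y \<in> topspace X. riemannian_dist A g x y < r}"
  have "HLS_dist (leaves X A T) (riemannian_dist A g) (proj x) (proj y) < r" if "y \<in> ?U" for y
    using that rho_le_dist[OF x, of y] HLS_dist_proj[OF x, of y] by auto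
  moreover have "openin X ?U" "x \<in> ?U"
    using openin_dist_ball[OF x] x dist_refl[OF x] \<open>r > 0\<close> by auto
  ultimately show "\<exists>U. openin X U \<and> x \<in> U \<and>
      (\<forall>y\<in>U. HLS_dist (leaves X A T) (riemannian_dist A g) (proj x) (proj y) < r)" by blast
qed

lemma GH_limit_HLS:
  "GH_limit (\<lambda>n. topspace X) D (HLS (leaves X A T) (riemannian_dist A g))
    (HLS_dist (leaves X A T) (riemannian_dist A g))"
  unfolding GH_limit_def
proof (intro conjI allI HLS_compact)
  show "compact_metric_space (topspace X) (D n)" for n
    by (rule warped_foliation.warped_compact[OF warped])
  let ?N = "HLS (leaves X A T) (riemannian_dist A g)"
  let ?e = "HLS_dist (leaves X A T) (riemannian_dist A g)"
  obtain K where K: "\<And>x y. x \<in> topspace X \<Longrightarrow> y \<in> topspace X \<Longrightarrow> riemannian_dist A g x y \<le> K"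
    using dist_bounded by blast
  have DK: "D n x y \<le> K" if "x \<in> topspace X" "y \<in> topspace X" for n x y
    using D_le[OF that, of n] K[OF that] by linarith
  have "\<forall>\<^sub>F n in sequentially. 0 \<le> GH_dist (topspace X) (D n) ?N ?e \<and>
      GH_dist (topspace X) (D n) ?N ?e \<le> 2 * \<epsilon>" if "\<epsilon> > 0" for \<epsilon>
  proof -
    have "2 * \<epsilon> > 0" using that by simp
    from D_uniform[OF this] show ?thesis
    proof (rule eventually_mono)
      fix n assume n: "\<forall>x\<in>topspace X. \<forall>y\<in>topspace X. D n x y \<le> \<rho> (leaf x) (leaf y) + 2 * \<epsilon>"
      have lower: "?e (proj x) (proj y) \<le> D n x y" if "x \<in> topspace X" "y \<in> topspace X" for x y
        unfolding HLS_dist_proj[OF that] by (rule warped_foliation.rho_le_warped_dist[OF warped that])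
      have upper: "D n x y \<le> ?e (proj x) (proj y) + 2 * \<epsilon>" if "x \<in> topspace X" "y \<in> topspace X" for x y
        unfolding HLS_dist_proj[OF that] using n that by blast
      show "0 \<le> GH_dist (topspace X) (D n) ?N ?e \<and> GH_dist (topspace X) (D n) ?N ?e \<le> 2 * \<epsilon>"
        using GH_dist_bounds[OF warped_foliation.warped_Metric_space[OF warped] topspace_nonempty DK
            HLS_Metric_space HLS_eq[symmetric] lower upper \<open>\<epsilon> > 0\<close>] by blast
    qed
  qed
  note ev = this
  show "(\<lambda>n. GH_dist (topspace X) (D n) ?N ?e) \<longlonglongrightarrow> 0"
  proof (rule tendstoI)
    fix r :: real assume "r > 0"
    \<comment> \<open>With this choice the bound is \<open>r / 2\<close>, strictly below
      \<open>r\<close>.\<close>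
    then have "r / 4 > 0" by simp
    from ev[OF this] show "\<forall>\<^sub>F n in sequentially. dist (GH_dist (topspace X) (D n) ?N ?e) 0 < r"
      by (rule eventually_mono) (use \<open>r > 0\<close> in \<open>auto simp: dist_real_def\<close>)
  qed
qed

end

theorem theorem3p1:
  fixes X :: "'a topology"
    and A :: "('a, 'e::euclidean_space) chart set"
    and T :: "'e set"
    and g :: "('a, 'e) tensor2"
    and G :: "'a set"
    and f :: "nat \<Rightarrow> 'a \<Rightarrow> real"
  assumes "foliated_riemannian_manifold X A T g"
    and "compact_space X" and "connected_space X"
    and "G \<subseteq> topspace X" and "X closure_of G = topspace X"
    and "\<And>n. warping_function X A T (f n)"
    and "\<And>n x. x \<in> topspace X \<Longrightarrow> f n x \<in> {0<..<1}"
    and "\<And>x. x \<in> G \<Longrightarrow> (\<lambda>n. f n x) \<longlonglongrightarrow> 0"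
  shows "GH_limit (\<lambda>n. topspace X) (\<lambda>n. riemannian_dist A (warped_metric T (f n) g))
           (HLS (leaves X A T) (riemannian_dist A g))
           (HLS_dist (leaves X A T) (riemannian_dist A g))"
proof -
  interpret compact_foliated_manifold X A T g
    using assms(1-3) by unfold_locales
  interpret warped_sequence X A T g f G
  proof (unfold_locales)
    show "warping_function X A T (f n)" for n by (rule assms(6))
  qed (use assms in auto)
  show ?thesis by (rule GH_limit_HLS)
qed

end
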